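(* Let $\varphi: M^2\hookrightarrow\mathbb{S}^3$ be a $c$-biharmonic surface. If $M^2$ has constant scalar curvature then, up to isometries, it is an open subset of one of the following: (i) the totally geodesic $\mathbb{S}^2$ or the small hypersphere $\mathbb{S}^2\left(\frac{1}{\sqrt3}\right)$; (ii) the minimal Clifford torus $\mathbb{S}^1\left(\frac{1}{\sqrt2}\right)\times\mathbb{S}^1\left(\frac{1}{\sqrt2}\right)$.
   Context: $\mathbb{S}^n$ is the unit sphere in $\mathbb{R}^{n+1}$ and $\mathbb{S}^n(r)$ is the round $n$-sphere of radius $r$. For $r<1$ the small hypersphere $\mathbb{S}^m(r)\subset\mathbb{S}^{m+1}$ is the intersection of $\mathbb{S}^{m+1}$ with a hyperplane at distance $\sqrt{1-r^2}$ from the origin; for $r_1^2+r_2^2=1$, the extrinsic product $\mathbb{S}^{p}(r_1)\times\mathbb{S}^{q}(r_2)\subset\mathbb{R}^{p+1}\times\mathbb{R}^{q+1}$ is a hypersurface of $\mathbb{S}^{p+q+1}$. Conventions: $R(X,Y)Z=[\nabla_X,\nabla_Y]Z-\nabla_{[X,Y]}Z$; $g(\mathrm{Ric}(X),Y)=\mathrm{Ric}(X,Y)=\mathrm{Tr}\{Z\mapsto R(Z,X)Y\}$; $\mathrm{Scal}=\mathrm{Tr}\,\mathrm{Ric}$; traces are taken with respect to the domain metric. $c$-biharmonic maps: for a smooth map $\phi:(M^m,g)\to(N^n,h)$ of Riemannian manifolds, let $\bar\nabla$ be the connection on $\phi^{-1}TN$, $\tau(\phi)=\mathrm{Tr}\,\bar\nabla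 d\phi$ the tension field, $\bar\Delta=-\mathrm{Tr}(\bar\nabla\bar\nabla-\bar\nabla_{\nabla})$ the rough Laplacian on $\phi^{-1}TN$, and $\tau_2(\phi)=-\bar\Delta\tau(\phi)-\mathrm{Tr}\,R^N(d\phi(\cdot),\tau(\phi))d\phi(\cdot)$ the bitension field. The map $\phi$ is $c$-biharmonic (conformal-biharmonic) if $$\tau_2^c(\phi):=\tau_2(\phi)-\tfrac23\,\mathrm{Scal}\,\tau(\phi)+2\,\mathrm{Tr}(\bar\nabla d\phi)(\mathrm{Ric}(\cdot),\cdot)+\tfrac13 d\phi(\nabla\mathrm{Scal})=0,$$ where $\mathrm{Scal}$ and $\mathrm{Ric}$ are those of $(M,g)$. A $c$-biharmonic hypersurface (surface, if $m=2$) is a codimension-one isometric immersion that is a $c$-biharmonic map. All hypersurfaces are oriented and without boundary.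
   Formalization: The surface M² is assumed connected; otherwise two disjoint discs on different great spheres would be a c-biharmonic surface of constant scalar curvature that is not an open subset of a single model. *)

theory Defs
  imports "HOL-Analysis.Analysis"
begin

section \<open>Smooth functions on open subsets of Euclidean space\<close>

definition pderiv_at :: "'m::finite \<Rightarrow> (real^'m \<Rightarrow> 'b::real_normed_vector) \<Rightarrow> real^'m \<Rightarrow> 'b" where
  "pderiv_at i f = (\<lambda>x. frechet_derivative f (at x) (axis i 1))"

(* Only used for open V.  All iterated partial derivatives exist and are differentiable,
   hence continuous; this is C^infinity on V. *)
definition smooth_on :: "(real^'m::finite) set \<Rightarrow> (real^'m \<Rightarrow> 'b::real_normed_vector) \<Rightarrow> bool" where
  "smooth_on V f \<longleftrightarrow> (\<forall>js :: 'm list. (foldr pderiv_at js f) differentiable_on V)"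


section \<open>Riemannian manifolds\<close>

text \<open>A chart is a pair of an open domain and a coordinate map; the values of the coordinate
  map outside the domain are irrelevant.\<close>

type_synonym ('a, 'm) chart = "'a set \<times> ('a \<Rightarrow> real^'m)"

abbreviation cdom :: "('a, 'm::finite) chart \<Rightarrow> 'a set" where
  "cdom c \<equiv> fst c"

abbreviation coord :: "('a, 'm::finite) chart \<Rightarrow> 'a \<Rightarrow> real^'m" where
  "coord c \<equiv> snd c"

definition cimage :: "('a, 'm::finite) chart \<Rightarrow> (real^'m) set" where
  "cimage c = coord c ` cdom c"

definition param :: "('a, 'm::finite) chart \<Rightarrow> real^'m \<Rightarrow> 'a" where
  "param c = the_inv_into (cdom c) (coord c)"

definition is_chart :: "'a topology \<Rightarrow> ('a, 'm::finite) chart \<Rightarrow> bool" where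
  "is_chart T c \<longleftrightarrow> openin T (cdom c) \<and> open (cimage c) \<and>
     homeomorphic_map (subtopology T (cdom c)) (top_of_set (cimage c)) (coord c)"

definition transition :: "('a, 'm::finite) chart \<Rightarrow> ('a, 'm) chart \<Rightarrow> real^'m \<Rightarrow> real^'m" where
  "transition c d = coord d \<circ> param c"

text \<open>The metric is recorded by its component matrices: \<open>metric M c x\<close> is the matrix
  \<open>(g\<^sub>i\<^sub>j)\<close> in the chart \<open>c\<close> at the point with coordinates \<open>x \<in> cimage c\<close>.\<close>

record ('a, 'm) riem =
  mtop :: "'a topology"
  atlas :: "('a, 'm) chart set"
  metric :: "('a, 'm) chart \<Rightarrow> real^'m \<Rightarrow> real^'m^'m"

definition smooth_manifold :: "('a, 'm::finite) riem \<Rightarrow> bool" where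
  "smooth_manifold M \<longleftrightarrow>
     Hausdorff_space (mtop M) \<and> second_countable (mtop M) \<and>
     (\<forall>c\<in>atlas M. is_chart (mtop M) c) \<and>
     (\<Union>c\<in>atlas M. cdom c) = topspace (mtop M) \<and>
     (\<forall>c\<in>atlas M. \<forall>d\<in>atlas M. smooth_on (coord c ` (cdom c \<inter> cdom d)) (transition c d))"

definition riemannian_manifold :: "('a, 'm::finite) riem \<Rightarrow> bool" where
  "riemannian_manifold M \<longleftrightarrow>
     smooth_manifold M \<and>
     (\<forall>c\<in>atlas M. smooth_on (cimage c) (metric M c) \<and>
        (\<forall>x\<in>cimage c. transpose (metric M c x) = metric M c x \<and>
           (\<forall>v. v \<noteq> 0 \<longrightarrow> v \<bullet> (metric M c x *v v) > 0))) \<and>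
     (\<forall>c\<in>atlas M. \<forall>d\<in>atlas M. \<forall>p\<in>cdom c \<inter> cdom d.
        let J = jacobian (transition c d) (at (coord c p))
        in metric M c (coord c p) = transpose J ** metric M d (coord d p) ** J)"

definition oriented :: "('a, 'm::finite) riem \<Rightarrow> bool" where
  "oriented M \<longleftrightarrow> (\<forall>c\<in>atlas M. \<forall>d\<in>atlas M. \<forall>p\<in>cdom c \<inter> cdom d.
     det (jacobian (transition c d) (at (coord c p))) > 0)"

text \<open>An embedded submanifold \<open>S\<close> of a Euclidean space, with the metric induced by the ambient
  inner product.  The atlas consists of all charts whose inverse is a smooth immersion into the
  ambient space.\<close>

definition induced_riem :: "'a::euclidean_space set \<Rightarrow> ('a, 'm::finite) riem" where
  "induced_riem S =
     \<lparr> mtop = top_of_set S,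
       atlas = {c. is_chart (top_of_set S) c \<and> smooth_on (cimage c) (param c) \<and>
                   (\<forall>x\<in>cimage c. inj (frechet_derivative (param c) (at x)))},
       metric = (\<lambda>c x. \<chi> i j. pderiv_at i (param c) x \<bullet> pderiv_at j (param c) x) \<rparr>"


section \<open>Levi-Civita connection and curvature of a metric on an open set of coordinates\<close>

definition christoffel :: "(real^'m::finite \<Rightarrow> real^'m^'m) \<Rightarrow> 'm \<Rightarrow> 'm \<Rightarrow> 'm \<Rightarrow> real^'m \<Rightarrow> real" where
  "christoffel g k i j x = (1/2) * (\<Sum>l\<in>UNIV. matrix_inv (g x) $ k $ l *
     (pderiv_at i (\<lambda>y. g y $ j $ l) x + pderiv_at j (\<lambda>y. g y $ i $ l) x
      - pderiv_at l (\<lambda>y. g y $ i $ j) x))"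

(* The component along the l-th coordinate field of R(e_i, e_j) e_k,
   where R(X,Y)Z = [nabla_X, nabla_Y] Z - nabla_[X,Y] Z. *)
definition curv_coeff ::
    "(real^'m::finite \<Rightarrow> real^'m^'m) \<Rightarrow> 'm \<Rightarrow> 'm \<Rightarrow> 'm \<Rightarrow> 'm \<Rightarrow> real^'m \<Rightarrow> real" where
  "curv_coeff g l i j k x =
     pderiv_at i (christoffel g l j k) x - pderiv_at j (christoffel g l i k) x
     + (\<Sum>p\<in>UNIV. christoffel g l i p x * christoffel g p j k x
                - christoffel g l j p x * christoffel g p i k x)"

definition curv ::
    "(real^'m::finite \<Rightarrow> real^'m^'m) \<Rightarrow> real^'m \<Rightarrow> real^'m \<Rightarrow> real^'m \<Rightarrow> real^'m \<Rightarrow> real^'m" where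
  "curv g x X Y Z =
     (\<chi> l. \<Sum>i\<in>UNIV. \<Sum>j\<in>UNIV. \<Sum>k\<in>UNIV. curv_coeff g l i j k x * X $ i * Y $ j * Z $ k)"

text \<open>\<open>Ric(X, Y)\<close> is the trace of \<open>Z \<mapsto> R(Z, X) Y\<close>.\<close>

definition ricci :: "(real^'m::finite \<Rightarrow> real^'m^'m) \<Rightarrow> real^'m \<Rightarrow> real^'m \<Rightarrow> real^'m \<Rightarrow> real" where
  "ricci g x X Y = trace (matrix (\<lambda>Z. curv g x Z X Y))"

text \<open>The endomorphism determined by \<open>g (Ric X, Y) = Ric (X, Y)\<close>.\<close>

definition ricci_op :: "(real^'m::finite \<Rightarrow> real^'m^'m) \<Rightarrow> real^'m \<Rightarrow> real^'m \<Rightarrow> real^'m" where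
  "ricci_op g x X = matrix_inv (g x) *v (\<chi> l. ricci g x X (axis l 1))"

definition scal :: "(real^'m::finite \<Rightarrow> real^'m^'m) \<Rightarrow> real^'m \<Rightarrow> real" where
  "scal g x = trace (matrix (ricci_op g x))"

definition grad :: "(real^'m::finite \<Rightarrow> real^'m^'m) \<Rightarrow> (real^'m \<Rightarrow> real) \<Rightarrow> real^'m \<Rightarrow> real^'m" where
  "grad g u x = matrix_inv (g x) *v (\<chi> l. pderiv_at l u x)"

definition gtrace ::
    "(real^'m::finite \<Rightarrow> real^'m^'m) \<Rightarrow> real^'m \<Rightarrow> ('m \<Rightarrow> 'm \<Rightarrow> 'b::real_vector) \<Rightarrow> 'b" where
  "gtrace g x B = (\<Sum>i\<in>UNIV. \<Sum>j\<in>UNIV. (matrix_inv (g x) $ i $ j) *\<^sub>R B i j)"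


section \<open>The c-bitension field in coordinates\<close>

text \<open>Here \<open>f\<close> is the coordinate expression of a map, \<open>g\<close> and \<open>h\<close> are the metrics of domain and
  target in these coordinates, and a section \<open>V\<close> of the pull-back of the tangent bundle of the
  target is given by its components with respect to the coordinate fields of the target.\<close>

definition cov_along ::
    "(real^'n::finite \<Rightarrow> real^'n^'n) \<Rightarrow> (real^'m::finite \<Rightarrow> real^'n) \<Rightarrow> 'm \<Rightarrow>
     (real^'m \<Rightarrow> real^'n) \<Rightarrow> real^'m \<Rightarrow> real^'n" where
  "cov_along h f i V x = pderiv_at i V x +
     (\<chi> c. \<Sum>a\<in>UNIV. \<Sum>b\<in>UNIV. christoffel h c a b (f x) * pderiv_at i f x $ a * V x $ b)"

text \<open>The value of the second fundamental form of \<open>f\<close> (the covariant derivative of \<open>df\<close>) on the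
  \<open>i\<close>-th and \<open>j\<close>-th coordinate fields.\<close>

definition hess_map ::
    "(real^'m::finite \<Rightarrow> real^'m^'m) \<Rightarrow> (real^'n::finite \<Rightarrow> real^'n^'n) \<Rightarrow> (real^'m \<Rightarrow> real^'n) \<Rightarrow>
     'm \<Rightarrow> 'm \<Rightarrow> real^'m \<Rightarrow> real^'n" where
  "hess_map g h f i j x = cov_along h f i (pderiv_at j f) x
     - (\<Sum>k\<in>UNIV. christoffel g k i j x *\<^sub>R pderiv_at k f x)"

definition tension ::
    "(real^'m::finite \<Rightarrow> real^'m^'m) \<Rightarrow> (real^'n::finite \<Rightarrow> real^'n^'n) \<Rightarrow> (real^'m \<Rightarrow> real^'n) \<Rightarrow>
     real^'m \<Rightarrow> real^'n" where
  "tension g h f x = gtrace g x (\<lambda>i j. hess_map g h f i j x)"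

definition rough_laplacian ::
    "(real^'m::finite \<Rightarrow> real^'m^'m) \<Rightarrow> (real^'n::finite \<Rightarrow> real^'n^'n) \<Rightarrow> (real^'m \<Rightarrow> real^'n) \<Rightarrow>
     (real^'m \<Rightarrow> real^'n) \<Rightarrow> real^'m \<Rightarrow> real^'n" where
  "rough_laplacian g h f V x = - gtrace g x (\<lambda>i j. cov_along h f i (cov_along h f j V) x
     - (\<Sum>k\<in>UNIV. christoffel g k i j x *\<^sub>R cov_along h f k V x))"

definition bitension ::
    "(real^'m::finite \<Rightarrow> real^'m^'m) \<Rightarrow> (real^'n::finite \<Rightarrow> real^'n^'n) \<Rightarrow> (real^'m \<Rightarrow> real^'n) \<Rightarrow>
     real^'m \<Rightarrow> real^'n" where
  "bitension g h f x = - rough_laplacian g h f (tension g h f) x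
     - gtrace g x (\<lambda>i j. curv h (f x) (pderiv_at i f x) (tension g h f x) (pderiv_at j f x))"

(* The third term is the trace of (X, Y) |-> (nabla df)(Ric X, Y); Ric e_i is expanded in the
   coordinate fields e_k. *)
definition c_bitension ::
    "(real^'m::finite \<Rightarrow> real^'m^'m) \<Rightarrow> (real^'n::finite \<Rightarrow> real^'n^'n) \<Rightarrow> (real^'m \<Rightarrow> real^'n) \<Rightarrow>
     real^'m \<Rightarrow> real^'n" where
  "c_bitension g h f x = bitension g h f x
     - ((2/3) * scal g x) *\<^sub>R tension g h f x
     + 2 *\<^sub>R gtrace g x (\<lambda>i j. \<Sum>k\<in>UNIV. (ricci_op g x (axis i 1) $ k) *\<^sub>R hess_map g h f k j x)
     + (1/3) *\<^sub>R frechet_derivative f (at x) (grad g (scal g) x)"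


section \<open>c-biharmonic maps and hypersurfaces\<close>

definition local_rep ::
    "('a, 'm::finite) chart \<Rightarrow> ('b, 'n::finite) chart \<Rightarrow> ('a \<Rightarrow> 'b) \<Rightarrow> real^'m \<Rightarrow> real^'n" where
  "local_rep c d \<phi> = coord d \<circ> \<phi> \<circ> param c"

definition smooth_map ::
    "('a, 'm::finite) riem \<Rightarrow> ('b, 'n::finite) riem \<Rightarrow> ('a \<Rightarrow> 'b) \<Rightarrow> bool" where
  "smooth_map M N \<phi> \<longleftrightarrow> continuous_map (mtop M) (mtop N) \<phi> \<and>
     (\<forall>c\<in>atlas M. \<forall>d\<in>atlas N.
        smooth_on (coord c ` {p \<in> cdom c. \<phi> p \<in> cdom d}) (local_rep c d \<phi>))"

definition isometric_immersion ::
    "('a, 'm::finite) riem \<Rightarrow> ('b, 'n::finite) riem \<Rightarrow> ('a \<Rightarrow> 'b) \<Rightarrow> bool" where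
  "isometric_immersion M N \<phi> \<longleftrightarrow> smooth_map M N \<phi> \<and>
     (\<forall>c\<in>atlas M. \<forall>d\<in>atlas N. \<forall>p\<in>cdom c. \<phi> p \<in> cdom d \<longrightarrow>
        (let D = jacobian (local_rep c d \<phi>) (at (coord c p))
         in inj ((*v) D) \<and>
            metric M c (coord c p) = transpose D ** metric N d (coord d (\<phi> p)) ** D))"

definition c_biharmonic ::
    "('a, 'm::finite) riem \<Rightarrow> ('b, 'n::finite) riem \<Rightarrow> ('a \<Rightarrow> 'b) \<Rightarrow> bool" where
  "c_biharmonic M N \<phi> \<longleftrightarrow> smooth_map M N \<phi> \<and>
     (\<forall>c\<in>atlas M. \<forall>d\<in>atlas N. \<forall>p\<in>cdom c. \<phi> p \<in> cdom d \<longrightarrow>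
        c_bitension (metric M c) (metric N d) (local_rep c d \<phi>) (coord c p) = 0)"

text \<open>Codimension one; the hypersurface is connected, oriented and without boundary (all charts
  are onto open subsets of \<open>real^'m\<close>).\<close>

definition c_biharmonic_hypersurface ::
    "('a, 'm::finite) riem \<Rightarrow> ('b, 'n::finite) riem \<Rightarrow> ('a \<Rightarrow> 'b) \<Rightarrow> bool" where
  "c_biharmonic_hypersurface M N \<phi> \<longleftrightarrow>
     CARD('n) = CARD('m) + 1 \<and>
     riemannian_manifold M \<and> connected_space (mtop M) \<and> oriented M \<and>
     isometric_immersion M N \<phi> \<and> c_biharmonic M N \<phi>"

definition constant_scalar_curvature :: "('a, 'm::finite) riem \<Rightarrow> bool" where
  "constant_scalar_curvature M \<longleftrightarrow>
     (\<exists>K. \<forall>c\<in>atlas M. \<forall>p\<in>cdom c. scal (metric M c) (coord c p) = K)"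


section \<open>The model surfaces in the unit 3-sphere\<close>

definition S3 :: "(real^4, 3) riem" where
  "S3 = induced_riem (sphere 0 1)"

definition totally_geodesic_S2 :: "(real^4) set" where
  "totally_geodesic_S2 = {x \<in> sphere 0 1. x $ 4 = 0}"

text \<open>The intersection with a hyperplane at distance \<open>sqrt (1 - r\<^sup>2)\<close> from the origin.\<close>

definition small_S2 :: "real \<Rightarrow> (real^4) set" where
  "small_S2 r = {x \<in> sphere 0 1. x $ 4 = sqrt (1 - r\<^sup>2)}"

text \<open>The extrinsic product of circles of radii \<open>r\<close> and \<open>s\<close>, contained in the unit sphere when
  \<open>r\<^sup>2 + s\<^sup>2 = 1\<close>.\<close>

definition product_torus :: "real \<Rightarrow> real \<Rightarrow> (real^4) set" where
  "product_torus r s = {x. (x $ 1)\<^sup>2 + (x $ 2)\<^sup>2 = r\<^sup>2 \<and> (x $ 3)\<^sup>2 + (x $ 4)\<^sup>2 = s\<^sup>2}"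

text \<open>Isometries of the unit sphere are the restrictions of orthogonal transformations.\<close>

definition open_part_up_to_isometry :: "(real^4) set \<Rightarrow> (real^4) set \<Rightarrow> bool" where
  "open_part_up_to_isometry X S \<longleftrightarrow>
     (\<exists>A. orthogonal_transformation A \<and> openin (top_of_set S) (A ` X))"

end

theory Submission
  imports Defs
begin

text \<open>
  In the ambient \<open>\<real>\<^sup>4\<close> the second fundamental form \<open>h\<close> of the surface has trace \<open>u\<close> and, by the Gauss
  equation, determinant \<open>D = K - 1\<close> with \<open>K\<close> the constant Gauss curvature; since \<open>Ric = K g\<close>, the
  c-bitension field is the bitension field plus \<open>(2/3) K\<close> times the tension field \<open>u \<eta>\<close>.  The
  tangential part of the equation makes \<open>- u / 2\<close> a principal curvature wherever \<open>du \<noteq> 0\<close>, whence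
  \<open>4 D + 3 u\<^sup>2 = 0\<close> there; as \<open>D\<close> is constant, \<open>u\<close> is constant.  The normal part then reads
  \<open>u (2 + 2 K / 3 - u\<^sup>2 + 2 D) = 0\<close>.  At a point that is not umbilic the Codazzi equation and the
  constancy of \<open>u\<close> and \<open>D\<close> give \<open>\<nabla> h = 0\<close> and therefore \<open>K = 0\<close>.  Hence either \<open>K = 0\<close>, \<open>u = 0\<close>, or
  the surface is umbilic with \<open>K = 1\<close> or \<open>K = 3\<close>.  In the umbilic cases \<open>\<eta> + (u / 2) F\<close> is a constant
  vector; in the flat case a quadratic form built from the frame is constant and vanishes on the
  surface.  Finally the image is open in the level set so obtained, by projection to a tangent plane.
\<close>

section \<open>Smooth functions\<close>

text \<open>The obstacle is that the c-bitension field is written in arbitrary charts of both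
  manifolds. Applying the differential of the inverse sphere chart (\<open>push\<close>) removes the
  target charts: covariant derivatives along the map become ordinary derivatives in R^4 followed by
  projection orthogonal to \<open>F\<close>. The locale \<open>immersion\<close> serves both the
  surface and the charts of the sphere, so one Gauss equation gives both curvatures. Principal
  directions are never chosen as fields, since they need not be smooth; facts about them are
  polynomial identities in the entries of g and h with det g cleared. If one principal curvature is
  - u / 2, the other is 3 u / 2, hence D = - 3 u^2 / 4. As D = K - 1, the normal equation is u (8 K
  / 3 - u^2) = 0, and umbilicity adds u^2 = 4 (K - 1). Away from umbilics, constancy of u and D
  makes g and h annihilate the symmetric cubic form given by the covariant derivative of h; as g and
  h are not proportional there, it vanishes. The orientation makes the unit normals agree on
  overlaps, so that local constants glue over the connected surface.\<close>

lemma pderiv_at_cong: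
  assumes "open V" "x \<in> V" "\<And>y. y \<in> V \<Longrightarrow> f y = g y"
  shows "pderiv_at i f x = pderiv_at i g x"
proof -
  have "(f has_derivative D) (at x) \<longleftrightarrow> (g has_derivative D) (at x)" for D
    using has_derivative_transform_within_open[where f = f and g = g and s = V and x = x]
      has_derivative_transform_within_open[where f = g and g = f and s = V and x = x] assms by metis
  then show ?thesis by (simp add: pderiv_at_def frechet_derivative_def)
qed

lemma pderiv_at_has_derivative:
  "(f has_derivative D) (at x) \<Longrightarrow> pderiv_at i f x = D (axis i 1)"
  by (metis frechet_derivative_at pderiv_at_def)

lemma linear_eq_sum_axis:
  fixes D :: "real^'m::finite \<Rightarrow> 'b::real_vector"
  assumes "linear D"
  shows "D v = (\<Sum>i\<in>UNIV. v $ i *\<^sub>R D (axis i 1))"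
proof -
  have "D v = D (\<Sum>i\<in>UNIV. v $ i *\<^sub>R axis i 1)"
    using basis_expansion[of v] by (simp add: scalar_mult_eq_scaleR)
  also have "\<dots> = (\<Sum>i\<in>UNIV. v $ i *\<^sub>R D (axis i 1))"
    by (simp add: linear_sum[OF assms] linear_cmul[OF assms])
  finally show ?thesis .
qed

lemma frechet_derivative_eq_sum:
  assumes "f differentiable (at x)"
  shows "frechet_derivative f (at x) v = (\<Sum>i\<in>UNIV. v $ i *\<^sub>R pderiv_at i f x)"
  unfolding pderiv_at_def by (rule linear_eq_sum_axis[OF linear_frechet_derivative[OF assms]])

lemma has_derivative_pderiv:
  assumes "f differentiable (at x)"
  shows "(f has_derivative (\<lambda>v. \<Sum>i\<in>UNIV. v $ i *\<^sub>R pderiv_at i f x)) (at x)"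
  using assms[unfolded frechet_derivative_works]
  by (simp add: frechet_derivative_eq_sum[OF assms, symmetric])

lemma pderiv_at_const [simp]: "pderiv_at i (\<lambda>_. c) = (\<lambda>_. 0)"
  by (simp add: pderiv_at_def)

lemma pderiv_at_bounded_linear:
  assumes "bounded_linear L" "f differentiable (at x)"
  shows "pderiv_at i (\<lambda>y. L (f y)) x = L (pderiv_at i f x)"
  using pderiv_at_has_derivative[OF bounded_linear.has_derivative[OF assms(1)
      assms(2)[unfolded frechet_derivative_works]]] by (simp add: pderiv_at_def)

lemma pderiv_at_bilinear:
  assumes "bounded_bilinear B" "f differentiable (at x)" "g differentiable (at x)"
  shows "pderiv_at i (\<lambda>y. B (f y) (g y)) x = B (f x) (pderiv_at i g x) + B (pderiv_at i f x) (g x)"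
  using pderiv_at_has_derivative[OF bounded_bilinear.FDERIV[OF assms(1)
      assms(2,3)[unfolded frechet_derivative_works]]] by (simp add: pderiv_at_def)

lemma differentiable_bilinear:
  assumes "bounded_bilinear B" "f differentiable (at x)" "g differentiable (at x)"
  shows "(\<lambda>y. B (f y) (g y)) differentiable (at x)"
  using bounded_bilinear.FDERIV[OF assms(1) assms(2,3)[unfolded frechet_derivative_works]]
  by (auto simp: differentiable_def)

lemma differentiable_bounded_linear:
  assumes "bounded_linear L" "f differentiable (at x)"
  shows "(\<lambda>y. L (f y)) differentiable (at x)"
  using bounded_linear.has_derivative[OF assms(1) assms(2)[unfolded frechet_derivative_works]]
  by (auto simp: differentiable_def)

lemma pderiv_at_add:
  assumes "f differentiable (at x)" "g differentiable (at x)"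
  shows "pderiv_at i (\<lambda>y. f y + g y) x = pderiv_at i f x + pderiv_at i g x"
  using pderiv_at_has_derivative[OF has_derivative_add[OF assms[unfolded frechet_derivative_works]]]
  by (simp add: pderiv_at_def)

lemma pderiv_at_diff:
  assumes "f differentiable (at x)" "g differentiable (at x)"
  shows "pderiv_at i (\<lambda>y. f y - g y) x = pderiv_at i f x - pderiv_at i g x"
  using pderiv_at_has_derivative[OF has_derivative_diff[OF assms[unfolded frechet_derivative_works]]]
  by (simp add: pderiv_at_def)

lemma pderiv_at_minus:
  assumes "f differentiable (at x)"
  shows "pderiv_at i (\<lambda>y. - f y) x = - pderiv_at i f x"
  using pderiv_at_has_derivative[OF has_derivative_minus[OF assms[unfolded frechet_derivative_works]]]
  by (simp add: pderiv_at_def)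

lemma pderiv_at_sum:
  assumes "\<And>k. k \<in> S \<Longrightarrow> f k differentiable (at x)"
  shows "pderiv_at i (\<lambda>y. \<Sum>k\<in>S. f k y) x = (\<Sum>k\<in>S. pderiv_at i (f k) x)"
  using pderiv_at_has_derivative[OF has_derivative_sum[of S f "\<lambda>k. frechet_derivative (f k) (at x)"]] assms
  by (simp add: pderiv_at_def frechet_derivative_works)

lemmas pderiv_at_mult = pderiv_at_bilinear[OF bounded_bilinear_mult]
lemmas pderiv_at_scaleR = pderiv_at_bilinear[OF bounded_bilinear_scaleR]
lemmas pderiv_at_inner = pderiv_at_bilinear[OF bounded_bilinear_inner]
lemmas differentiable_scaleR' = differentiable_bilinear[OF bounded_bilinear_scaleR]

lemma pderiv_at_nth:
  fixes f :: "real^'m::finite \<Rightarrow> real^'n::finite"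
  assumes "f differentiable (at x)"
  shows "pderiv_at i (\<lambda>y. f y $ a) x = pderiv_at i f x $ a"
  by (rule pderiv_at_bounded_linear[OF bounded_linear_vec_nth assms])

lemma pderiv_at_compose:
  fixes g :: "real^'n::finite \<Rightarrow> 'b::real_normed_vector" and f :: "real^'m::finite \<Rightarrow> real^'n"
  assumes "f differentiable (at x)" "g differentiable (at (f x))"
  shows "pderiv_at i (\<lambda>y. g (f y)) x = (\<Sum>a\<in>UNIV. pderiv_at i f x $ a *\<^sub>R pderiv_at a g (f x))"
proof -
  have "((\<lambda>y. g (f y)) has_derivative
      (\<lambda>v. frechet_derivative g (at (f x)) (frechet_derivative f (at x) v))) (at x)"
    using diff_chain_at[OF assms[unfolded frechet_derivative_works]] by (simp add: o_def)
  from pderiv_at_has_derivative[OF this]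
  show ?thesis by (simp add: frechet_derivative_eq_sum[OF assms(2)]) (simp add: pderiv_at_def)
qed

primrec Ck :: "nat \<Rightarrow> (real^'m::finite) set \<Rightarrow> (real^'m \<Rightarrow> 'b::real_normed_vector) \<Rightarrow> bool" where
  "Ck 0 V f \<longleftrightarrow> f differentiable_on V"
| "Ck (Suc n) V f \<longleftrightarrow> f differentiable_on V \<and> (\<forall>i. Ck n V (pderiv_at i f))"

declare Ck.simps(2) [simp del]

lemma Ck_pderiv: "Ck (Suc n) V f \<Longrightarrow> Ck n V (pderiv_at i f)"
  by (simp add: Ck.simps(2))

text \<open>The recursive form \<open>Ck\<close> replaces the quantifier over index lists in
  \<open>smooth_on\<close> because closure under products, composition and inverses needs an
  induction on the order.\<close>

lemma Ck_iff:
  "Ck n V f \<longleftrightarrow> (\<forall>js. length js \<le> n \<longrightarrow> foldr pderiv_at js f differentiable_on V)"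
proof (induction n arbitrary: f)
  case (Suc n)
  have "(\<forall>js. length js \<le> Suc n \<longrightarrow> foldr pderiv_at js f differentiable_on V) \<longleftrightarrow>
     f differentiable_on V \<and>
     (\<forall>i js. length js \<le> n \<longrightarrow> foldr pderiv_at js (pderiv_at i f) differentiable_on V)" (is "?l = ?r")
  proof
    assume l: ?l
    have "foldr pderiv_at js (pderiv_at i f) differentiable_on V" if "length js \<le> n" for i js
      using l[rule_format, of "js @ [i]"] that by simp
    then show ?r using l[rule_format, of "[]"] by simp
  next
    assume r: ?r
    have "foldr pderiv_at js f differentiable_on V" if "length js \<le> Suc n" for js
      \<comment> \<open>\<open>foldr\<close> applies the last index of the list first, so the first
        differentiation is split off at the end.\<close>
      using that r by (cases js rule: rev_cases) auto
    then show ?l by blast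
  qed
  then show ?case by (simp add: Suc Ck.simps(2))
qed simp

lemma smooth_on_iff_Ck: "smooth_on V f \<longleftrightarrow> (\<forall>n. Ck n V f)"
  by (auto simp: smooth_on_def Ck_iff)

lemma Ck_differentiable_on: "Ck n V f \<Longrightarrow> f differentiable_on V"
  by (cases n) (auto simp: Ck.simps(2))

lemma Ck_SucD: "Ck (Suc n) V f \<Longrightarrow> Ck n V f"
  by (auto simp: Ck_iff)

lemma differentiable_on_open_at:
  "f differentiable_on V \<Longrightarrow> open V \<Longrightarrow> x \<in> V \<Longrightarrow> f differentiable (at x)"
  by (metis differentiable_on_def at_within_open)

lemma Ck_differentiable_at: "Ck n V f \<Longrightarrow> open V \<Longrightarrow> x \<in> V \<Longrightarrow> f differentiable (at x)"
  using Ck_differentiable_on differentiable_on_open_at by blast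

lemma differentiable_on_cong:
  assumes "\<And>x. x \<in> V \<Longrightarrow> f x = g x" "f differentiable_on V"
  shows "g differentiable_on V"
  unfolding differentiable_on_def
proof
  fix x assume x: "x \<in> V"
  then obtain D where "(f has_derivative D) (at x within V)"
    using assms(2) by (auto simp: differentiable_on_def differentiable_def)
  from has_derivative_transform[OF x assms(1)[symmetric] this]
  show "g differentiable (at x within V)" by (auto simp: differentiable_def)
qed

lemma Ck_cong:
  assumes "open V" "\<And>x. x \<in> V \<Longrightarrow> f x = g x" "Ck n V f"
  shows "Ck n V g"
  using assms(2,3)
proof (induction n arbitrary: f g)
  case 0
  then show ?case using differentiable_on_cong[of V f g] by simp
next
  case (Suc n)
  have "g differentiable_on V"
    using Suc.prems differentiable_on_cong[of V f g] by (simp add: Ck.simps(2))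
  moreover have "Ck n V (pderiv_at i g)" for i
    by (rule Suc.IH[OF pderiv_at_cong[OF assms(1)] Ck_pderiv[OF Suc.prems(2)]]) (use Suc.prems in auto)
  ultimately show ?case by (simp add: Ck.simps(2))
qed

text \<open>The working form of the induction step: any formula for the first partial derivatives
  that is valid on \<open>V\<close> may be used, and the induction hypothesis is applied to that
  formula.\<close>

lemma Ck_SucI:
  assumes "open V" "\<And>x. x \<in> V \<Longrightarrow> f differentiable (at x)"
    "\<And>i x. x \<in> V \<Longrightarrow> pderiv_at i f x = f' i x" "\<And>i. Ck n V (f' i)"
  shows "Ck (Suc n) V f"
proof -
  have "Ck n V (pderiv_at i f)" for i
    using assms Ck_cong[OF assms(1), of "f' i" "pderiv_at i f"] by simp
  then show ?thesis
    using assms(2) by (simp add: differentiable_at_imp_differentiable_on Ck.simps(2))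
qed

lemma Ck_const: "Ck n V (\<lambda>_. c)"
  by (induction n arbitrary: c) (auto simp: Ck.simps(2))

lemma Ck_add:
  assumes "open V" shows "Ck n V f \<Longrightarrow> Ck n V g \<Longrightarrow> Ck n V (\<lambda>x. f x + g x)"
proof (induction n arbitrary: f g)
  case (Suc n)
  show ?case
    by (rule Ck_SucI[OF assms, where f' = "\<lambda>i x. pderiv_at i f x + pderiv_at i g x"])
      (use Suc.prems Ck_differentiable_at[OF Suc.prems(1) assms] Ck_differentiable_at[OF Suc.prems(2) assms]
        in \<open>auto intro!: pderiv_at_add Suc.IH Ck_pderiv\<close>)
qed (auto intro: differentiable_on_add)

lemma Ck_sum:
  assumes "open V" "\<And>k. k \<in> S \<Longrightarrow> Ck n V (f k)"
  shows "Ck n V (\<lambda>x. \<Sum>k\<in>S. f k x)"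
  using assms(2) by (induction S rule: infinite_finite_induct) (auto intro!: Ck_const Ck_add assms(1))

lemma Ck_bounded_linear:
  assumes "open V" "bounded_linear L" shows "Ck n V f \<Longrightarrow> Ck n V (\<lambda>x. L (f x))"
proof (induction n arbitrary: f)
  case 0
  then show ?case
    using assms by (auto intro!: differentiable_at_imp_differentiable_on differentiable_bounded_linear[OF assms(2)]
        dest: differentiable_on_open_at)
next
  case (Suc n)
  show ?case
    by (rule Ck_SucI[OF assms(1), where f' = "\<lambda>i x. L (pderiv_at i f x)"])
      (use Suc.prems Ck_differentiable_at[OF Suc.prems assms(1)] in
       \<open>auto intro!: pderiv_at_bounded_linear[OF assms(2)] differentiable_bounded_linear[OF assms(2)] Suc.IH Ck_pderiv\<close>)
qed

lemma Ck_bilinear: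
  assumes "open V" "bounded_bilinear B"
  shows "Ck n V f \<Longrightarrow> Ck n V g \<Longrightarrow> Ck n V (\<lambda>x. B (f x) (g x))"
proof (induction n arbitrary: f g)
  case 0
  then show ?case
    using assms by (auto intro!: differentiable_at_imp_differentiable_on differentiable_bilinear[OF assms(2)]
        dest: differentiable_on_open_at)
next
  case (Suc n)
  show ?case
    by (rule Ck_SucI[OF assms(1), where f' = "\<lambda>i x. B (f x) (pderiv_at i g x) + B (pderiv_at i f x) (g x)"])
      (use Suc.prems Ck_differentiable_at[OF Suc.prems(1) assms(1)] Ck_differentiable_at[OF Suc.prems(2) assms(1)]
        Ck_SucD[OF Suc.prems(1)] Ck_SucD[OF Suc.prems(2)] in
       \<open>auto intro!: pderiv_at_bilinear[OF assms(2)] differentiable_bilinear[OF assms(2)] Ck_add[OF assms(1)] Suc.IH Ck_pderiv\<close>)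
qed

text \<open>The chain rule expresses the partial derivatives through those of \<open>g\<close>
  composed with the same \<open>f\<close>, so the induction varies \<open>g\<close> only.\<close>

lemma Ck_compose:
  fixes g :: "real^'n::finite \<Rightarrow> 'b::real_normed_vector" and f :: "real^'m::finite \<Rightarrow> real^'n"
  assumes "open V" "open W" "f ` V \<subseteq> W"
  shows "Ck n W g \<Longrightarrow> Ck n V f \<Longrightarrow> Ck n V (\<lambda>x. g (f x))"
proof (induction n arbitrary: g)
  case 0
  then show ?case
    using assms
    by (auto intro!: differentiable_at_imp_differentiable_on differentiable_chain_at[of f _ g, unfolded o_def]
        dest: differentiable_on_open_at)
next
  case (Suc n)
  have d: "f differentiable (at x)" "g differentiable (at (f x))" if "x \<in> V" for x
    using that Suc.prems Ck_differentiable_at assms by blast+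
  show ?case
  proof (rule Ck_SucI[OF assms(1), where f' = "\<lambda>i x. \<Sum>a\<in>UNIV. pderiv_at i f x $ a *\<^sub>R pderiv_at a g (f x)"])
    show "(\<lambda>x. g (f x)) differentiable (at x)" if "x \<in> V" for x
      using d[OF that] differentiable_chain_at[unfolded o_def] by blast
    show "pderiv_at i (\<lambda>x. g (f x)) x = (\<Sum>a\<in>UNIV. pderiv_at i f x $ a *\<^sub>R pderiv_at a g (f x))"
      if "x \<in> V" for i x
      using d[OF that] by (rule pderiv_at_compose)
    show "Ck n V (\<lambda>x. \<Sum>a\<in>UNIV. pderiv_at i f x $ a *\<^sub>R pderiv_at a g (f x))" for i
      using Suc.prems
      by (intro Ck_sum Ck_bilinear[OF _ bounded_bilinear_scaleR] assms
          Ck_bounded_linear[OF _ bounded_linear_vec_nth] Suc.IH Ck_SucD[OF Suc.prems(2)] Ck_pderiv)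
  qed
qed

lemma pderiv_at_inverse:
  fixes f :: "real^'m::finite \<Rightarrow> real"
  assumes "f differentiable (at x)" "f x \<noteq> 0"
  shows "pderiv_at i (\<lambda>y. inverse (f y)) x = - (inverse (f x) * pderiv_at i f x * inverse (f x))"
  using pderiv_at_has_derivative[OF Deriv.has_derivative_inverse[OF assms(2)
      assms(1)[unfolded frechet_derivative_works]]] by (simp add: pderiv_at_def)

lemma pderiv_at_sqrt:
  fixes f :: "real^'m::finite \<Rightarrow> real"
  assumes "f differentiable (at x)" "f x > 0"
  shows "(\<lambda>y. sqrt (f y)) differentiable (at x)"
    "pderiv_at i (\<lambda>y. sqrt (f y)) x = inverse (sqrt (f x)) / 2 * pderiv_at i f x"
proof -
  have "((\<lambda>y. sqrt (f y)) has_derivative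
      (\<lambda>v. frechet_derivative f (at x) v * (inverse (sqrt (f x)) / 2))) (at x)"
    using has_derivative_real_sqrt[OF assms(2) assms(1)[unfolded frechet_derivative_works]]
    by (auto intro: DERIV_real_sqrt[OF assms(2)])
  then show "(\<lambda>y. sqrt (f y)) differentiable (at x)"
    "pderiv_at i (\<lambda>y. sqrt (f y)) x = inverse (sqrt (f x)) / 2 * pderiv_at i f x"
    by (auto simp: differentiable_def pderiv_at_has_derivative) (simp add: pderiv_at_def)
qed

lemma Ck_inverse:
  fixes f :: "real^'m::finite \<Rightarrow> real"
  assumes "open V" "\<And>x. x \<in> V \<Longrightarrow> f x \<noteq> 0"
  shows "Ck n V f \<Longrightarrow> Ck n V (\<lambda>x. inverse (f x))"
proof (induction n)
  case 0
  then show ?case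
    using assms by (auto intro!: differentiable_at_imp_differentiable_on differentiable_inverse
        dest: differentiable_on_open_at)
next
  case (Suc n)
  \<comment> \<open>The derivative of the inverse again contains the inverse, one order lower; this
    is where the induction hypothesis enters.\<close>
  have *: "Ck n V (\<lambda>x. inverse (f x))" using Suc Ck_SucD by blast
  show ?case
  proof (rule Ck_SucI[OF assms(1), where f' = "\<lambda>i x. - (inverse (f x) * pderiv_at i f x * inverse (f x))"])
    show "Ck n V (\<lambda>x. - (inverse (f x) * pderiv_at i f x * inverse (f x)))" for i
      using Suc.prems *
      by (intro Ck_bounded_linear[OF assms(1) bounded_linear_minus[OF bounded_linear_ident]]
          Ck_bilinear[OF assms(1) bounded_bilinear_mult] Ck_pderiv)
  qed (use Ck_differentiable_at[OF Suc.prems assms(1)] assms in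
      \<open>auto intro!: pderiv_at_inverse differentiable_inverse\<close>)
qed

lemma Ck_sqrt:
  fixes f :: "real^'m::finite \<Rightarrow> real"
  assumes "open V" "\<And>x. x \<in> V \<Longrightarrow> f x > 0"
  shows "Ck n V f \<Longrightarrow> Ck n V (\<lambda>x. sqrt (f x))"
proof (induction n)
  case 0
  then show ?case
    using assms by (auto intro!: differentiable_at_imp_differentiable_on pderiv_at_sqrt
        dest: differentiable_on_open_at)
next
  case (Suc n)
  have *: "Ck n V (\<lambda>x. inverse (sqrt (f x)))"
    using Suc Ck_SucD assms(2) by (intro Ck_inverse[OF assms(1)]) fastforce+
  show ?case
  proof (rule Ck_SucI[OF assms(1), where f' = "\<lambda>i x. inverse (sqrt (f x)) / 2 * pderiv_at i f x"])
    show "Ck n V (\<lambda>x. inverse (sqrt (f x)) / 2 * pderiv_at i f x)" for i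
      using Suc.prems * Ck_bounded_linear[OF assms(1) bounded_linear_divide[of 2] *]
      by (intro Ck_bilinear[OF assms(1) bounded_bilinear_mult] Ck_pderiv)
  next
    fix x assume "x \<in> V"
    then show "(\<lambda>x. sqrt (f x)) differentiable (at x)"
      "pderiv_at i (\<lambda>x. sqrt (f x)) x = inverse (sqrt (f x)) / 2 * pderiv_at i f x" for i
      using pderiv_at_sqrt[OF Ck_differentiable_at[OF Suc.prems assms(1)] assms(2)] by blast+
  qed
qed

section \<open>Closure properties of smooth functions\<close>

lemma smooth_on_differentiable_at: "smooth_on V f \<Longrightarrow> open V \<Longrightarrow> x \<in> V \<Longrightarrow> f differentiable (at x)"
  by (auto simp: smooth_on_iff_Ck intro: Ck_differentiable_at)

lemma smooth_on_pderiv: "smooth_on V f \<Longrightarrow> smooth_on V (pderiv_at i f)"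
  unfolding smooth_on_iff_Ck using Ck_pderiv by blast

lemma smooth_on_cong:
  "open V \<Longrightarrow> (\<And>x. x \<in> V \<Longrightarrow> f x = g x) \<Longrightarrow> smooth_on V f \<Longrightarrow> smooth_on V g"
  unfolding smooth_on_iff_Ck using Ck_cong by blast

lemma smooth_on_subset: "smooth_on V f \<Longrightarrow> W \<subseteq> V \<Longrightarrow> smooth_on W f"
  unfolding smooth_on_def using differentiable_on_subset by blast

text \<open>Allows the target chart to vary from point to point when the surface in R^4 is shown to
  be smooth.\<close>

lemma smooth_on_local:
  assumes "\<And>x. x \<in> V \<Longrightarrow> \<exists>W. open W \<and> x \<in> W \<and> smooth_on W f"
  shows "smooth_on V f"
  unfolding smooth_on_def
  using assms by (metis smooth_on_def differentiable_on_open_at differentiable_at_imp_differentiable_on)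

lemma smooth_on_const: "smooth_on V (\<lambda>_. c)"
  by (simp add: smooth_on_iff_Ck Ck_const)

lemma smooth_on_add: "open V \<Longrightarrow> smooth_on V f \<Longrightarrow> smooth_on V g \<Longrightarrow> smooth_on V (\<lambda>x. f x + g x)"
  by (simp add: smooth_on_iff_Ck Ck_add)

lemma smooth_on_sum: "open V \<Longrightarrow> (\<And>k. k \<in> S \<Longrightarrow> smooth_on V (f k)) \<Longrightarrow> smooth_on V (\<lambda>x. \<Sum>k\<in>S. f k x)"
  by (simp add: smooth_on_iff_Ck Ck_sum)

lemma smooth_on_bounded_linear:
  "open V \<Longrightarrow> bounded_linear L \<Longrightarrow> smooth_on V f \<Longrightarrow> smooth_on V (\<lambda>x. L (f x))"
  by (simp add: smooth_on_iff_Ck Ck_bounded_linear)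

lemma smooth_on_bilinear:
  "open V \<Longrightarrow> bounded_bilinear B \<Longrightarrow> smooth_on V f \<Longrightarrow> smooth_on V g \<Longrightarrow> smooth_on V (\<lambda>x. B (f x) (g x))"
  by (simp add: smooth_on_iff_Ck Ck_bilinear)

lemma smooth_on_minus: "open V \<Longrightarrow> smooth_on V f \<Longrightarrow> smooth_on V (\<lambda>x. - f x)"
  by (rule smooth_on_bounded_linear[OF _ bounded_linear_minus[OF bounded_linear_ident]])

lemma smooth_on_diff: "open V \<Longrightarrow> smooth_on V f \<Longrightarrow> smooth_on V g \<Longrightarrow> smooth_on V (\<lambda>x. f x - g x)"
  using smooth_on_add[of V f "\<lambda>x. - g x"] smooth_on_minus[of V g] by simp

lemma smooth_on_mult:
  fixes f g :: "real^'m::finite \<Rightarrow> real"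
  shows "open V \<Longrightarrow> smooth_on V f \<Longrightarrow> smooth_on V g \<Longrightarrow> smooth_on V (\<lambda>x. f x * g x)"
  by (rule smooth_on_bilinear[OF _ bounded_bilinear_mult])

lemma smooth_on_inner: "open V \<Longrightarrow> smooth_on V f \<Longrightarrow> smooth_on V g \<Longrightarrow> smooth_on V (\<lambda>x. f x \<bullet> g x)"
  by (rule smooth_on_bilinear[OF _ bounded_bilinear_inner])

lemma smooth_on_scaleR: "open V \<Longrightarrow> smooth_on V f \<Longrightarrow> smooth_on V g \<Longrightarrow> smooth_on V (\<lambda>x. f x *\<^sub>R g x)"
  by (rule smooth_on_bilinear[OF _ bounded_bilinear_scaleR])

lemma smooth_on_prod:
  fixes f :: "'k \<Rightarrow> real^'m::finite \<Rightarrow> real"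
  assumes "open V" "\<And>k. k \<in> S \<Longrightarrow> smooth_on V (f k)"
  shows "smooth_on V (\<lambda>x. \<Prod>k\<in>S. f k x)"
  using assms(2)
  by (induction S rule: infinite_finite_induct) (auto intro!: smooth_on_const smooth_on_mult assms(1))

lemma smooth_on_inverse:
  fixes f :: "real^'m::finite \<Rightarrow> real"
  shows "open V \<Longrightarrow> (\<And>x. x \<in> V \<Longrightarrow> f x \<noteq> 0) \<Longrightarrow> smooth_on V f \<Longrightarrow> smooth_on V (\<lambda>x. inverse (f x))"
  by (simp add: smooth_on_iff_Ck Ck_inverse)

lemma smooth_on_divide:
  fixes f g :: "real^'m::finite \<Rightarrow> real"
  shows "open V \<Longrightarrow> (\<And>x. x \<in> V \<Longrightarrow> g x \<noteq> 0) \<Longrightarrow> smooth_on V f \<Longrightarrow> smooth_on V g \<Longrightarrow>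
    smooth_on V (\<lambda>x. f x / g x)"
  unfolding divide_inverse by (intro smooth_on_mult smooth_on_inverse)

lemma smooth_on_sqrt:
  fixes f :: "real^'m::finite \<Rightarrow> real"
  shows "open V \<Longrightarrow> (\<And>x. x \<in> V \<Longrightarrow> f x > 0) \<Longrightarrow> smooth_on V f \<Longrightarrow> smooth_on V (\<lambda>x. sqrt (f x))"
  by (simp add: smooth_on_iff_Ck Ck_sqrt)

lemma smooth_on_nth:
  fixes f :: "real^'m::finite \<Rightarrow> 'b::real_normed_vector^'n::finite"
  shows "open V \<Longrightarrow> smooth_on V f \<Longrightarrow> smooth_on V (\<lambda>x. f x $ a)"
  by (rule smooth_on_bounded_linear[OF _ bounded_linear_vec_nth])

lemma smooth_on_ident: "smooth_on V (\<lambda>x. x)"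
proof -
  have "Ck n V (\<lambda>x. x)" for n
    by (cases n) (auto simp: Ck.simps(2) pderiv_at_def Ck_const differentiable_on_def)
  then show ?thesis by (simp add: smooth_on_iff_Ck)
qed

lemma bounded_linear_axis: "bounded_linear (axis a :: 'b::real_normed_vector \<Rightarrow> 'b^'n::finite)"
  by (intro linearI bounded_linear_intro[where K=1])
    (auto simp: axis_def vec_eq_iff norm_vec_def L2_set_def if_distrib if_distribR cong: if_cong)

lemma vec_eq_sum_axis: "v = (\<Sum>a\<in>UNIV. axis a (v $ a))"
  by (simp add: vec_eq_iff axis_def if_distrib if_distribR cong: if_cong)

lemma smooth_on_vecI:
  fixes f :: "real^'m::finite \<Rightarrow> 'b::real_normed_vector^'n::finite"
  assumes "open V" "\<And>a. smooth_on V (\<lambda>x. f x $ a)"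
  shows "smooth_on V f"
proof -
  have "smooth_on V (\<lambda>x. \<Sum>a\<in>UNIV. axis a (f x $ a))"
    by (intro smooth_on_sum smooth_on_bounded_linear[OF _ bounded_linear_axis] assms)
  then show ?thesis by (simp flip: vec_eq_sum_axis)
qed

lemma smooth_on_compose:
  fixes g :: "real^'n::finite \<Rightarrow> 'b::real_normed_vector" and f :: "real^'m::finite \<Rightarrow> real^'n"
  shows "open V \<Longrightarrow> open W \<Longrightarrow> f ` V \<subseteq> W \<Longrightarrow> smooth_on W g \<Longrightarrow> smooth_on V f \<Longrightarrow> smooth_on V (\<lambda>x. g (f x))"
  by (simp add: smooth_on_iff_Ck Ck_compose)

lemma smooth_on_det:
  fixes A :: "real^'m::finite \<Rightarrow> real^'n::finite^'n"
  assumes "open V" "\<And>i j. smooth_on V (\<lambda>x. A x $ i $ j)"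
  shows "smooth_on V (\<lambda>x. det (A x))"
  unfolding det_def by (intro smooth_on_sum smooth_on_mult smooth_on_prod smooth_on_const assms)

section \<open>Smooth dependence of the inverse matrix\<close>

lemma matrix_inv_right:
  fixes A :: "real^'n::finite^'n"
  assumes "invertible A"
  shows "A ** matrix_inv A = mat 1"
  using someI_ex[OF assms[unfolded invertible_def]] by (simp add: matrix_inv_def)

text \<open>Quotients of determinants are visibly smooth in the matrix entries, unlike the choice
  operator behind \<open>matrix_inv\<close>.\<close>

lemma matrix_inv_cramer:
  fixes A :: "real^'n::finite^'n"
  assumes "invertible A"
  shows "matrix_inv A $ k $ l = det (\<chi> i j. if j = k then axis l 1 $ i else A $ i $ j) / det A"
proof -
  have "A *v (matrix_inv A *v axis l 1) = axis l 1"
    by (simp add: matrix_vector_mul_assoc matrix_inv_right[OF assms])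
  then have "matrix_inv A *v axis l 1 = (\<chi> k. det (\<chi> i j. if j = k then axis l 1 $ i else A $ i $ j) / det A)"
    using cramer[of A] assms by (simp add: invertible_det_nz)
  moreover have "(matrix_inv A *v axis l 1) $ k = matrix_inv A $ k $ l"
    by (simp add: matrix_vector_mult_basis column_def)
  ultimately show ?thesis by simp
qed

lemma smooth_on_matrix_inv:
  fixes A :: "real^'m::finite \<Rightarrow> real^'n::finite^'n"
  assumes "open V" "\<And>i j. smooth_on V (\<lambda>x. A x $ i $ j)" "\<And>x. x \<in> V \<Longrightarrow> invertible (A x)"
  shows "smooth_on V (\<lambda>x. matrix_inv (A x) $ k $ l)"
proof (rule smooth_on_cong[OF assms(1)])
  show "det (\<chi> i j. if j = k then axis l 1 $ i else A x $ i $ j) / det (A x) = matrix_inv (A x) $ k $ l"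
    if "x \<in> V" for x using matrix_inv_cramer[OF assms(3)[OF that]] by simp
  have "smooth_on V (\<lambda>x. if j = k then axis l 1 $ i else A x $ i $ j)" for i j
    by (cases "j = k") (simp_all add: smooth_on_const assms)
  then show "smooth_on V (\<lambda>x. det (\<chi> i j. if j = k then axis l 1 $ i else A x $ i $ j) / det (A x))"
    using assms(3) by (intro smooth_on_divide smooth_on_det assms(1,2)) (auto simp: invertible_det_nz)
qed

section \<open>Symmetry of second derivatives\<close>

lemma pderiv_line:
  fixes f :: "real^'m::finite \<Rightarrow> real"
  assumes "f differentiable (at (w + s *\<^sub>R axis i 1))"
  shows "((\<lambda>s. f (w + s *\<^sub>R axis i 1)) has_real_derivative pderiv_at i f (w + s *\<^sub>R axis i 1)) (at s)"
proof -
  let ?D = "frechet_derivative f (at (w + s *\<^sub>R axis i 1))"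
  have "((\<lambda>s. w + s *\<^sub>R axis i 1) has_derivative (\<lambda>t. t *\<^sub>R axis i 1)) (at s)"
    by (auto intro!: derivative_eq_intros)
  from diff_chain_at[OF this assms[unfolded frechet_derivative_works]]
  have "((\<lambda>s. f (w + s *\<^sub>R axis i 1)) has_derivative (\<lambda>t. ?D (t *\<^sub>R axis i 1))) (at s)"
    by (simp add: o_def)
  moreover have "?D (t *\<^sub>R axis i 1) = t * ?D (axis i 1)" for t
    using linear_frechet_derivative[OF assms] by (simp add: linear_cmul)
  ultimately show ?thesis
    by (simp add: has_field_derivative_def pderiv_at_def mult_commute_abs)
qed

text \<open>Two applications of the mean value theorem, first in direction \<open>i\<close> and then
  in direction \<open>j\<close>. The left side is symmetric in \<open>i\<close> and
  \<open>j\<close>, which is what makes Schwarz's theorem follow.\<close>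

lemma mixed_difference:
  fixes f :: "real^'m::finite \<Rightarrow> real"
  assumes "smooth_on V f" "open V" "cball x (2 * r) \<subseteq> V" "r > 0"
  shows "\<exists>y\<in>cball x (2 * r). f (x + r *\<^sub>R axis i 1 + r *\<^sub>R axis j 1) - f (x + r *\<^sub>R axis i 1)
     - f (x + r *\<^sub>R axis j 1) + f x = r * r * pderiv_at j (pderiv_at i f) y"
proof -
  have in_ball: "x + s *\<^sub>R axis i 1 + t *\<^sub>R axis j 1 \<in> cball x (2 * r)"
    if "0 \<le> s" "s \<le> r" "0 \<le> t" "t \<le> r" for s t
  proof -
    \<comment> \<open>The triangle inequality gives radius \<open>2 * r\<close> for the corners of
      the square; it also covers the case \<open>i = j\<close>.\<close>
    have "norm (s *\<^sub>R axis i 1 + t *\<^sub>R axis j 1 :: real^'m) \<le> s + t"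
      by (rule order_trans[OF norm_triangle_ineq]) (use that in \<open>simp add: norm_axis_1\<close>)
    moreover have "dist x (x + s *\<^sub>R axis i 1 + t *\<^sub>R axis j 1) = norm (s *\<^sub>R axis i 1 + t *\<^sub>R axis j 1 :: real^'m)"
      by (metis add.assoc add_diff_cancel_left' dist_commute dist_norm)
    ultimately show ?thesis using that unfolding mem_cball by linarith
  qed
  have inV: "x + s *\<^sub>R axis i 1 + t *\<^sub>R axis j 1 \<in> V"
    if "0 \<le> s" "s \<le> r" "0 \<le> t" "t \<le> r" for s t using in_ball that assms(3) by blast
  have fd: "f differentiable (at y)" "pderiv_at i f differentiable (at y)" if "y \<in> V" for y
    using smooth_on_differentiable_at[OF _ assms(2) that] smooth_on_pderiv assms(1) by blast+
  let ?A = "\<lambda>s. f (x + r *\<^sub>R axis j 1 + s *\<^sub>R axis i 1) - f (x + s *\<^sub>R axis i 1)"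
  have "\<exists>\<sigma>. 0 < \<sigma> \<and> \<sigma> < r \<and> ?A r - ?A 0 = (r - 0) *
     (pderiv_at i f (x + r *\<^sub>R axis j 1 + \<sigma> *\<^sub>R axis i 1) - pderiv_at i f (x + \<sigma> *\<^sub>R axis i 1))"
  proof (rule MVT2[OF assms(4)])
    fix s assume s: "0 \<le> s" "s \<le> r"
    have "x + r *\<^sub>R axis j 1 + s *\<^sub>R axis i 1 \<in> V" "x + s *\<^sub>R axis i 1 \<in> V"
      using inV[OF s, of r] inV[OF s, of 0] assms(4) by (simp_all add: algebra_simps)
    then show "(?A has_real_derivative (pderiv_at i f (x + r *\<^sub>R axis j 1 + s *\<^sub>R axis i 1) -
        pderiv_at i f (x + s *\<^sub>R axis i 1))) (at s)"
      using fd by (intro DERIV_diff pderiv_line) auto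
  qed
  then obtain \<sigma> where \<sigma>: "0 < \<sigma>" "\<sigma> < r" "?A r - ?A 0 = r *
     (pderiv_at i f (x + r *\<^sub>R axis j 1 + \<sigma> *\<^sub>R axis i 1) - pderiv_at i f (x + \<sigma> *\<^sub>R axis i 1))" by auto
  let ?B = "\<lambda>t. pderiv_at i f (x + \<sigma> *\<^sub>R axis i 1 + t *\<^sub>R axis j 1)"
  have "\<exists>\<tau>. 0 < \<tau> \<and> \<tau> < r \<and> ?B r - ?B 0 =
     (r - 0) * pderiv_at j (pderiv_at i f) (x + \<sigma> *\<^sub>R axis i 1 + \<tau> *\<^sub>R axis j 1)"
    by (rule MVT2[OF assms(4)]) (use \<sigma> inV fd in \<open>auto intro!: pderiv_line\<close>)
  then obtain \<tau> where \<tau>: "0 < \<tau>" "\<tau> < r" "?B r - ?B 0 =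
     r * pderiv_at j (pderiv_at i f) (x + \<sigma> *\<^sub>R axis i 1 + \<tau> *\<^sub>R axis j 1)" by auto
  show ?thesis
    using \<sigma> \<tau> in_ball[of \<sigma> \<tau>]
    by (intro bexI[of _ "x + \<sigma> *\<^sub>R axis i 1 + \<tau> *\<^sub>R axis j 1"]) (auto simp: algebra_simps)
qed

text \<open>The same second difference equals \<open>r * r\<close> times either mixed derivative at
  some nearby point; both derivatives are continuous at \<open>x\<close>.\<close>

lemma pderiv_at_commute_real:
  fixes f :: "real^'m::finite \<Rightarrow> real"
  assumes "smooth_on V f" "open V" "x \<in> V"
  shows "pderiv_at i (pderiv_at j f) x = pderiv_at j (pderiv_at i f) x"
proof (rule ccontr)
  let ?a = "pderiv_at i (pderiv_at j f)" and ?b = "pderiv_at j (pderiv_at i f)"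
  assume ne: "?a x \<noteq> ?b x"
  \<comment> \<open>Half of the supposed gap: both values at \<open>x\<close> will lie within
    \<open>e\<close> of one common number.\<close>
  define e where "e = \<bar>?a x - ?b x\<bar> / 2"
  have e: "e > 0" using ne by (simp add: e_def)
  have "isCont ?a x" "isCont ?b x"
    using smooth_on_differentiable_at[OF _ assms(2,3)] smooth_on_pderiv assms(1)
    by (blast intro: differentiable_imp_continuous_within)+
  then obtain d1 d2 where d1: "d1 > 0" "\<And>y. dist y x < d1 \<Longrightarrow> dist (?a y) (?a x) < e"
    and d2: "d2 > 0" "\<And>y. dist y x < d2 \<Longrightarrow> dist (?b y) (?b x) < e"
    unfolding continuous_at_eps_delta[unfolded dist_norm[symmetric]] continuous_at_eps_delta using e
    by (metis dist_norm)
  obtain d3 where d3: "d3 > 0" "ball x d3 \<subseteq> V" using assms(2,3) open_contains_ball by blast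
  define r where "r = min d1 (min d2 d3) / 4"
  have r: "r > 0" "2 * r < d1" "2 * r < d2" "2 * r < d3" using d1 d2 d3 by (auto simp: r_def)
  then have sub: "cball x (2 * r) \<subseteq> V" using d3 by (force simp: subset_iff)
  obtain y where y: "y \<in> cball x (2 * r)" "f (x + r *\<^sub>R axis i 1 + r *\<^sub>R axis j 1) - f (x + r *\<^sub>R axis i 1)
     - f (x + r *\<^sub>R axis j 1) + f x = r * r * ?b y"
    using mixed_difference[OF assms(1,2) sub r(1), of i j] by blast
  obtain z where z: "z \<in> cball x (2 * r)" "f (x + r *\<^sub>R axis j 1 + r *\<^sub>R axis i 1) - f (x + r *\<^sub>R axis j 1)
     - f (x + r *\<^sub>R axis i 1) + f x = r * r * ?a z"
    using mixed_difference[OF assms(1,2) sub r(1), of j i] by blast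
  have *: "x + r *\<^sub>R axis j 1 + r *\<^sub>R axis i 1 = x + r *\<^sub>R axis i 1 + r *\<^sub>R axis j 1"
    by (simp add: add_ac)
  have "r * r * ?a z = r * r * ?b y"
    using y(2) z(2) unfolding * by linarith
  then have "?a z = ?b y" using r(1) by auto
  moreover have "dist z x < d1" "dist y x < d2"
    using y(1) z(1) r by (auto simp: dist_commute)
  then have "dist (?a z) (?a x) < e" "dist (?b y) (?b x) < e"
    using d1(2) d2(2) by blast+
  ultimately have "dist (?a x) (?a z) < e" "dist (?b x) (?a z) < e" by (simp_all add: dist_commute)
  then have "dist (?a x) (?b x) < 2 * e"
    using dist_triangle_half_l[of "?a x" "?a z" "2 * e" "?b x"] by simp
  then show False by (simp add: e_def dist_real_def)
qed

lemma pderiv_at_commute: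
  fixes f :: "real^'m::finite \<Rightarrow> 'b::euclidean_space"
  assumes "smooth_on V f" "open V" "x \<in> V"
  shows "pderiv_at i (pderiv_at j f) x = pderiv_at j (pderiv_at i f) x"
proof (rule euclidean_eqI)
  fix b :: 'b assume "b \<in> Basis"
  have L: "bounded_linear (\<lambda>v::'b. v \<bullet> b)" by (rule bounded_linear_inner_left)
  have *: "pderiv_at i (pderiv_at j (\<lambda>y. f y \<bullet> b)) x = pderiv_at i (pderiv_at j f) x \<bullet> b" for i j
  proof -
    have "pderiv_at i (pderiv_at j (\<lambda>y. f y \<bullet> b)) x = pderiv_at i (\<lambda>y. pderiv_at j f y \<bullet> b) x"
      using assms by (intro pderiv_at_cong[OF assms(2,3)] pderiv_at_bounded_linear[OF L])
        (auto intro: smooth_on_differentiable_at)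
    also have "\<dots> = pderiv_at i (pderiv_at j f) x \<bullet> b"
      using smooth_on_differentiable_at[OF smooth_on_pderiv[OF assms(1)] assms(2,3)]
      by (rule pderiv_at_bounded_linear[OF L])
    finally show ?thesis .
  qed
  show "pderiv_at i (pderiv_at j f) x \<bullet> b = pderiv_at j (pderiv_at i f) x \<bullet> b"
    unfolding *[symmetric]
    by (rule pderiv_at_commute_real[OF smooth_on_bounded_linear[OF assms(2) L assms(1)] assms(2,3)])
qed

section \<open>Immersions into Euclidean space and the Gauss equation\<close>

lemma sum_delta_scaleR [simp]:
  fixes f :: "'k::finite \<Rightarrow> 'b::real_vector"
  shows "(\<Sum>k\<in>UNIV. (if k = i then 1 else 0 :: real) *\<^sub>R f k) = f i"
    "(\<Sum>k\<in>UNIV. (if i = k then 1 else 0 :: real) *\<^sub>R f k) = f i"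
  by (simp_all add: if_distrib if_distribR cong: if_cong)

lemma matrix_inv_left:
  fixes A :: "real^'n::finite^'n"
  assumes "invertible A"
  shows "matrix_inv A ** A = mat 1"
  using someI_ex[OF assms[unfolded invertible_def]] by (simp add: matrix_inv_def)

text \<open>The metric is a separate parameter, tied to \<open>\<Psi>\<close> only on
  \<open>V\<close>, so that the component matrices of an abstract manifold can be inserted.
  Instances are parametrized surfaces as well as inverses of sphere charts.\<close>

locale immersion =
  fixes V :: "(real^'m::finite) set" and \<Psi> :: "real^'m \<Rightarrow> real^'n::finite" and g :: "real^'m \<Rightarrow> real^'m^'m"
  assumes open_V: "open V"
    and smooth: "smooth_on V \<Psi>"
    and metric_eq: "x \<in> V \<Longrightarrow> g x $ i $ j = pderiv_at i \<Psi> x \<bullet> pderiv_at j \<Psi> x"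
    and independent_tangents: "x \<in> V \<Longrightarrow> (\<Sum>i\<in>UNIV. v $ i *\<^sub>R pderiv_at i \<Psi> x) = 0 \<Longrightarrow> v = 0"
begin

abbreviation tan :: "'m \<Rightarrow> real^'m \<Rightarrow> real^'n" where "tan i \<equiv> pderiv_at i \<Psi>"

text \<open>The reciprocal tangent frame: inner products with it read off tangential
  components.\<close>

definition dual :: "'m \<Rightarrow> real^'m \<Rightarrow> real^'n" where
  "dual k x = (\<Sum>l\<in>UNIV. matrix_inv (g x) $ k $ l *\<^sub>R tan l x)"

text \<open>The second fundamental form in Euclidean space. For an immersion into the sphere it
  still contains a component along the position vector.\<close>

definition normal_hess :: "'m \<Rightarrow> 'm \<Rightarrow> real^'m \<Rightarrow> real^'n" where
  "normal_hess i j x = pderiv_at i (tan j) x - (\<Sum>k\<in>UNIV. christoffel g k i j x *\<^sub>R tan k x)"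

lemma smooth_tan: "smooth_on V (tan i)"
  by (rule smooth_on_pderiv[OF smooth])

lemma smooth_metric: "smooth_on V (\<lambda>x. g x $ i $ j)"
  by (rule smooth_on_cong[OF open_V _ smooth_on_inner[OF open_V smooth_tan[of i] smooth_tan[of j]]])
    (simp add: metric_eq)

lemma differentiable_tan: "x \<in> V \<Longrightarrow> tan i differentiable (at x)"
  by (rule smooth_on_differentiable_at[OF smooth_tan open_V])

lemma metric_sym: "x \<in> V \<Longrightarrow> g x $ i $ j = g x $ j $ i"
  by (simp add: metric_eq inner_commute)

lemma invertible_metric:
  assumes "x \<in> V" shows "invertible (g x)"
proof -
  have "v = 0" if "g x *v v = 0" for v
  proof -
    let ?w = "\<Sum>i\<in>UNIV. v $ i *\<^sub>R tan i x"
    have "?w \<bullet> ?w = v \<bullet> (g x *v v)"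
      using assms
      by (simp add: inner_sum_left inner_sum_right inner_vec_def[of v] matrix_vector_mult_def metric_eq
          sum_distrib_left mult.assoc)
        (simp add: inner_commute mult.commute)
    then have "?w = 0" using that by simp
    then show ?thesis using independent_tangents assms by blast
  qed
  then show ?thesis by (simp add: invertible_left_inverse matrix_left_invertible_ker)
qed

lemma smooth_metric_inv: "smooth_on V (\<lambda>x. matrix_inv (g x) $ k $ l)"
  by (rule smooth_on_matrix_inv[OF open_V smooth_metric invertible_metric])

lemma smooth_dual: "smooth_on V (dual k)"
  unfolding dual_def by (intro smooth_on_sum smooth_on_scaleR smooth_metric_inv smooth_tan open_V)

lemma differentiable_dual: "x \<in> V \<Longrightarrow> dual i differentiable (at x)"
  by (rule smooth_on_differentiable_at[OF smooth_dual open_V])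

lemma dual_inner_tan:
  assumes "x \<in> V" shows "dual k x \<bullet> tan j x = (if k = j then 1 else 0)"
proof -
  have "dual k x \<bullet> tan j x = (matrix_inv (g x) ** g x) $ k $ j"
    using assms by (simp add: dual_def inner_sum_left matrix_matrix_mult_def metric_eq)
  then show ?thesis by (simp add: matrix_inv_left[OF invertible_metric[OF assms]] mat_def)
qed

lemma tan_inner_dual:
  "x \<in> V \<Longrightarrow> tan j x \<bullet> dual k x = (if k = j then 1 else 0)"
  by (subst inner_commute) (rule dual_inner_tan)

lemma dual_inner_dual:
  assumes "x \<in> V" shows "dual k x \<bullet> dual l x = matrix_inv (g x) $ k $ l"
proof -
  have "dual k x \<bullet> dual l x = (\<Sum>p\<in>UNIV. matrix_inv (g x) $ k $ p * (tan p x \<bullet> dual l x))"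
    by (subst (1) dual_def) (simp add: inner_sum_left)
  then show ?thesis using assms by (simp add: tan_inner_dual if_distrib cong: if_cong)
qed

lemma metric_inv_sym: "x \<in> V \<Longrightarrow> matrix_inv (g x) $ k $ l = matrix_inv (g x) $ l $ k"
  by (metis dual_inner_dual inner_commute)

lemma pderiv_tan_commute: "x \<in> V \<Longrightarrow> pderiv_at i (tan j) x = pderiv_at j (tan i) x"
  by (rule pderiv_at_commute[OF smooth open_V])

lemma pderiv_metric:
  assumes "x \<in> V"
  shows "pderiv_at i (\<lambda>y. g y $ j $ l) x = tan j x \<bullet> pderiv_at i (tan l) x + pderiv_at i (tan j) x \<bullet> tan l x"
proof -
  have "pderiv_at i (\<lambda>y. g y $ j $ l) x = pderiv_at i (\<lambda>y. tan j y \<bullet> tan l y) x"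
    by (rule pderiv_at_cong[OF open_V assms]) (simp add: metric_eq)
  then show ?thesis using assms by (simp add: pderiv_at_inner differentiable_tan)
qed

text \<open>In the Koszul combination of metric derivatives, symmetry of second derivatives leaves
  only twice the product of the second derivative with a tangent vector.\<close>

lemma christoffel_eq:
  assumes "x \<in> V"
  shows "christoffel g k i j x = pderiv_at i (tan j) x \<bullet> dual k x"
proof -
  have "pderiv_at i (\<lambda>y. g y $ j $ l) x + pderiv_at j (\<lambda>y. g y $ i $ l) x
      - pderiv_at l (\<lambda>y. g y $ i $ j) x = 2 * (pderiv_at i (tan j) x \<bullet> tan l x)" for l
    using pderiv_tan_commute[OF assms] by (simp add: pderiv_metric[OF assms] inner_commute algebra_simps)
  then show ?thesis
    by (simp add: christoffel_def dual_def inner_sum_right sum_distrib_left mult_ac)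
qed

lemma smooth_christoffel: "smooth_on V (christoffel g k i j)"
  by (rule smooth_on_cong[OF open_V _ smooth_on_inner[OF open_V smooth_on_pderiv[OF smooth_tan[of j]] smooth_dual[of k]]])
    (simp add: christoffel_eq)

lemma christoffel_sym: "x \<in> V \<Longrightarrow> christoffel g k i j x = christoffel g k j i x"
  by (simp add: christoffel_eq pderiv_tan_commute[of x i j])

lemma tan_eq_sum_dual:
  assumes "x \<in> V" shows "tan l x = (\<Sum>k\<in>UNIV. g x $ l $ k *\<^sub>R dual k x)"
proof -
  have "(\<Sum>k\<in>UNIV. g x $ l $ k *\<^sub>R dual k x)
      = (\<Sum>k\<in>UNIV. \<Sum>p\<in>UNIV. (g x $ l $ k * matrix_inv (g x) $ k $ p) *\<^sub>R tan p x)"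
    by (simp add: dual_def scaleR_sum_right)
  also have "\<dots> = (\<Sum>p\<in>UNIV. (g x ** matrix_inv (g x)) $ l $ p *\<^sub>R tan p x)"
    by (subst sum.swap) (simp add: matrix_matrix_mult_def scaleR_sum_left)
  finally show ?thesis
    by (simp add: matrix_inv_right[OF invertible_metric[OF assms]] mat_def)
qed

lemma normal_hess_inner_tan:
  assumes "x \<in> V" shows "normal_hess i j x \<bullet> tan l x = 0"
proof -
  have "normal_hess i j x \<bullet> dual p x = 0" for p
    using assms
    by (simp add: normal_hess_def inner_diff_left inner_sum_left tan_inner_dual christoffel_eq if_distrib cong: if_cong)
  then show ?thesis by (simp add: tan_eq_sum_dual[OF assms] inner_sum_right)
qed

lemma pderiv_dual_inner_tan:
  assumes "x \<in> V" shows "pderiv_at i (dual l) x \<bullet> tan p x = - christoffel g l i p x"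
proof -
  have "pderiv_at i (\<lambda>y. dual l y \<bullet> tan p y) x = pderiv_at i (\<lambda>y. if l = p then 1 else 0) x"
    by (rule pderiv_at_cong[OF open_V assms]) (simp add: dual_inner_tan)
  then show ?thesis
    using assms by (simp add: pderiv_at_inner differentiable_dual differentiable_tan christoffel_eq
        inner_commute[of "dual l x"])
qed

lemma pderiv_dual_inner_normal:
  assumes "x \<in> V" "\<And>l. N \<bullet> tan l x = 0"
  shows "N \<bullet> pderiv_at i (dual l) x = (\<Sum>p\<in>UNIV. matrix_inv (g x) $ l $ p * (N \<bullet> pderiv_at i (tan p) x))"
proof -
  have d: "(\<lambda>y. matrix_inv (g y) $ l $ p) differentiable (at x)" for p
    by (rule smooth_on_differentiable_at[OF smooth_metric_inv open_V assms(1)])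
  have "pderiv_at i (dual l) x = (\<Sum>p\<in>UNIV. pderiv_at i (\<lambda>y. matrix_inv (g y) $ l $ p *\<^sub>R tan p y) x)"
    unfolding dual_def
    by (rule pderiv_at_sum) (intro differentiable_scaleR' d differentiable_tan assms(1))
  then show ?thesis
    by (simp add: pderiv_at_scaleR[OF d differentiable_tan[OF assms(1)]] inner_sum_right inner_add_right assms(2))
qed

lemma normal_inner_pderiv_tan:
  assumes "x \<in> V" "\<And>l. N \<bullet> tan l x = 0"
  shows "N \<bullet> pderiv_at i (tan p) x = N \<bullet> normal_hess i p x"
  using assms by (simp add: normal_hess_def inner_diff_right inner_sum_right)

text \<open>By \<open>christoffel_eq\<close> the derivative falls on a product; the factor
  \<open>pderiv_at j (tan k)\<close> is then split into its normal part, which yields the Gauss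
  term, and its tangential part, which yields products of Christoffel symbols.\<close>

lemma pderiv_christoffel:
  assumes "x \<in> V"
  shows "pderiv_at i (christoffel g l j k) x = pderiv_at i (pderiv_at j (tan k)) x \<bullet> dual l x
     + (\<Sum>p\<in>UNIV. matrix_inv (g x) $ l $ p * (normal_hess j k x \<bullet> normal_hess i p x))
     - (\<Sum>p\<in>UNIV. christoffel g p j k x * christoffel g l i p x)"
proof -
  have d: "pderiv_at j (tan k) differentiable (at x)"
    by (rule smooth_on_differentiable_at[OF smooth_on_pderiv[OF smooth_tan] open_V assms])
  have "pderiv_at i (christoffel g l j k) x = pderiv_at i (\<lambda>y. pderiv_at j (tan k) y \<bullet> dual l y) x"
    by (rule pderiv_at_cong[OF open_V assms]) (simp add: christoffel_eq)
  also have "\<dots> = pderiv_at i (pderiv_at j (tan k)) x \<bullet> dual l x + pderiv_at j (tan k) x \<bullet> pderiv_at i (dual l) x"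
    using assms by (simp add: pderiv_at_inner d differentiable_dual)
  also have "pderiv_at j (tan k) x = normal_hess j k x + (\<Sum>p\<in>UNIV. christoffel g p j k x *\<^sub>R tan p x)"
    by (simp add: normal_hess_def)
  also have "\<dots> \<bullet> pderiv_at i (dual l) x =
      (\<Sum>p\<in>UNIV. matrix_inv (g x) $ l $ p * (normal_hess j k x \<bullet> normal_hess i p x))
      - (\<Sum>p\<in>UNIV. christoffel g p j k x * christoffel g l i p x)"
    using assms
    by (simp add: inner_add_left inner_sum_left normal_hess_inner_tan normal_inner_pderiv_tan
        pderiv_dual_inner_normal[OF assms normal_hess_inner_tan[OF assms]]
        inner_commute[of "pderiv_at _ \<Psi> x" "pderiv_at i (dual l) x"] pderiv_dual_inner_tan sum_negf)
  finally show ?thesis by simp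
qed

text \<open>The third derivatives of \<open>\<Psi>\<close> cancel by symmetry, and the products of
  Christoffel symbols cancel those in \<open>curv_coeff\<close>.\<close>

lemma gauss_equation:
  assumes "x \<in> V"
  shows "curv_coeff g l i j k x = (\<Sum>p\<in>UNIV. matrix_inv (g x) $ l $ p *
    (normal_hess j k x \<bullet> normal_hess i p x - normal_hess i k x \<bullet> normal_hess j p x))"
proof -
  have "pderiv_at i (pderiv_at j (tan k)) x = pderiv_at j (pderiv_at i (tan k)) x"
    by (rule pderiv_at_commute[OF smooth_tan open_V assms])
  then show ?thesis
    by (simp add: curv_coeff_def pderiv_christoffel[OF assms] sum_subtractf right_diff_distrib mult.commute)
qed

end

section \<open>Space forms\<close>

lemma matrix_inner_sum:
  fixes A :: "real^'m::finite^'m"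
  shows "X \<bullet> (A *v Y) = (\<Sum>i\<in>UNIV. \<Sum>j\<in>UNIV. A $ i $ j * X $ i * Y $ j)"
  by (simp add: inner_vec_def matrix_vector_mult_def sum_distrib_left mult_ac)

lemma sum_delta_mult [simp]:
  fixes f :: "'k::finite \<Rightarrow> real"
  shows "(\<Sum>k\<in>UNIV. (if k = i then 1 else 0) * f k) = f i"
    "(\<Sum>k\<in>UNIV. (if i = k then 1 else 0) * f k) = f i"
    "(\<Sum>k\<in>UNIV. f k * (if k = i then 1 else 0)) = f i"
    "(\<Sum>k\<in>UNIV. f k * (if i = k then 1 else 0)) = f i"
  by (simp_all add: if_distrib if_distribR cong: if_cong)

text \<open>Purely pointwise in \<open>x\<close>: it applies to the sphere with \<open>c = 1\<close>
  and to every surface with \<open>c\<close> its Gauss curvature at \<open>x\<close>.\<close>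

lemma curv_space_form:
  fixes g :: "real^'m::finite \<Rightarrow> real^'m^'m"
  assumes "\<And>l i j k. curv_coeff g l i j k x =
      c * ((if l = i then 1 else 0) * g x $ j $ k - (if l = j then 1 else 0) * g x $ i $ k)"
  shows "curv g x X Y Z = c *\<^sub>R ((Y \<bullet> (g x *v Z)) *\<^sub>R X - (X \<bullet> (g x *v Z)) *\<^sub>R Y)"
proof (simp add: vec_eq_iff, rule allI)
  fix l :: 'm
  let ?d = "\<lambda>i. (if l = i then 1 else 0) :: real"
  have "curv g x X Y Z $ l = (\<Sum>i\<in>UNIV. \<Sum>j\<in>UNIV. \<Sum>k\<in>UNIV.
      c * (?d i * X $ i * (g x $ j $ k * Y $ j * Z $ k)) - c * (?d j * Y $ j * (g x $ i $ k * X $ i * Z $ k)))"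
    by (simp only: curv_def assms vec_lambda_beta) (simp add: algebra_simps)
  also have "\<dots> = c * ((\<Sum>i\<in>UNIV. ?d i * X $ i) * (\<Sum>j\<in>UNIV. \<Sum>k\<in>UNIV. g x $ j $ k * Y $ j * Z $ k))
      - c * (\<Sum>i\<in>UNIV. (\<Sum>j\<in>UNIV. ?d j * Y $ j) * (\<Sum>k\<in>UNIV. g x $ i $ k * X $ i * Z $ k))"
    by (simp only: sum_subtractf sum_distrib_left[symmetric] sum_distrib_right[symmetric])
  also have "\<dots> = c * (X $ l * (Y \<bullet> (g x *v Z))) - c * (Y $ l * (X \<bullet> (g x *v Z)))"
    by (simp only: sum_delta_mult matrix_inner_sum sum_distrib_left)
  finally show "curv g x X Y Z $ l = c * ((Y \<bullet> (g x *v Z)) * X $ l - (X \<bullet> (g x *v Z)) * Y $ l)"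
    by (simp add: algebra_simps)
qed

lemma ricci_space_form:
  fixes g :: "real^'m::finite \<Rightarrow> real^'m^'m"
  assumes "\<And>X Y Z. curv g x X Y Z = c *\<^sub>R ((Y \<bullet> (g x *v Z)) *\<^sub>R X - (X \<bullet> (g x *v Z)) *\<^sub>R Y)"
  shows "ricci g x X Y = c * (real CARD('m) - 1) * (X \<bullet> (g x *v Y))"
proof -
  have "ricci g x X Y = (\<Sum>i\<in>UNIV. c * ((X \<bullet> (g x *v Y)) - (g x *v Y) $ i * X $ i))"
    by (simp add: ricci_def trace_def matrix_def assms inner_axis')
  also have "\<dots> = c * (real CARD('m) * (X \<bullet> (g x *v Y)) - (\<Sum>i\<in>UNIV. (g x *v Y) $ i * X $ i))"
    by (simp add: sum_distrib_left[symmetric] sum_subtractf)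
  also have "(\<Sum>i\<in>UNIV. (g x *v Y) $ i * X $ i) = X \<bullet> (g x *v Y)"
    by (simp add: inner_vec_def mult.commute)
  finally show ?thesis by (simp add: algebra_simps)
qed

lemma ricci_op_space_form:
  fixes g :: "real^'m::finite \<Rightarrow> real^'m^'m"
  assumes "\<And>X Y. ricci g x X Y = c * (X \<bullet> (g x *v Y))" "invertible (g x)" "\<And>i j. g x $ i $ j = g x $ j $ i"
  shows "ricci_op g x X = c *\<^sub>R X" "scal g x = c * real CARD('m)"
proof -
  have *: "ricci_op g x X = c *\<^sub>R X" for X
  proof -
    have "(\<chi> l. ricci g x X (axis l 1)) = c *\<^sub>R (g x *v X)"
    proof -
      have "X \<bullet> (g x *v axis l 1) = (g x *v X) $ l" for l
        by (simp add: matrix_vector_mult_basis column_def inner_vec_def)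
          (simp add: matrix_vector_mult_def assms(3)[of l] mult.commute)
      then show ?thesis by (simp add: vec_eq_iff assms(1))
    qed
    then have "ricci_op g x X = c *\<^sub>R (matrix_inv (g x) *v (g x *v X))"
      by (simp add: ricci_op_def matrix_vector_mult_scaleR)
    then show ?thesis
      by (simp add: matrix_vector_mul_assoc matrix_inv_left[OF assms(2)])
  qed
  then show "ricci_op g x X = c *\<^sub>R X" .
  show "scal g x = c * real CARD('m)"
    by (simp add: scal_def * trace_def matrix_def axis_def)
qed

section \<open>Charts of unit spheres\<close>

lemma sum_option:
  fixes f :: "'k::finite option \<Rightarrow> 'b::comm_monoid_add"
  shows "(\<Sum>k\<in>UNIV. f k) = f None + (\<Sum>i\<in>UNIV. f (Some i))"
  by (simp add: UNIV_option_conv sum.reindex)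

text \<open>An independent family of full cardinality spans. The index type is free so that a frame
  can be indexed by \<open>'m option\<close> (position and tangents) or
  \<open>2 option option\<close> (position, normal and tangents).\<close>

lemma orthogonal_basis_eq_0:
  fixes b :: "'k::finite \<Rightarrow> real^'n::finite"
  assumes "CARD('k) = CARD('n)" "\<And>c. (\<Sum>k\<in>UNIV. c $ k *\<^sub>R b k) = 0 \<Longrightarrow> c = 0" "\<And>k. w \<bullet> b k = 0"
  shows "w = 0"
proof -
  define f :: "real^'k \<Rightarrow> real^'n" where "f c = (\<Sum>k\<in>UNIV. c $ k *\<^sub>R b k)" for c
  have lin: "linear f"
    by (rule linearI) (simp_all add: f_def scaleR_add_left sum.distrib scaleR_sum_right)
  have "inj f" using assms(2) by (simp add: linear_injective_0[OF lin] f_def)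
  then have "dim (range f) = DIM(real^'k)"
    using dim_image_eq[OF lin, of UNIV] by simp
  then have "dim (range f) = DIM(real^'n)" using assms(1) by simp
  then have "span (range f) = UNIV" by (rule dim_eq_full[THEN iffD1])
  then have "w \<in> range f" using iffD2[OF span_eq_iff linear_subspace_image[OF lin subspace_UNIV]] by (metis UNIV_I)
  then obtain c where "w = f c" by blast
  then have "w \<bullet> w = (\<Sum>k\<in>UNIV. c $ k * (w \<bullet> b k))"
    by (subst (2) \<open>w = f c\<close>) (simp add: f_def inner_sum_right)
  then show ?thesis using assms(3) by simp
qed

locale spherical_immersion = immersion V \<Psi> g
  for V :: "(real^'m::finite) set" and \<Psi> :: "real^'m \<Rightarrow> real^'n::finite" and g +
  assumes on_sphere: "x \<in> V \<Longrightarrow> \<Psi> x \<bullet> \<Psi> x = 1"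
begin

lemma differentiable_\<Psi>: "x \<in> V \<Longrightarrow> \<Psi> differentiable (at x)"
  by (rule smooth_on_differentiable_at[OF smooth open_V])

lemma pos_inner_tan:
  assumes "x \<in> V" shows "\<Psi> x \<bullet> tan i x = 0"
proof -
  have "pderiv_at i (\<lambda>y. \<Psi> y \<bullet> \<Psi> y) x = pderiv_at i (\<lambda>y. 1) x"
    by (rule pderiv_at_cong[OF open_V assms]) (simp add: on_sphere)
  then show ?thesis
    using assms by (simp add: pderiv_at_inner differentiable_\<Psi> inner_commute)
qed

lemma pos_inner_pderiv_tan:
  assumes "x \<in> V" shows "\<Psi> x \<bullet> pderiv_at i (tan j) x = - g x $ i $ j"
proof -
  have "pderiv_at i (\<lambda>y. \<Psi> y \<bullet> tan j y) x = pderiv_at i (\<lambda>y. 0) x"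
    by (rule pderiv_at_cong[OF open_V assms]) (simp add: pos_inner_tan)
  then show ?thesis
    using assms by (simp add: pderiv_at_inner differentiable_\<Psi> differentiable_tan metric_eq)
qed

lemma pos_inner_normal_hess:
  assumes "x \<in> V" shows "\<Psi> x \<bullet> normal_hess i j x = - g x $ i $ j"
  using assms by (simp add: normal_hess_def inner_diff_right inner_sum_right pos_inner_tan pos_inner_pderiv_tan)

end

locale sphere_chart = spherical_immersion V \<Psi> g
  for V :: "(real^'m::finite) set" and \<Psi> :: "real^'m \<Rightarrow> real^'n::finite" and g +
  assumes codim_1: "CARD('n) = CARD('m) + 1"
begin

lemma orthogonal_eq_0:
  assumes "x \<in> V" "w \<bullet> \<Psi> x = 0" "\<And>i. w \<bullet> tan i x = 0"
  shows "w = 0"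
proof (rule orthogonal_basis_eq_0[where b = "case_option (\<Psi> x) (\<lambda>i. tan i x)"])
  show "CARD('m option) = CARD('n)" by (simp add: codim_1)
  fix c :: "real^('m option)"
  assume "(\<Sum>k\<in>UNIV. c $ k *\<^sub>R (case k of None \<Rightarrow> \<Psi> x | Some i \<Rightarrow> tan i x)) = 0"
  then have 0: "c $ None *\<^sub>R \<Psi> x + (\<Sum>i\<in>UNIV. c $ Some i *\<^sub>R tan i x) = 0" by (simp add: sum_option)
  from arg_cong[OF this, of "\<lambda>v. \<Psi> x \<bullet> v"] have n: "c $ None = 0"
    using assms(1) by (simp add: inner_add_right inner_sum_right on_sphere pos_inner_tan)
  then have "(\<Sum>i\<in>UNIV. (\<chi> i. c $ Some i) $ i *\<^sub>R tan i x) = 0" using 0 by simp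
  from independent_tangents[OF assms(1) this] have "c $ Some i = 0" for i by (simp add: vec_eq_iff)
  then have "c $ k = 0" for k using n by (cases k) auto
  then show "c = 0" by (simp add: vec_eq_iff)
qed (auto simp: assms split: option.split)

text \<open>The vector is orthogonal to the tangents and has a known position component; in
  codimension one nothing else is left.\<close>

lemma normal_hess_sphere:
  assumes "x \<in> V" shows "normal_hess i j x = - g x $ i $ j *\<^sub>R \<Psi> x"
proof -
  have "normal_hess i j x + g x $ i $ j *\<^sub>R \<Psi> x = 0"
    using assms
    by (intro orthogonal_eq_0[of x])
      (simp_all add: inner_add_left normal_hess_inner_tan pos_inner_tan on_sphere
        pos_inner_normal_hess inner_commute[of "normal_hess i j x" "\<Psi> x"])
  then show ?thesis by (simp add: eq_neg_iff_add_eq_0)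
qed

lemma metric_inv_metric:
  assumes "x \<in> V" shows "(\<Sum>p\<in>UNIV. matrix_inv (g x) $ l $ p * g x $ p $ i) = (if l = i then 1 else 0)"
proof -
  have "(\<Sum>p\<in>UNIV. matrix_inv (g x) $ l $ p * g x $ p $ i) = (matrix_inv (g x) ** g x) $ l $ i"
    by (simp add: matrix_matrix_mult_def)
  then show ?thesis by (simp add: matrix_inv_left[OF invertible_metric[OF assms]] mat_def)
qed

lemma curv_sphere:
  assumes "x \<in> V"
  shows "curv g x X Y Z = (Y \<bullet> (g x *v Z)) *\<^sub>R X - (X \<bullet> (g x *v Z)) *\<^sub>R Y"
proof -
  have "curv_coeff g l i j k x =
      1 * ((if l = i then 1 else 0) * g x $ j $ k - (if l = j then 1 else 0) * g x $ i $ k)" for l i j k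
  proof -
    have "curv_coeff g l i j k x = (\<Sum>p\<in>UNIV. (matrix_inv (g x) $ l $ p * g x $ p $ i) * g x $ j $ k -
        (matrix_inv (g x) $ l $ p * g x $ p $ j) * g x $ i $ k)"
      using metric_sym[OF assms] 
      by (simp add: gauss_equation[OF assms] normal_hess_sphere[OF assms] on_sphere[OF assms] algebra_simps)
    then show ?thesis
      by (simp add: sum_subtractf sum_distrib_right[symmetric] metric_inv_metric[OF assms])
  qed
  from curv_space_form[of g x 1, OF this] show ?thesis by simp
qed

end

section \<open>The c-bitension field in the ambient Euclidean space\<close>

lemma gtrace_cmul: "gtrace g x (\<lambda>i j. c *\<^sub>R A i j) = c *\<^sub>R gtrace g x A"
  by (simp add: gtrace_def scaleR_sum_right mult.commute)

context spherical_immersion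
begin

text \<open>For \<open>x\<close> in \<open>V\<close> this projects onto the tangent space of the
  unit sphere at \<open>F x\<close>, not onto that of the immersed manifold.\<close>

definition proj :: "real^'m \<Rightarrow> real^'n \<Rightarrow> real^'n" where
  "proj x w = w - (w \<bullet> \<Psi> x) *\<^sub>R \<Psi> x"

lemma linear_proj: "linear (proj x)"
  by (rule linearI) (simp_all add: proj_def inner_add_left algebra_simps)

text \<open>Adding the metric times \<open>\<Psi>\<close> cancels the position component of
  \<open>normal_hess\<close>, which leaves the second fundamental form inside the sphere.\<close>

definition ambient_tension :: "real^'m \<Rightarrow> real^'n" where
  "ambient_tension x = gtrace g x (\<lambda>i j. normal_hess i j x + g x $ i $ j *\<^sub>R \<Psi> x)"

lemma ambient_tension_inner_tan:
  "x \<in> V \<Longrightarrow> ambient_tension x \<bullet> tan l x = 0"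
  by (simp add: ambient_tension_def gtrace_def inner_sum_left inner_add_left normal_hess_inner_tan pos_inner_tan)

lemma gtrace_metric:
  assumes "x \<in> V" shows "gtrace g x (\<lambda>i j. g x $ i $ j *\<^sub>R w) = real CARD('m) *\<^sub>R w"
proof -
  have "gtrace g x (\<lambda>i j. g x $ i $ j *\<^sub>R w) = (\<Sum>i\<in>UNIV. (matrix_inv (g x) ** g x) $ i $ i) *\<^sub>R w"
    using metric_sym[OF assms]
    by (simp add: gtrace_def scaleR_sum_left matrix_matrix_mult_def)
  then show ?thesis by (simp add: matrix_inv_left[OF invertible_metric[OF assms]] mat_def)
qed

end

locale map_into_sphere =
  T: sphere_chart W \<Psi> h + S: spherical_immersion V F g
  for W :: "(real^'k::finite) set" and \<Psi> :: "real^'k \<Rightarrow> real^'n::finite" and h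
    and V :: "(real^'m::finite) set" and F :: "real^'m \<Rightarrow> real^'n" and g +
  fixes f :: "real^'m \<Rightarrow> real^'k"
  assumes smooth_f: "smooth_on V f"
    and f_in: "x \<in> V \<Longrightarrow> f x \<in> W"
    and F_eq: "x \<in> V \<Longrightarrow> F x = \<Psi> (f x)"
begin

text \<open>The differential of the sphere parametrization at \<open>f x\<close>: chart components
  of a tangent vector become a vector of the ambient space.\<close>

definition push :: "real^'m \<Rightarrow> real^'k \<Rightarrow> real^'n" where
  "push x v = (\<Sum>a\<in>UNIV. v $ a *\<^sub>R T.tan a (f x))"

lemma linear_push: "linear (push x)"
  by (rule linearI) (simp_all add: push_def scaleR_add_left sum.distrib scaleR_sum_right)

lemma differentiable_f: "x \<in> V \<Longrightarrow> f differentiable (at x)"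
  by (rule smooth_on_differentiable_at[OF smooth_f S.open_V])

lemma push_pderiv_f:
  assumes "x \<in> V" shows "push x (pderiv_at i f x) = S.tan i x"
proof -
  have "S.tan i x = pderiv_at i (\<lambda>y. \<Psi> (f y)) x"
    by (rule pderiv_at_cong[OF S.open_V assms]) (simp add: F_eq)
  then show ?thesis
    using assms by (simp add: push_def pderiv_at_compose differentiable_f T.differentiable_\<Psi> f_in)
qed

lemma push_inner_push:
  assumes "x \<in> V" shows "push x X \<bullet> push x Y = X \<bullet> (h (f x) *v Y)"
  using assms
  by (simp add: push_def inner_sum_left inner_sum_right matrix_inner_sum T.metric_eq f_in sum_distrib_left mult_ac)
    (rule sum.swap)

lemma proj_tan: "x \<in> V \<Longrightarrow> S.proj x (T.tan a (f x)) = T.tan a (f x)"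
  by (simp add: S.proj_def F_eq T.pos_inner_tan f_in inner_commute)

lemma proj_pos: "x \<in> V \<Longrightarrow> S.proj x (\<Psi> (f x)) = 0"
  by (simp add: S.proj_def F_eq T.on_sphere f_in)

lemma proj_pderiv_tan:
  assumes "x \<in> V"
  shows "S.proj x (pderiv_at b (T.tan a) (f x)) = (\<Sum>c\<in>UNIV. christoffel h c b a (f x) *\<^sub>R T.tan c (f x))"
proof -
  have "pderiv_at b (T.tan a) (f x) =
      - h (f x) $ b $ a *\<^sub>R \<Psi> (f x) + (\<Sum>c\<in>UNIV. christoffel h c b a (f x) *\<^sub>R T.tan c (f x))"
    using T.normal_hess_sphere[OF f_in[OF assms], of b a] by (simp add: T.normal_hess_def algebra_simps)
  then show ?thesis
    using assms
    by (simp add: linear_add[OF S.linear_proj] linear_sum[OF S.linear_proj] linear_cmul[OF S.linear_proj]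
        linear_diff[OF S.linear_proj] linear_neg[OF S.linear_proj] proj_tan proj_pos)
qed

text \<open>Differentiating \<open>push\<close> along the map brings in second derivatives of
  \<open>\<Psi>\<close>. They are Christoffel combinations of tangent vectors plus a multiple of the
  position vector, and \<open>proj\<close> removes the latter.\<close>

lemma push_cov_along:
  assumes "x \<in> V" "v differentiable (at x)"
  shows "push x (cov_along h f i v x) = S.proj x (pderiv_at i (\<lambda>y. push y (v y)) x)"
proof -
  have dt: "(\<lambda>y. T.tan a (f y)) differentiable (at x)" for a
    using differentiable_chain_at[OF differentiable_f[OF assms(1)] T.differentiable_tan[OF f_in[OF assms(1)]]]
    by (simp add: o_def)
  have dv: "(\<lambda>y. v y $ a) differentiable (at x)" for a
    by (rule differentiable_bounded_linear[OF bounded_linear_vec_nth assms(2)])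
  have "pderiv_at i (\<lambda>y. push y (v y)) x = (\<Sum>a\<in>UNIV. pderiv_at i (\<lambda>y. v y $ a *\<^sub>R T.tan a (f y)) x)"
    unfolding push_def by (rule pderiv_at_sum) (intro differentiable_scaleR' dt dv)
  also have "\<dots> = (\<Sum>a\<in>UNIV. v x $ a *\<^sub>R (\<Sum>b\<in>UNIV. pderiv_at i f x $ b *\<^sub>R pderiv_at b (T.tan a) (f x))
      + pderiv_at i v x $ a *\<^sub>R T.tan a (f x))"
    using assms
    by (simp add: pderiv_at_scaleR[OF dv dt] pderiv_at_nth pderiv_at_compose differentiable_f T.differentiable_tan f_in)
  finally have "S.proj x (pderiv_at i (\<lambda>y. push y (v y)) x) = push x (pderiv_at i v x) +
     (\<Sum>a\<in>UNIV. \<Sum>b\<in>UNIV. \<Sum>c\<in>UNIV. (christoffel h c b a (f x) * pderiv_at i f x $ b * v x $ a) *\<^sub>R T.tan c (f x))"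
    using assms(1)
    by (simp add: linear_add[OF S.linear_proj] linear_sum[OF S.linear_proj] linear_cmul[OF S.linear_proj]
        proj_pderiv_tan proj_tan push_def sum.distrib scaleR_sum_right mult_ac)
  also have "(\<Sum>a\<in>UNIV. \<Sum>b\<in>UNIV. \<Sum>c\<in>UNIV. (christoffel h c b a (f x) * pderiv_at i f x $ b * v x $ a) *\<^sub>R T.tan c (f x))
      = (\<Sum>c\<in>UNIV. \<Sum>b\<in>UNIV. \<Sum>a\<in>UNIV. (christoffel h c b a (f x) * pderiv_at i f x $ b * v x $ a) *\<^sub>R T.tan c (f x))"
    by (subst sum.swap, subst (2) sum.swap, subst sum.swap) simp
  also have "\<dots> = push x (\<chi> c. \<Sum>a\<in>UNIV. \<Sum>b\<in>UNIV. christoffel h c a b (f x) * pderiv_at i f x $ a * v x $ b)"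
    by (simp add: push_def scaleR_sum_left)
  finally show ?thesis
    by (simp add: cov_along_def linear_add[OF linear_push])
qed

lemma smooth_cov_along:
  assumes "smooth_on V v" shows "smooth_on V (cov_along h f i v)"
proof -
  have "smooth_on V (\<lambda>x. christoffel h c a b (f x))" for c a b
    by (rule smooth_on_compose[OF S.open_V T.open_V _ T.smooth_christoffel smooth_f]) (use f_in in auto)
  then have "smooth_on V (\<lambda>x. cov_along h f i v x $ c)" for c
    unfolding cov_along_def vector_add_component vec_lambda_beta
    by (intro smooth_on_add smooth_on_sum smooth_on_mult smooth_on_nth smooth_on_pderiv smooth_f assms S.open_V)
  then show ?thesis by (rule smooth_on_vecI[OF S.open_V])
qed

lemma smooth_hess_map: "smooth_on V (hess_map g h f i j)"
  unfolding hess_map_def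
  by (intro smooth_on_diff smooth_cov_along smooth_on_pderiv smooth_f S.open_V smooth_on_sum smooth_on_scaleR
      S.smooth_christoffel)

lemma smooth_tension: "smooth_on V (tension g h f)"
  unfolding tension_def gtrace_def
  by (intro smooth_on_sum smooth_on_scaleR S.smooth_metric_inv smooth_hess_map S.open_V)

lemma push_hess_map:
  assumes "x \<in> V"
  shows "push x (hess_map g h f i j x) = S.normal_hess i j x + g x $ i $ j *\<^sub>R F x"
proof -
  have "push x (cov_along h f i (pderiv_at j f) x) = S.proj x (pderiv_at i (\<lambda>y. push y (pderiv_at j f y)) x)"
    using assms smooth_on_differentiable_at[OF smooth_on_pderiv[OF smooth_f] S.open_V]
    by (intro push_cov_along)
  also have "pderiv_at i (\<lambda>y. push y (pderiv_at j f y)) x = pderiv_at i (S.tan j) x"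
    by (rule pderiv_at_cong[OF S.open_V assms push_pderiv_f])
  also have "S.proj x \<dots> = pderiv_at i (S.tan j) x + g x $ i $ j *\<^sub>R F x"
    using S.pos_inner_pderiv_tan[OF assms] by (simp add: S.proj_def inner_commute)
  finally show ?thesis
    using assms by (simp add: hess_map_def linear_diff[OF linear_push] linear_sum[OF linear_push]
        linear_cmul[OF linear_push] push_pderiv_f S.normal_hess_def)
qed

lemma push_gtrace: "push x (gtrace g x B) = gtrace g x (\<lambda>i j. push x (B i j))"
  by (simp add: gtrace_def linear_sum[OF linear_push] linear_cmul[OF linear_push])

lemma push_tension: "x \<in> V \<Longrightarrow> push x (tension g h f x) = S.ambient_tension x"
  by (simp add: tension_def push_gtrace S.ambient_tension_def push_hess_map)

lemma push_cov_along_tension: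
  assumes "x \<in> V"
  shows "push x (cov_along h f i (tension g h f) x) = S.proj x (pderiv_at i S.ambient_tension x)"
proof -
  have "push x (cov_along h f i (tension g h f) x) = S.proj x (pderiv_at i (\<lambda>y. push y (tension g h f y)) x)"
    by (rule push_cov_along[OF assms smooth_on_differentiable_at[OF smooth_tension S.open_V assms]])
  also have "pderiv_at i (\<lambda>y. push y (tension g h f y)) x = pderiv_at i S.ambient_tension x"
    by (rule pderiv_at_cong[OF S.open_V assms push_tension])
  finally show ?thesis .
qed

lemma push_rough_laplacian:
  assumes "x \<in> V"
  shows "push x (rough_laplacian g h f (tension g h f) x) =
    - gtrace g x (\<lambda>i j. S.proj x (pderiv_at i (\<lambda>y. S.proj y (pderiv_at j S.ambient_tension y)) x)
        - (\<Sum>k\<in>UNIV. christoffel g k i j x *\<^sub>R S.proj x (pderiv_at k S.ambient_tension x)))"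
proof -
  have "push x (cov_along h f i (cov_along h f j (tension g h f)) x) =
      S.proj x (pderiv_at i (\<lambda>y. S.proj y (pderiv_at j S.ambient_tension y)) x)" for i j
  proof -
    have "push x (cov_along h f i (cov_along h f j (tension g h f)) x) =
        S.proj x (pderiv_at i (\<lambda>y. push y (cov_along h f j (tension g h f) y)) x)"
      by (rule push_cov_along[OF assms
          smooth_on_differentiable_at[OF smooth_cov_along[OF smooth_tension] S.open_V assms]])
    also have "pderiv_at i (\<lambda>y. push y (cov_along h f j (tension g h f) y)) x =
        pderiv_at i (\<lambda>y. S.proj y (pderiv_at j S.ambient_tension y)) x"
      by (rule pderiv_at_cong[OF S.open_V assms push_cov_along_tension])
    finally show ?thesis .
  qed
  then show ?thesis
    using assms
    by (simp add: rough_laplacian_def linear_neg[OF linear_push] push_gtrace linear_diff[OF linear_push]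
        linear_sum[OF linear_push] linear_cmul[OF linear_push] push_cov_along_tension)
qed

text \<open>Of the two terms of the constant curvature tensor, the one with the product of the
  tension field and a tangent vector vanishes, as the tension field is normal.\<close>

lemma push_curv:
  assumes "x \<in> V"
  shows "push x (curv h (f x) (pderiv_at i f x) (tension g h f x) (pderiv_at j f x)) = - g x $ i $ j *\<^sub>R S.ambient_tension x"
  using assms
  by (simp add: T.curv_sphere[OF f_in] linear_neg[OF linear_push] linear_diff[OF linear_push] linear_cmul[OF linear_push]
      push_pderiv_f push_tension push_inner_push[symmetric] S.ambient_tension_inner_tan S.metric_eq)

lemma push_bitension:
  assumes "x \<in> V"
  shows "push x (bitension g h f x) =
    gtrace g x (\<lambda>i j. S.proj x (pderiv_at i (\<lambda>y. S.proj y (pderiv_at j S.ambient_tension y)) x)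
        - (\<Sum>k\<in>UNIV. christoffel g k i j x *\<^sub>R S.proj x (pderiv_at k S.ambient_tension x)))
    + real CARD('m) *\<^sub>R S.ambient_tension x"
proof -
  have "gtrace g x (\<lambda>i j. - g x $ i $ j *\<^sub>R S.ambient_tension x) = - (real CARD('m) *\<^sub>R S.ambient_tension x)"
    using gtrace_cmul[of g x "-1" "\<lambda>i j. g x $ i $ j *\<^sub>R S.ambient_tension x"] S.gtrace_metric[OF assms] by simp
  then show ?thesis
    unfolding bitension_def
    by (simp add: linear_diff[OF linear_push] linear_neg[OF linear_push] push_rough_laplacian[OF assms]
        push_gtrace push_curv[OF assms])
qed

text \<open>Coefficient of the tension field: the dimension from the curvature of the sphere,
  \<open>2 * \<kappa>\<close> from the Ricci term because Ric is \<open>\<kappa>\<close> times the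
  identity, and the scalar curvature term. The gradient term drops out.\<close>

lemma push_c_bitension:
  assumes "x \<in> V" "\<And>X. ricci_op g x X = \<kappa> *\<^sub>R X" "grad g (scal g) x = 0"
  shows "push x (c_bitension g h f x) =
    gtrace g x (\<lambda>i j. S.proj x (pderiv_at i (\<lambda>y. S.proj y (pderiv_at j S.ambient_tension y)) x)
        - (\<Sum>k\<in>UNIV. christoffel g k i j x *\<^sub>R S.proj x (pderiv_at k S.ambient_tension x)))
    + (real CARD('m) + 2 * \<kappa> - 2 / 3 * scal g x) *\<^sub>R S.ambient_tension x"
proof -
  have "gtrace g x (\<lambda>i j. \<Sum>k\<in>UNIV. (ricci_op g x (axis i 1) $ k) *\<^sub>R hess_map g h f k j x) = \<kappa> *\<^sub>R tension g h f x"
    by (simp add: assms(2) axis_def tension_def gtrace_cmul[symmetric] if_distrib if_distribR cong: if_cong)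
  moreover have "frechet_derivative f (at x) 0 = 0"
    using linear_frechet_derivative[OF differentiable_f[OF assms(1)]] by (rule linear_0)
  ultimately show ?thesis
    using assms(1)
    by (simp add: c_bitension_def assms(3) linear_add[OF linear_push] linear_diff[OF linear_push]
        linear_cmul[OF linear_push] push_bitension push_tension algebra_simps)
qed

end

section \<open>Surfaces in the 3-sphere\<close>

locale spherical_surface = spherical_immersion V F g
  for V :: "(real^2) set" and F :: "real^2 \<Rightarrow> real^4" and g
begin

definition det_metric :: "real^2 \<Rightarrow> real" where
  "det_metric x = g x $ 1 $ 1 * g x $ 2 $ 2 - (g x $ 1 $ 2)\<^sup>2"

lemma metric_pos:
  assumes "x \<in> V" shows "g x $ 1 $ 1 > 0" "det_metric x > 0"
proof -
  have ne: "a *\<^sub>R tan 1 x + b *\<^sub>R tan 2 x \<noteq> 0" if "a \<noteq> 0 \<or> b \<noteq> 0" for a b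
    using independent_tangents[OF assms, of "vector [a, b]"] that
    by (auto simp: sum_2 vec_eq_iff forall_2)
  show 1: "g x $ 1 $ 1 > 0" using ne[of 1 0] by (simp add: metric_eq[OF assms])
  \<comment> \<open>A multiple of the component of \<open>tan 2 x\<close> orthogonal to
    \<open>tan 1 x\<close>; its squared length exposes the determinant.\<close>
  let ?v = "(- g x $ 1 $ 2) *\<^sub>R tan 1 x + g x $ 1 $ 1 *\<^sub>R tan 2 x"
  have "?v \<bullet> ?v = g x $ 1 $ 1 * det_metric x"
    by (simp add: det_metric_def metric_eq[OF assms] inner_add_left inner_add_right inner_commute
        algebra_simps power2_eq_square)
  moreover have "?v \<bullet> ?v > 0" using ne[of "- g x $ 1 $ 2" "g x $ 1 $ 1"] 1 by simp
  ultimately show "det_metric x > 0" using 1 by (simp add: zero_less_mult_iff)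
qed

end

locale surface = spherical_surface V F g
  for V :: "(real^2) set" and F :: "real^2 \<Rightarrow> real^4" and g +
  fixes \<eta> :: "real^2 \<Rightarrow> real^4"
  assumes smooth_\<eta>: "smooth_on V \<eta>"
    and \<eta>_unit: "x \<in> V \<Longrightarrow> \<eta> x \<bullet> \<eta> x = 1"
    and \<eta>_pos: "x \<in> V \<Longrightarrow> \<eta> x \<bullet> F x = 0"
    and \<eta>_tan: "x \<in> V \<Longrightarrow> \<eta> x \<bullet> tan i x = 0"
begin

definition sff :: "2 \<Rightarrow> 2 \<Rightarrow> real^2 \<Rightarrow> real" where
  "sff i j x = pderiv_at i (tan j) x \<bullet> \<eta> x"

definition trace_sff :: "real^2 \<Rightarrow> real" where
  "trace_sff x = (\<Sum>i\<in>UNIV. \<Sum>j\<in>UNIV. matrix_inv (g x) $ i $ j * sff i j x)"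

text \<open>The determinant of h relative to g, that is, of the shape operator.\<close>

definition det_sff :: "real^2 \<Rightarrow> real" where
  "det_sff x = (sff 1 1 x * sff 2 2 x - (sff 1 2 x)\<^sup>2) / (g x $ 1 $ 1 * g x $ 2 $ 2 - (g x $ 1 $ 2)\<^sup>2)"

text \<open>The covariant derivative of h; the first index is the direction of
  differentiation.\<close>

definition cov_sff :: "2 \<Rightarrow> 2 \<Rightarrow> 2 \<Rightarrow> real^2 \<Rightarrow> real" where
  "cov_sff i j l x = pderiv_at i (sff j l) x - (\<Sum>k\<in>UNIV. christoffel g k i j x * sff k l x)
     - (\<Sum>k\<in>UNIV. christoffel g k i l x * sff j k x)"

lemma differentiable_\<eta>: "x \<in> V \<Longrightarrow> \<eta> differentiable (at x)"
  by (rule smooth_on_differentiable_at[OF smooth_\<eta> open_V])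

lemma smooth_sff: "smooth_on V (sff i j)"
  unfolding sff_def by (intro smooth_on_inner open_V smooth_on_pderiv smooth_tan smooth_\<eta>)

lemma differentiable_sff: "x \<in> V \<Longrightarrow> sff i j differentiable (at x)"
  by (rule smooth_on_differentiable_at[OF smooth_sff open_V])

lemma smooth_trace_sff: "smooth_on V trace_sff"
  unfolding trace_sff_def by (intro smooth_on_sum smooth_on_mult open_V smooth_metric_inv smooth_sff)

lemma differentiable_trace_sff: "x \<in> V \<Longrightarrow> trace_sff differentiable (at x)"
  by (rule smooth_on_differentiable_at[OF smooth_trace_sff open_V])

lemma orthogonal_frame_eq_0:
  assumes "x \<in> V" "w \<bullet> F x = 0" "w \<bullet> \<eta> x = 0" "\<And>i. w \<bullet> tan i x = 0"
  shows "w = 0"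
proof (rule orthogonal_basis_eq_0[where b = "case_option (F x) (case_option (\<eta> x) (\<lambda>i. tan i x))"])
  show "CARD(2 option option) = CARD(4)" by simp
  fix c :: "real^(2 option option)"
  assume "(\<Sum>k\<in>UNIV. c $ k *\<^sub>R case_option (F x) (case_option (\<eta> x) (\<lambda>i. tan i x)) k) = 0"
  then have 0: "c $ None *\<^sub>R F x + (c $ Some None *\<^sub>R \<eta> x + (\<Sum>i\<in>UNIV. c $ Some (Some i) *\<^sub>R tan i x)) = 0"
    by (simp add: sum_option)
  from arg_cong[OF this, of "\<lambda>v. F x \<bullet> v"] have n: "c $ None = 0"
    using assms(1) \<eta>_pos by (simp add: inner_add_right inner_sum_right on_sphere pos_inner_tan inner_commute)
  from arg_cong[OF 0, of "\<lambda>v. \<eta> x \<bullet> v"] have n': "c $ Some None = 0"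
    using assms(1) \<eta>_tan by (simp add: inner_add_right inner_sum_right \<eta>_unit \<eta>_pos)
  then have "(\<Sum>i\<in>UNIV. (\<chi> i. c $ Some (Some i)) $ i *\<^sub>R tan i x) = 0" using 0 n by simp
  from independent_tangents[OF assms(1) this] have "c $ Some (Some i) = 0" for i by (simp add: vec_eq_iff)
  then have "c $ k = 0" for k using n n' by (cases k; cases "the k") auto
  then show "c = 0" by (simp add: vec_eq_iff)
qed (auto simp: assms split: option.split)

lemma frame_eqI:
  assumes "x \<in> V" "v \<bullet> F x = w \<bullet> F x" "v \<bullet> \<eta> x = w \<bullet> \<eta> x" "\<And>i. v \<bullet> tan i x = w \<bullet> tan i x"
  shows "v = w"
  using orthogonal_frame_eq_0[OF assms(1), of "v - w"] assms(2-) by (simp add: inner_diff_left)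

lemma tan_pos: "x \<in> V \<Longrightarrow> tan i x \<bullet> F x = 0"
  by (subst inner_commute) (rule pos_inner_tan)

lemma tan_\<eta>: "x \<in> V \<Longrightarrow> tan i x \<bullet> \<eta> x = 0"
  by (subst inner_commute) (rule \<eta>_tan)

lemma pos_\<eta>: "x \<in> V \<Longrightarrow> F x \<bullet> \<eta> x = 0"
  by (subst inner_commute) (rule \<eta>_pos)

lemma dual_pos: "x \<in> V \<Longrightarrow> dual k x \<bullet> F x = 0"
  by (simp add: dual_def inner_sum_left tan_pos)

lemma dual_\<eta>: "x \<in> V \<Longrightarrow> dual k x \<bullet> \<eta> x = 0"
  by (simp add: dual_def inner_sum_left tan_\<eta>)

lemmas frame_inner = tan_pos pos_inner_tan tan_\<eta> \<eta>_tan pos_\<eta> \<eta>_pos \<eta>_unit on_sphere dual_pos dual_\<eta>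
  dual_inner_tan

lemma frame_expansion:
  assumes "x \<in> V"
  shows "w = (w \<bullet> F x) *\<^sub>R F x + (w \<bullet> \<eta> x) *\<^sub>R \<eta> x + (\<Sum>k\<in>UNIV. (w \<bullet> dual k x) *\<^sub>R tan k x)" (is "_ = ?r")
proof (rule frame_eqI[OF assms])
  have "(\<Sum>k\<in>UNIV. (w \<bullet> dual k x) * (tan k x \<bullet> tan i x)) = w \<bullet> tan i x" for i
    by (subst (2) tan_eq_sum_dual[OF assms]) (simp add: inner_sum_right metric_eq[OF assms] inner_commute mult.commute)
  then show "w \<bullet> tan i x = ?r \<bullet> tan i x" for i
    by (simp add: assms frame_inner inner_add_left inner_sum_left)
qed (simp_all add: assms frame_inner inner_add_left inner_sum_left)

lemma sff_sym: "x \<in> V \<Longrightarrow> sff i j x = sff j i x"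
  by (simp add: sff_def pderiv_tan_commute[of x i j])

lemma normal_hess_surface:
  assumes "x \<in> V" shows "normal_hess i j x = sff i j x *\<^sub>R \<eta> x - g x $ i $ j *\<^sub>R F x"
proof (rule frame_eqI[OF assms])
  show "normal_hess i j x \<bullet> F x = (sff i j x *\<^sub>R \<eta> x - g x $ i $ j *\<^sub>R F x) \<bullet> F x"
    using assms by (subst inner_commute) (simp add: inner_diff_left frame_inner pos_inner_normal_hess)
  show "normal_hess i j x \<bullet> \<eta> x = (sff i j x *\<^sub>R \<eta> x - g x $ i $ j *\<^sub>R F x) \<bullet> \<eta> x"
    using assms by (simp add: inner_diff_left inner_sum_left frame_inner normal_hess_def sff_def)
qed (use assms in \<open>simp add: inner_diff_left frame_inner normal_hess_inner_tan\<close>)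

lemma pderiv_tan_inner_tan:
  assumes "x \<in> V"
  shows "pderiv_at i (tan j) x \<bullet> tan l x = (\<Sum>k\<in>UNIV. christoffel g k i j x * g x $ k $ l)"
  using normal_hess_inner_tan[OF assms, of i j l]
  by (simp add: normal_hess_def inner_diff_left inner_sum_left metric_eq[OF assms])

lemma pderiv_tan_eq:
  "x \<in> V \<Longrightarrow> pderiv_at i (tan j) x =
    (\<Sum>k\<in>UNIV. christoffel g k i j x *\<^sub>R tan k x) + sff i j x *\<^sub>R \<eta> x - g x $ i $ j *\<^sub>R F x"
  using normal_hess_surface[of x i j] by (simp add: normal_hess_def algebra_simps)

lemma pderiv_\<eta>_inner_tan:
  assumes "x \<in> V" shows "pderiv_at i \<eta> x \<bullet> tan j x = - sff i j x"
proof -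
  have "pderiv_at i (\<lambda>y. \<eta> y \<bullet> tan j y) x = pderiv_at i (\<lambda>y. 0) x"
    by (rule pderiv_at_cong[OF open_V assms]) (simp add: \<eta>_tan)
  then show ?thesis
    using assms by (simp add: pderiv_at_inner differentiable_\<eta> differentiable_tan sff_def inner_commute)
qed

lemma pderiv_\<eta>_inner_\<eta>:
  assumes "x \<in> V" shows "pderiv_at i \<eta> x \<bullet> \<eta> x = 0"
proof -
  have "pderiv_at i (\<lambda>y. \<eta> y \<bullet> \<eta> y) x = pderiv_at i (\<lambda>y. 1) x"
    by (rule pderiv_at_cong[OF open_V assms]) (simp add: \<eta>_unit)
  then show ?thesis
    using assms by (simp add: pderiv_at_inner differentiable_\<eta> inner_commute)
qed

lemma pderiv_\<eta>_inner_pos: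
  assumes "x \<in> V" shows "pderiv_at i \<eta> x \<bullet> F x = 0"
proof -
  have "pderiv_at i (\<lambda>y. \<eta> y \<bullet> F y) x = pderiv_at i (\<lambda>y. 0) x"
    by (rule pderiv_at_cong[OF open_V assms]) (simp add: \<eta>_pos)
  then show ?thesis
    using assms by (simp add: pderiv_at_inner differentiable_\<eta> differentiable_\<Psi> \<eta>_tan)
qed

lemma weingarten:
  assumes "x \<in> V" shows "pderiv_at i \<eta> x = - (\<Sum>k\<in>UNIV. sff i k x *\<^sub>R dual k x)"
  by (rule frame_eqI[OF assms])
    (simp_all add: assms frame_inner inner_sum_left pderiv_\<eta>_inner_pos pderiv_\<eta>_inner_\<eta> pderiv_\<eta>_inner_tan)

text \<open>Differentiating \<open>sff\<close> produces a third derivative of \<open>F\<close>,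
  symmetric in all indices, and one Christoffel term. The two Christoffel terms in
  \<open>cov_sff\<close> complete that one to a symmetric expression.\<close>

lemma codazzi:
  assumes "x \<in> V" shows "cov_sff i j l x = cov_sff j i l x" "cov_sff i j l x = cov_sff i l j x"
proof -
  have *: "pderiv_at i (sff j l) x = pderiv_at i (pderiv_at j (tan l)) x \<bullet> \<eta> x - (\<Sum>k\<in>UNIV. christoffel g k j l x * sff i k x)" for i j l
  proof -
    have "pderiv_at j (tan l) x \<bullet> pderiv_at i \<eta> x = - (\<Sum>k\<in>UNIV. christoffel g k j l x * sff i k x)"
      by (simp add: weingarten[OF assms] inner_sum_right christoffel_eq[OF assms] mult.commute)
    then show ?thesis
      unfolding sff_def[abs_def] using assms
      by (simp add: pderiv_at_inner differentiable_\<eta> smooth_on_differentiable_at[OF smooth_on_pderiv[OF smooth_tan] open_V])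
  qed
  have "pderiv_at i (pderiv_at j (tan l)) x = pderiv_at j (pderiv_at i (tan l)) x"
    by (rule pderiv_at_commute[OF smooth_tan open_V assms])
  then show "cov_sff i j l x = cov_sff j i l x"
    using christoffel_sym[OF assms] sff_sym[OF assms] by (simp add: cov_sff_def *)
  have "pderiv_at i (sff j l) x = pderiv_at i (sff l j) x"
    by (rule pderiv_at_cong[OF open_V assms sff_sym])
  then show "cov_sff i j l x = cov_sff i l j x"
    using sff_sym[OF assms] by (simp add: cov_sff_def)
qed

lemma metric_inv_explicit:
  assumes "x \<in> V"
  shows "matrix_inv (g x) $ 1 $ 1 = g x $ 2 $ 2 / det_metric x"
    "matrix_inv (g x) $ 1 $ 2 = - g x $ 1 $ 2 / det_metric x"
    "matrix_inv (g x) $ 2 $ 1 = - g x $ 1 $ 2 / det_metric x"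
    "matrix_inv (g x) $ 2 $ 2 = g x $ 1 $ 1 / det_metric x"
proof -
  let ?G = "matrix_inv (g x)" and ?d = "det_metric x"
  have "(?G ** g x) $ l $ i = (if l = i then 1 else 0)" for l i
    by (simp add: matrix_inv_left[OF invertible_metric[OF assms]] mat_def)
  then have e: "?G $ l $ 1 * g x $ 1 $ i + ?G $ l $ 2 * g x $ 2 $ i = (if l = i then 1 else 0)" for l i
    by (simp add: matrix_matrix_mult_def sum_2)
  have s: "g x $ 2 $ 1 = g x $ 1 $ 2" by (rule metric_sym[OF assms])
  have d: "?d \<noteq> 0" using metric_pos[OF assms] by simp
  have "?G $ 1 $ 1 * ?d = g x $ 2 $ 2" "?G $ 1 $ 2 * ?d = - g x $ 1 $ 2"
    "?G $ 2 $ 1 * ?d = - g x $ 1 $ 2" "?G $ 2 $ 2 * ?d = g x $ 1 $ 1"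
    using e[of 1 1] e[of 1 2] e[of 2 1] e[of 2 2] unfolding det_metric_def s
    by simp_all algebra+
  then show "?G $ 1 $ 1 = g x $ 2 $ 2 / ?d" "?G $ 1 $ 2 = - g x $ 1 $ 2 / ?d"
    "?G $ 2 $ 1 = - g x $ 1 $ 2 / ?d" "?G $ 2 $ 2 = g x $ 1 $ 1 / ?d"
    using d by (metis nonzero_mult_div_cancel_right)+
qed

lemma trace_sff_explicit:
  assumes "x \<in> V"
  shows "trace_sff x * det_metric x =
    g x $ 2 $ 2 * sff 1 1 x - 2 * g x $ 1 $ 2 * sff 1 2 x + g x $ 1 $ 1 * sff 2 2 x"
  using metric_pos[OF assms] sff_sym[OF assms, of 2 1]
  by (simp add: trace_sff_def sum_2 metric_inv_explicit[OF assms] field_simps)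

lemma det_sff_explicit:
  assumes "x \<in> V"
  shows "det_sff x * det_metric x = sff 1 1 x * sff 2 2 x - (sff 1 2 x)\<^sup>2"
  using metric_pos[OF assms] by (simp add: det_sff_def det_metric_def)

text \<open>The Cayley-Hamilton identity of the shape operator with both indices lowered. It reduces
  the third fundamental form to h and g.\<close>

lemma cayley_hamilton:
  assumes "x \<in> V"
  shows "(\<Sum>i\<in>UNIV. \<Sum>j\<in>UNIV. sff k i x * matrix_inv (g x) $ i $ j * sff j l x)
    = trace_sff x * sff k l x - det_sff x * g x $ k $ l"
proof -
  have d: "det_metric x \<noteq> 0" using metric_pos[OF assms] by simp
  have s: "g x $ 2 $ 1 = g x $ 1 $ 2" "sff 2 1 x = sff 1 2 x"
    using metric_sym sff_sym assms by auto
  \<comment> \<open>Multiplying by the determinant clears the inverse metric and leaves a polynomial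
    identity, checked index by index.\<close>
  have "(\<Sum>i\<in>UNIV. \<Sum>j\<in>UNIV. sff k i x * matrix_inv (g x) $ i $ j * sff j l x) * det_metric x
    = sff k 1 x * g x $ 2 $ 2 * sff 1 l x - sff k 1 x * g x $ 1 $ 2 * sff 2 l x
      - sff k 2 x * g x $ 1 $ 2 * sff 1 l x + sff k 2 x * g x $ 1 $ 1 * sff 2 l x"
    using d by (simp add: sum_2 metric_inv_explicit[OF assms] field_simps)
  also have "\<dots> = (trace_sff x * det_metric x) * sff k l x - (det_sff x * det_metric x) * g x $ k $ l"
    unfolding trace_sff_explicit[OF assms] det_sff_explicit[OF assms]
    using exhaust_2[of k] exhaust_2[of l]
    by (elim disjE) (simp_all add: s algebra_simps power2_eq_square)
  finally have "(\<Sum>i\<in>UNIV. \<Sum>j\<in>UNIV. sff k i x * matrix_inv (g x) $ i $ j * sff j l x) * det_metric x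
    = (trace_sff x * sff k l x - det_sff x * g x $ k $ l) * det_metric x"
    by (simp add: left_diff_distrib right_diff_distrib mult_ac)
  then show ?thesis using d by simp
qed

lemma pderiv_\<eta>_inner_pderiv_\<eta>:
  assumes "x \<in> V"
  shows "pderiv_at k \<eta> x \<bullet> pderiv_at l \<eta> x = trace_sff x * sff k l x - det_sff x * g x $ k $ l"
proof -
  have "pderiv_at k \<eta> x \<bullet> pderiv_at l \<eta> x
      = (\<Sum>i\<in>UNIV. \<Sum>j\<in>UNIV. sff k i x * matrix_inv (g x) $ i $ j * sff j l x)"
    using sff_sym[OF assms, of _ l]
    by (simp add: weingarten[OF assms] inner_sum_left inner_sum_right dual_inner_dual[OF assms]
        sum_distrib_left mult_ac sum_negf) (rule sum.swap)
  then show ?thesis by (simp add: cayley_hamilton[OF assms])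
qed

text \<open>In dimension two an expression skew in \<open>i, j\<close> and in \<open>k, p\<close> is
  unique up to a factor, so the Gauss term of h is \<open>det_sff\<close> times that of g. The
  summand 1 is the contribution of the position component of \<open>normal_hess\<close>.\<close>

lemma curvature_surface:
  assumes "x \<in> V"
  shows "ricci_op g x X = (1 + det_sff x) *\<^sub>R X" "scal g x = 2 * (1 + det_sff x)"
proof -
  let ?K = "1 + det_sff x"
  have d: "det_metric x \<noteq> 0" using metric_pos[OF assms] by simp
  have s: "g x $ 2 $ 1 = g x $ 1 $ 2" "sff 2 1 x = sff 1 2 x"
    using metric_sym sff_sym assms by auto
  have ginv: "(\<Sum>p\<in>UNIV. matrix_inv (g x) $ l $ p * g x $ i $ p) = (if l = i then 1 else 0)" for l i
  proof -
    have "(\<Sum>p\<in>UNIV. matrix_inv (g x) $ l $ p * g x $ i $ p) = (matrix_inv (g x) ** g x) $ l $ i"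
      by (simp add: matrix_matrix_mult_def metric_sym[OF assms, of i])
    then show ?thesis by (simp add: matrix_inv_left[OF invertible_metric[OF assms]] mat_def)
  qed
  have "curv_coeff g l i j k x =
      ?K * ((if l = i then 1 else 0) * g x $ j $ k - (if l = j then 1 else 0) * g x $ i $ k)" for l i j k
  proof -
    have cancel: "A = det_sff x * B" if "A * det_metric x = (det_sff x * det_metric x) * B" for A B
    proof -
      have "A * det_metric x = (det_sff x * B) * det_metric x" using that by (simp add: mult_ac)
      then show ?thesis using d by simp
    qed
    have "(sff j k x * sff i p x - sff i k x * sff j p x) * det_metric x
      = (det_sff x * det_metric x) * (g x $ j $ k * g x $ i $ p - g x $ i $ k * g x $ j $ p)" for p
      unfolding det_sff_explicit[OF assms] unfolding det_metric_def
      using exhaust_2[of i] exhaust_2[of j] exhaust_2[of k] exhaust_2[of p]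
      by (elim disjE) (simp_all add: s algebra_simps power2_eq_square)
    then have h: "sff j k x * sff i p x - sff i k x * sff j p x
      = det_sff x * (g x $ j $ k * g x $ i $ p - g x $ i $ k * g x $ j $ p)" for p
      by (rule cancel)
    have "normal_hess j k x \<bullet> normal_hess i p x - normal_hess i k x \<bullet> normal_hess j p x
       = (sff j k x * sff i p x - sff i k x * sff j p x) + (g x $ j $ k * g x $ i $ p - g x $ i $ k * g x $ j $ p)" for p
      using assms by (simp add: normal_hess_surface inner_diff_left inner_diff_right frame_inner)
    then have N: "normal_hess j k x \<bullet> normal_hess i p x - normal_hess i k x \<bullet> normal_hess j p x
       = ?K * (g x $ j $ k * g x $ i $ p - g x $ i $ k * g x $ j $ p)" for p
      unfolding h by (simp only: distrib_right mult_1 add.commute)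
    have *: "G1 * (K * (a * b1 - c * d1)) + G2 * (K * (a * b2 - c * d2)) = K * ((G1 * b1 + G2 * b2) * a - (G1 * d1 + G2 * d2) * c)"
      for G1 G2 K a b1 b2 c d1 d2 :: real by algebra
    have "curv_coeff g l i j k x = ?K * ((\<Sum>p\<in>UNIV. matrix_inv (g x) $ l $ p * g x $ i $ p) * g x $ j $ k
        - (\<Sum>p\<in>UNIV. matrix_inv (g x) $ l $ p * g x $ j $ p) * g x $ i $ k)"
      unfolding gauss_equation[OF assms] N sum_2 by (rule *)
    then show ?thesis by (simp add: ginv)
  qed
  from ricci_space_form[OF curv_space_form[OF this]]
  have "ricci g x X Y = ?K * (X \<bullet> (g x *v Y))" for X Y by simp
  from ricci_op_space_form[OF this invertible_metric[OF assms] metric_sym[OF assms]]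
  show "ricci_op g x X = ?K *\<^sub>R X" "scal g x = 2 * ?K" by simp_all
qed

lemma ambient_tension_surface:
  "x \<in> V \<Longrightarrow> ambient_tension x = trace_sff x *\<^sub>R \<eta> x"
  by (simp add: ambient_tension_def gtrace_def normal_hess_surface trace_sff_def scaleR_sum_left)

text \<open>The metric is parallel: the derivative of its inverse supplies exactly the Christoffel
  terms of \<open>cov_sff\<close>.\<close>

lemma pderiv_trace_sff:
  assumes "x \<in> V"
  shows "pderiv_at l trace_sff x = (\<Sum>i\<in>UNIV. \<Sum>j\<in>UNIV. matrix_inv (g x) $ i $ j * cov_sff l i j x)"
proof -
  let ?G = "matrix_inv (g x)"
  have dd: "pderiv_at l (dual i) x \<bullet> dual j x = - (\<Sum>p\<in>UNIV. ?G $ j $ p * christoffel g i l p x)" for i j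
    by (subst dual_def) (simp add: inner_sum_right pderiv_dual_inner_tan[OF assms] sum_negf)
  have "pderiv_at l (\<lambda>y. matrix_inv (g y) $ i $ j) x = pderiv_at l (\<lambda>y. dual i y \<bullet> dual j y) x" for i j
    by (rule pderiv_at_cong[OF open_V assms]) (simp add: dual_inner_dual)
  then have G: "pderiv_at l (\<lambda>y. matrix_inv (g y) $ i $ j) x =
     - (\<Sum>p\<in>UNIV. ?G $ i $ p * christoffel g j l p x) - (\<Sum>p\<in>UNIV. ?G $ j $ p * christoffel g i l p x)" for i j
    using assms by (simp add: pderiv_at_inner differentiable_dual dd inner_commute[of "dual i x"])
  have dG: "(\<lambda>y. matrix_inv (g y) $ i $ j) differentiable (at x)" for i j
    by (rule smooth_on_differentiable_at[OF smooth_metric_inv open_V assms])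
  have "pderiv_at l trace_sff x = (\<Sum>i\<in>UNIV. \<Sum>j\<in>UNIV. pderiv_at l (\<lambda>y. matrix_inv (g y) $ i $ j * sff i j y) x)"
    unfolding trace_sff_def[abs_def]
    by (simp add: pderiv_at_sum differentiable_sum dG differentiable_sff[OF assms])
  also have "\<dots> = (\<Sum>i\<in>UNIV. \<Sum>j\<in>UNIV. ?G $ i $ j * pderiv_at l (sff i j) x +
      pderiv_at l (\<lambda>y. matrix_inv (g y) $ i $ j) x * sff i j x)"
    by (simp only: pderiv_at_mult[OF dG differentiable_sff[OF assms]])
  finally have "pderiv_at l trace_sff x = (\<Sum>i\<in>UNIV. \<Sum>j\<in>UNIV. ?G $ i $ j * pderiv_at l (sff i j) x +
      pderiv_at l (\<lambda>y. matrix_inv (g y) $ i $ j) x * sff i j x)" .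
  then show ?thesis
    using sff_sym[OF assms, of 2 1] metric_inv_sym[OF assms, of 2 1]
    by (simp add: G cov_sff_def sum_2 algebra_simps)
qed

end

section \<open>c-biharmonic surfaces with constant Gauss curvature\<close>

text \<open>Two binary quadratic forms, one of them definite, that annihilate a binary cubic form
  annihilate it only trivially unless they are proportional.\<close>

lemma cubic_apolar_eq_0:
  fixes a b c d g11 g12 g22 h11 h12 h22 :: real
  assumes g: "g11 > 0" "g11 * g22 - g12\<^sup>2 > 0"
    and tg: "g22 * a - 2 * g12 * b + g11 * c = 0" "g22 * b - 2 * g12 * c + g11 * d = 0"
    and th: "h22 * a - 2 * h12 * b + h11 * c = 0" "h22 * b - 2 * h12 * c + h11 * d = 0"
    and ne: "g11 * h12 - g12 * h11 \<noteq> 0 \<or> g11 * h22 - g22 * h11 \<noteq> 0"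
  shows "a = 0" "b = 0" "c = 0" "d = 0"
proof -
  \<comment> \<open>Minors of the coefficient rows of g and h: eliminating \<open>c\<close>,
    respectively \<open>d\<close>, between the two annihilation conditions gives \<open>e1\<close>
    and \<open>e2\<close>.\<close>
  define p q where "p = g11 * h12 - g12 * h11" and "q = g11 * h22 - g22 * h11"
  have e1: "q * a = 2 * p * b" and e2: "q * b = 2 * p * c"
    using tg th unfolding p_def q_def by algebra+
  \<comment> \<open>By \<open>e1\<close> and \<open>e2\<close> the triple \<open>(a, b, c)\<close>
    behaves like a multiple of \<open>((2 * p)\<^sup>2, 2 * p * q, q\<^sup>2)\<close>. Inserting
    this into the first condition for g gives the definite form \<open>\<Delta>\<close> as a factor,
    and \<open>(p, q)\<close> is not zero.\<close>
  define \<Delta> where "\<Delta> = g22 * (2 * p)\<^sup>2 - 2 * g12 * (2 * p) * q + g11 * q\<^sup>2"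
  have pos: "\<Delta> > 0"
  proof -
    have "g11 * \<Delta> = (g11 * q - 2 * g12 * p)\<^sup>2 + 4 * (g11 * g22 - g12\<^sup>2) * p\<^sup>2"
      unfolding \<Delta>_def by algebra
    also have "\<dots> > 0"
    proof (cases "p = 0")
      case True
      then have "q \<noteq> 0" using ne by (simp add: p_def q_def)
      then show ?thesis using True g by simp
    next
      case False
      then show ?thesis using g by (intro add_nonneg_pos) simp_all
    qed
    finally show ?thesis using g by (simp add: zero_less_mult_iff)
  qed
  have "\<Delta> * c = 0" "\<Delta> * b = 0" "\<Delta> * a = 0"
    using e1 e2 tg(1) unfolding \<Delta>_def by algebra+
  then show abc: "a = 0" "b = 0" "c = 0" using pos by auto
  show "d = 0" using tg(2) abc g by simp
qed

context surface
begin

text \<open>The right side of \<open>push_c_bitension\<close>, with the coefficient of the tension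
  field as the parameter \<open>c\<close>.\<close>

definition bitension_expr :: "real \<Rightarrow> real^2 \<Rightarrow> real^4" where
  "bitension_expr c x =
    gtrace g x (\<lambda>i j. proj x (pderiv_at i (\<lambda>y. proj y (pderiv_at j ambient_tension y)) x)
        - (\<Sum>k\<in>UNIV. christoffel g k i j x *\<^sub>R proj x (pderiv_at k ambient_tension x)))
    + c *\<^sub>R ambient_tension x"

definition grad_tension :: "2 \<Rightarrow> real^2 \<Rightarrow> real^4" where
  "grad_tension j y = pderiv_at j trace_sff y *\<^sub>R \<eta> y + trace_sff y *\<^sub>R pderiv_at j \<eta> y"

lemma smooth_grad_tension: "smooth_on V (grad_tension j)"
  unfolding grad_tension_def
  by (intro smooth_on_add smooth_on_scaleR open_V smooth_on_pderiv smooth_trace_sff smooth_\<eta>)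

lemma differentiable_grad_tension: "x \<in> V \<Longrightarrow> grad_tension j differentiable (at x)"
  by (rule smooth_on_differentiable_at[OF smooth_grad_tension open_V])

lemma proj_pderiv_tension:
  assumes "x \<in> V" shows "proj x (pderiv_at j ambient_tension x) = grad_tension j x"
proof -
  have "pderiv_at j ambient_tension x = pderiv_at j (\<lambda>y. trace_sff y *\<^sub>R \<eta> y) x"
    by (rule pderiv_at_cong[OF open_V assms ambient_tension_surface])
  also have "\<dots> = grad_tension j x"
    using assms by (simp add: pderiv_at_scaleR differentiable_trace_sff differentiable_\<eta> grad_tension_def)
  finally show ?thesis
    using assms by (simp add: proj_def grad_tension_def inner_add_left frame_inner pderiv_\<eta>_inner_pos)
qed

lemma bitension_expr_eq:
  assumes "x \<in> V"
  shows "bitension_expr c x = gtrace g x (\<lambda>i j. proj x (pderiv_at i (grad_tension j) x)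
        - (\<Sum>k\<in>UNIV. christoffel g k i j x *\<^sub>R grad_tension k x)) + (c * trace_sff x) *\<^sub>R \<eta> x"
proof -
  have "pderiv_at i (\<lambda>y. proj y (pderiv_at j ambient_tension y)) x = pderiv_at i (grad_tension j) x" for i j
    by (rule pderiv_at_cong[OF open_V assms proj_pderiv_tension])
  then show ?thesis
    using assms by (simp add: bitension_expr_def proj_pderiv_tension ambient_tension_surface)
qed

lemma grad_tension_inner:
  assumes "x \<in> V"
  shows "grad_tension j x \<bullet> tan l x = - (trace_sff x * sff j l x)"
    "grad_tension j x \<bullet> \<eta> x = pderiv_at j trace_sff x"
    "grad_tension j x \<bullet> F x = 0"
  using assms by (simp_all add: grad_tension_def inner_add_left frame_inner pderiv_\<eta>_inner_tan
      pderiv_\<eta>_inner_\<eta> pderiv_\<eta>_inner_pos)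

text \<open>Differentiates the known products of \<open>grad_tension\<close> with the tangents,
  which avoids computing second derivatives of \<open>\<eta>\<close>.\<close>

lemma pderiv_grad_tension_inner_tan:
  assumes "x \<in> V"
  shows "pderiv_at i (grad_tension j) x \<bullet> tan l x - (\<Sum>k\<in>UNIV. christoffel g k i j x * (grad_tension k x \<bullet> tan l x))
    = - (pderiv_at i trace_sff x * sff j l x) - pderiv_at j trace_sff x * sff i l x - trace_sff x * cov_sff i j l x"
proof -
  have "pderiv_at i (\<lambda>y. grad_tension j y \<bullet> tan l y) x = pderiv_at i (\<lambda>y. - (trace_sff y * sff j l y)) x"
    by (rule pderiv_at_cong[OF open_V assms]) (rule grad_tension_inner(1))
  also have "\<dots> = - (trace_sff x * pderiv_at i (sff j l) x + pderiv_at i trace_sff x * sff j l x)"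
    using assms by (simp add: pderiv_at_minus pderiv_at_mult differentiable_trace_sff differentiable_sff
        differentiable_bilinear[OF bounded_bilinear_mult])
  also have "pderiv_at i (\<lambda>y. grad_tension j y \<bullet> tan l y) x =
      grad_tension j x \<bullet> pderiv_at i (tan l) x + pderiv_at i (grad_tension j) x \<bullet> tan l x"
    using assms by (simp add: pderiv_at_inner differentiable_grad_tension differentiable_tan)
  also have "grad_tension j x \<bullet> pderiv_at i (tan l) x =
      sff i l x * pderiv_at j trace_sff x - trace_sff x * (\<Sum>k\<in>UNIV. christoffel g k i l x * sff j k x)"
    by (simp add: pderiv_tan_eq[OF assms] inner_add_right inner_diff_right inner_sum_right
        grad_tension_inner[OF assms] sum_negf sum_distrib_left mult_ac)
  finally show ?thesis
    by (simp add: cov_sff_def grad_tension_inner[OF assms] sum_negf sum_distrib_left algebra_simps)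
qed

lemma sum_metric_inv:
  assumes "x \<in> V"
  shows "(\<Sum>i\<in>UNIV. \<Sum>j\<in>UNIV. matrix_inv (g x) $ i $ j * c i j) * det_metric x =
    g x $ 2 $ 2 * c 1 1 - g x $ 1 $ 2 * (c 1 2 + c 2 1) + g x $ 1 $ 1 * c 2 2"
  using metric_pos(2)[OF assms] by (simp add: sum_2 metric_inv_explicit[OF assms] field_simps)

text \<open>The tangential part contains h applied twice to the gradient of u, and u times the
  divergence of h. The Codazzi equation moves \<open>l\<close> to the front, so that the divergence
  becomes the derivative of the trace.\<close>

lemma bitension_tangential:
  assumes "x \<in> V" "bitension_expr c x = 0"
  shows "2 * (\<Sum>i\<in>UNIV. \<Sum>j\<in>UNIV. matrix_inv (g x) $ i $ j * pderiv_at i trace_sff x * sff j l x)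
    + trace_sff x * pderiv_at l trace_sff x = 0"
proof -
  let ?G = "matrix_inv (g x)"
  have proj_tan: "proj x w \<bullet> tan l x = w \<bullet> tan l x" for w
    using assms(1) by (simp add: proj_def inner_diff_left frame_inner)
  have cod: "cov_sff i j l x = cov_sff l i j x" for i j
    using codazzi[OF assms(1)] by metis
  have "0 = bitension_expr c x \<bullet> tan l x" using assms(2) by simp
  also have "\<dots> = (\<Sum>i\<in>UNIV. \<Sum>j\<in>UNIV. ?G $ i $ j *
      (pderiv_at i (grad_tension j) x \<bullet> tan l x - (\<Sum>k\<in>UNIV. christoffel g k i j x * (grad_tension k x \<bullet> tan l x))))"
    using assms(1)
    by (simp add: bitension_expr_eq inner_add_left gtrace_def inner_sum_left inner_diff_left proj_tan frame_inner)
  also have "\<dots> = (\<Sum>i\<in>UNIV. \<Sum>j\<in>UNIV. ?G $ i $ j *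
      (- (pderiv_at i trace_sff x * sff j l x) - pderiv_at j trace_sff x * sff i l x - trace_sff x * cov_sff l i j x))"
    by (simp only: pderiv_grad_tension_inner_tan[OF assms(1)] cod)
  also have "\<dots> = - (2 * (\<Sum>i\<in>UNIV. \<Sum>j\<in>UNIV. ?G $ i $ j * pderiv_at i trace_sff x * sff j l x)
    + trace_sff x * (\<Sum>i\<in>UNIV. \<Sum>j\<in>UNIV. ?G $ i $ j * cov_sff l i j x))"
    using metric_inv_sym[OF assms(1), of 2 1] by (simp add: sum_2 algebra_simps)
  finally show ?thesis using pderiv_trace_sff[OF assms(1), of l] by simp
qed

text \<open>For constant u the normal part of the Laplacian is \<open>- u\<close> times the trace of
  the third fundamental form, which is \<open>u\<^sup>2 - 2 * D\<close> by Cayley-Hamilton.\<close>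

lemma bitension_normal:
  assumes "x \<in> V" "bitension_expr c x = 0" "\<And>y j. y \<in> V \<Longrightarrow> pderiv_at j trace_sff y = 0"
  shows "trace_sff x * (c - (trace_sff x)\<^sup>2 + 2 * det_sff x) = 0"
proof -
  let ?G = "matrix_inv (g x)"
  have proj_\<eta>: "proj x w \<bullet> \<eta> x = w \<bullet> \<eta> x" for w
    using assms(1) by (simp add: proj_def inner_diff_left frame_inner)
  have "pderiv_at i (grad_tension j) x \<bullet> \<eta> x = - trace_sff x * (pderiv_at j \<eta> x \<bullet> pderiv_at i \<eta> x)" for i j
  proof -
    have "pderiv_at i (\<lambda>y. grad_tension j y \<bullet> \<eta> y) x = pderiv_at i (\<lambda>y. 0) x"
      by (rule pderiv_at_cong[OF open_V assms(1)]) (simp add: grad_tension_inner assms(3))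
    then have "grad_tension j x \<bullet> pderiv_at i \<eta> x + pderiv_at i (grad_tension j) x \<bullet> \<eta> x = 0"
      using assms(1) by (simp add: pderiv_at_inner differentiable_grad_tension differentiable_\<eta>)
    then show ?thesis by (simp add: grad_tension_def assms(1,3))
  qed
  then have *: "pderiv_at i (grad_tension j) x \<bullet> \<eta> x =
      - trace_sff x * (trace_sff x * sff j i x - det_sff x * g x $ j $ i)" for i j
    by (simp add: pderiv_\<eta>_inner_pderiv_\<eta>[OF assms(1)])
  have trg: "(\<Sum>i\<in>UNIV. \<Sum>j\<in>UNIV. ?G $ i $ j * g x $ i $ j) = 2"
    using arg_cong[OF gtrace_metric[OF assms(1), of "\<eta> x"], of "\<lambda>v. v \<bullet> \<eta> x"] assms(1)
    by (simp add: gtrace_def inner_sum_left frame_inner)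
  have "0 = bitension_expr c x \<bullet> \<eta> x" using assms(2) by simp
  also have "\<dots> = (\<Sum>i\<in>UNIV. \<Sum>j\<in>UNIV. ?G $ i $ j * (pderiv_at i (grad_tension j) x \<bullet> \<eta> x)) + c * trace_sff x"
    using assms(1)
    by (simp add: bitension_expr_eq inner_add_left gtrace_def inner_sum_left inner_diff_left proj_\<eta>
        frame_inner grad_tension_inner assms(3))
  also have "\<dots> = - trace_sff x * (trace_sff x * (\<Sum>i\<in>UNIV. \<Sum>j\<in>UNIV. ?G $ i $ j * sff i j x)
      - det_sff x * (\<Sum>i\<in>UNIV. \<Sum>j\<in>UNIV. ?G $ i $ j * g x $ i $ j)) + c * trace_sff x"
    using sff_sym[OF assms(1), of 2 1] metric_sym[OF assms(1), of 2 1]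
    by (simp add: * sum_2 algebra_simps)
  finally show ?thesis
    unfolding trg trace_sff_def[symmetric] by (simp add: algebra_simps power2_eq_square)
qed

lemma trace_sff_constant:
  assumes E: "\<And>y. y \<in> V \<Longrightarrow> bitension_expr c y = 0"
    and D: "\<And>y. y \<in> V \<Longrightarrow> det_sff y = \<delta>" and "x \<in> V"
  shows "pderiv_at i trace_sff x = 0"
proof -
  let ?u = trace_sff
  have crit: "4 * \<delta> + 3 * (?u y)\<^sup>2 = 0" if y: "y \<in> V" and ne: "pderiv_at k ?u y \<noteq> 0" for y k
  proof -
    \<comment> \<open>The entries of 2 h + u g. This matrix annihilates the gradient of u, so its
      determinant vanishes; relative to g the determinant is
      \<open>4 * D + 3 * u\<^sup>2\<close>.\<close>
    let ?a = "2 * sff 1 1 y + ?u y * g y $ 1 $ 1"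
    let ?b = "2 * sff 1 2 y + ?u y * g y $ 1 $ 2"
    let ?d = "2 * sff 2 2 y + ?u y * g y $ 2 $ 2"
    \<comment> \<open>The components of the gradient of u, multiplied by \<open>det_metric y\<close>
      to avoid fractions.\<close>
    define p q where "p = g y $ 2 $ 2 * pderiv_at 1 ?u y - g y $ 1 $ 2 * pderiv_at 2 ?u y"
      and "q = g y $ 1 $ 1 * pderiv_at 2 ?u y - g y $ 1 $ 2 * pderiv_at 1 ?u y"
    have s: "g y $ 2 $ 1 = g y $ 1 $ 2" "sff 2 1 y = sff 1 2 y"
      using metric_sym sff_sym y by auto
    have dm: "det_metric y > 0" by (rule metric_pos[OF y])
    have du: "det_metric y * pderiv_at 1 ?u y = g y $ 1 $ 1 * p + g y $ 1 $ 2 * q"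
      "det_metric y * pderiv_at 2 ?u y = g y $ 1 $ 2 * p + g y $ 2 $ 2 * q"
      unfolding det_metric_def p_def q_def by algebra+
    have t: "2 * (p * sff 1 l y + q * sff 2 l y) + ?u y * (det_metric y * pderiv_at l ?u y) = 0" for l
    proof -
      have "(2 * (\<Sum>i\<in>UNIV. \<Sum>j\<in>UNIV. matrix_inv (g y) $ i $ j * (pderiv_at i ?u y * sff j l y))
          + ?u y * pderiv_at l ?u y) * det_metric y = 0"
        using bitension_tangential[OF y E[OF y], of l] by (simp add: mult.assoc)
      then show ?thesis
        using sum_metric_inv[OF y, of "\<lambda>i j. pderiv_at i ?u y * sff j l y"] unfolding p_def q_def by algebra
    qed
    have "?a * p + ?b * q = 0" "?b * p + ?d * q = 0"
      using t[of 1] t[of 2] unfolding du s by (simp_all add: algebra_simps)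
    then have "(?a * ?d - ?b\<^sup>2) * p = 0" "(?a * ?d - ?b\<^sup>2) * q = 0" by algebra+
    moreover have "p \<noteq> 0 \<or> q \<noteq> 0"
      using du dm ne exhaust_2[of k] by auto
    ultimately have "?a * ?d - ?b\<^sup>2 = 0" by auto
    moreover have "?a * ?d - ?b\<^sup>2 = 4 * (det_sff y * det_metric y) + 2 * ?u y * (?u y * det_metric y) + (?u y)\<^sup>2 * det_metric y"
      unfolding det_sff_explicit[OF y] trace_sff_explicit[OF y] unfolding det_metric_def by algebra
    ultimately have "(4 * \<delta> + 3 * (?u y)\<^sup>2) * det_metric y = 0"
      using D[OF y] by (simp add: algebra_simps power2_eq_square)
    then show ?thesis using dm by simp
  qed
  show ?thesis
  proof (rule ccontr)
    assume ne: "pderiv_at i ?u x \<noteq> 0"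
    have "isCont (pderiv_at i ?u) x"
      using smooth_on_differentiable_at[OF smooth_on_pderiv[OF smooth_trace_sff] open_V assms(3)]
      by (rule differentiable_imp_continuous_within)
    then have "eventually (\<lambda>y. pderiv_at i ?u y \<noteq> 0) (at x)"
      using ne by (intro tendsto_imp_eventually_ne) (auto simp: isCont_def)
    then obtain S where S: "open S" "x \<in> S" "\<And>y. y \<in> S \<Longrightarrow> y \<noteq> x \<Longrightarrow> pderiv_at i ?u y \<noteq> 0"
      unfolding eventually_at_topological by blast
    define O' where "O' = S \<inter> V"
    have O': "open O'" "x \<in> O'" "\<And>y. y \<in> O' \<Longrightarrow> 4 * \<delta> + 3 * (?u y)\<^sup>2 = 0"
      using S ne crit open_V assms(3) unfolding O'_def by blast+
    have d: "?u differentiable (at x)" by (rule differentiable_trace_sff[OF assms(3)])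
    have "pderiv_at i (\<lambda>y. ?u y * ?u y) x = pderiv_at i (\<lambda>y. - 4 * \<delta> / 3) x"
    proof (rule pderiv_at_cong[OF O'(1,2)])
      show "?u y * ?u y = - 4 * \<delta> / 3" if "y \<in> O'" for y
        using O'(3)[OF that] unfolding power2_eq_square by linarith
    qed
    then have "?u x * pderiv_at i ?u x = 0"
      using pderiv_at_mult[OF d d, of i] by simp
    \<comment> \<open>Not yet a contradiction: vanishing at \<open>x\<close> forces
      \<open>\<delta> = 0\<close>, and then the same equation makes u vanish on all of
      \<open>O'\<close>, against the nonzero derivative.\<close>
    then have "?u x = 0" using ne by simp
    then have "\<delta> = 0" using O'(3)[OF O'(2)] by simp
    then have "pderiv_at i ?u x = pderiv_at i (\<lambda>y. 0) x"
      using O' by (intro pderiv_at_cong[OF O'(1,2)]) auto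
    then show False using ne by simp
  qed
qed

text \<open>Constant trace and constant determinant give one contraction each: the cubic form
  \<open>cov_sff\<close> is annihilated by g and by h. The inequality says that \<open>x\<close> is
  not umbilic, so \<open>cubic_apolar_eq_0\<close> applies.\<close>

lemma cov_sff_eq_0:
  assumes u: "\<And>y j. y \<in> V \<Longrightarrow> pderiv_at j trace_sff y = 0"
    and D: "\<And>y. y \<in> V \<Longrightarrow> det_sff y = \<delta>" and x: "x \<in> V" and ne: "(trace_sff x)\<^sup>2 \<noteq> 4 * \<delta>"
  shows "cov_sff i j l x = 0"
proof -
  let ?g11 = "g x $ 1 $ 1" and ?g12 = "g x $ 1 $ 2" and ?g22 = "g x $ 2 $ 2"
  let ?h11 = "sff 1 1 x" and ?h12 = "sff 1 2 x" and ?h22 = "sff 2 2 x"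
  have s: "g x $ 2 $ 1 = ?g12" "sff 2 1 x = ?h12"
    using metric_sym sff_sym x by auto
  have dm: "det_metric x > 0" by (rule metric_pos[OF x])
  have tg: "?g22 * cov_sff l 1 1 x - 2 * ?g12 * cov_sff l 1 2 x + ?g11 * cov_sff l 2 2 x = 0" for l
    using sum_metric_inv[OF x, of "\<lambda>i j. cov_sff l i j x"] pderiv_trace_sff[OF x, of l] u[OF x, of l] codazzi(2)[OF x, of l 2 1]
    by simp
  \<comment> \<open>Differentiates det h = \<open>\<delta>\<close> det g. The Christoffel terms on
    the two sides cancel by the same equation.\<close>
  have th: "?h22 * cov_sff l 1 1 x - 2 * ?h12 * cov_sff l 1 2 x + ?h11 * cov_sff l 2 2 x = 0" for l
  proof -
    have dg: "(\<lambda>y. g y $ i $ j) differentiable (at x)" for i j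
      by (rule smooth_on_differentiable_at[OF smooth_metric open_V x])
    have pg: "pderiv_at l (\<lambda>y. g y $ i $ j) x =
      (\<Sum>k\<in>UNIV. christoffel g k l i x * g x $ k $ j) + (\<Sum>k\<in>UNIV. christoffel g k l j x * g x $ k $ i)" for i j
      by (simp add: pderiv_metric[OF x] pderiv_tan_inner_tan[OF x] inner_commute[of "tan i x"])
    have ph: "pderiv_at l (sff i j) x = cov_sff l i j x + (\<Sum>k\<in>UNIV. christoffel g k l i x * sff k j x)
      + (\<Sum>k\<in>UNIV. christoffel g k l j x * sff i k x)" for i j
      by (simp add: cov_sff_def)
    have "pderiv_at l (\<lambda>y. sff 1 1 y * sff 2 2 y - sff 1 2 y * sff 1 2 y) x =
      pderiv_at l (\<lambda>y. \<delta> * (g y $ 1 $ 1 * g y $ 2 $ 2 - g y $ 1 $ 2 * g y $ 1 $ 2)) x"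
    proof (rule pderiv_at_cong[OF open_V x])
      fix y assume y: "y \<in> V"
      show "sff 1 1 y * sff 2 2 y - sff 1 2 y * sff 1 2 y = \<delta> * (g y $ 1 $ 1 * g y $ 2 $ 2 - g y $ 1 $ 2 * g y $ 1 $ 2)"
        using det_sff_explicit[OF y] D[OF y] by (simp add: det_metric_def power2_eq_square)
    qed
    then have e: "?h11 * pderiv_at l (sff 2 2) x + pderiv_at l (sff 1 1) x * ?h22 - 2 * ?h12 * pderiv_at l (sff 1 2) x
      = \<delta> * (?g11 * pderiv_at l (\<lambda>y. g y $ 2 $ 2) x + pderiv_at l (\<lambda>y. g y $ 1 $ 1) x * ?g22
          - 2 * ?g12 * pderiv_at l (\<lambda>y. g y $ 1 $ 2) x)"
      by (simp add: pderiv_at_diff pderiv_at_mult differentiable_bilinear[OF bounded_bilinear_mult]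
          dg differentiable_sff[OF x] differentiable_diff mult.assoc)
    have "?h11 * ?h22 - ?h12\<^sup>2 = \<delta> * (?g11 * ?g22 - ?g12\<^sup>2)"
      using det_sff_explicit[OF x] D[OF x] by (simp add: det_metric_def)
    with e show ?thesis
      unfolding pg ph sum_2 s by algebra
  qed
  \<comment> \<open>If both minors vanished, h would be a multiple of g and the discriminant
    \<open>u\<^sup>2 - 4 * D\<close> would be zero.\<close>
  have ne': "?g11 * ?h12 - ?g12 * ?h11 \<noteq> 0 \<or> ?g11 * ?h22 - ?g22 * ?h11 \<noteq> 0"
  proof (rule ccontr)
    assume "\<not> ?thesis"
    then have z: "?g11 * ?h12 = ?g12 * ?h11" "?g11 * ?h22 = ?g22 * ?h11" by auto
    have "?g11\<^sup>2 * ((trace_sff x * det_metric x)\<^sup>2 - 4 * (det_sff x * det_metric x) * det_metric x) = 0"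
      unfolding trace_sff_explicit[OF x] det_sff_explicit[OF x] unfolding det_metric_def using z by algebra
    then have "(?g11 * det_metric x)\<^sup>2 * ((trace_sff x)\<^sup>2 - 4 * det_sff x) = 0"
      by (simp add: power2_eq_square algebra_simps)
    then show False using ne D[OF x] metric_pos[OF x] by simp
  qed
  note C = codazzi[OF x]
  have sym: "cov_sff 2 1 1 x = cov_sff 1 1 2 x" "cov_sff 2 1 2 x = cov_sff 1 2 2 x"
    "cov_sff 1 2 1 x = cov_sff 1 1 2 x" "cov_sff 2 2 1 x = cov_sff 1 2 2 x"
    using C by metis+
  have "cov_sff 1 1 1 x = 0 \<and> cov_sff 1 1 2 x = 0 \<and> cov_sff 1 2 2 x = 0 \<and> cov_sff 2 2 2 x = 0"
    using cubic_apolar_eq_0[OF metric_pos(1)[OF x] metric_pos(2)[OF x, unfolded det_metric_def]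
        tg[of 1] tg[of 2, unfolded sym] th[of 1] th[of 2, unfolded sym] ne'] by blast
  then show ?thesis
    using exhaust_2[of i] exhaust_2[of j] exhaust_2[of l] sym by (elim disjE) simp_all
qed

lemma umbilic_sff:
  assumes x: "x \<in> V" and eq: "(trace_sff x)\<^sup>2 = 4 * det_sff x"
  shows "sff i j x = trace_sff x / 2 * g x $ i $ j"
proof -
  let ?g11 = "g x $ 1 $ 1" and ?g12 = "g x $ 1 $ 2" and ?g22 = "g x $ 2 $ 2"
  let ?h11 = "sff 1 1 x" and ?h12 = "sff 1 2 x" and ?h22 = "sff 2 2 x"
  have s: "g x $ 2 $ 1 = ?g12" "sff 2 1 x = ?h12"
    using metric_sym sff_sym x by auto
  note pos = metric_pos[OF x]
  define A B where "A = ?g11 * ?h12 - ?g12 * ?h11" and "B = ?g11 * ?h22 - ?g22 * ?h11"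
  \<comment> \<open>The discriminant of the shape operator as a positively weighted sum of two
    squares; its vanishing kills both minors.\<close>
  have "?g11\<^sup>2 * ((trace_sff x * det_metric x)\<^sup>2 - 4 * (det_sff x * det_metric x) * det_metric x) =
     4 * det_metric x * A\<^sup>2 + (?g11 * B - 2 * ?g12 * A)\<^sup>2"
    unfolding trace_sff_explicit[OF x] det_sff_explicit[OF x] unfolding det_metric_def A_def B_def by algebra
  moreover have "(trace_sff x * det_metric x)\<^sup>2 - 4 * (det_sff x * det_metric x) * det_metric x = 0"
    by (simp add: power_mult_distrib eq) (simp add: power2_eq_square)
  ultimately have "4 * det_metric x * A\<^sup>2 + (?g11 * B - 2 * ?g12 * A)\<^sup>2 = 0" by simp
  moreover have "4 * det_metric x * A\<^sup>2 \<ge> 0" using pos by simp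
  ultimately have "4 * det_metric x * A\<^sup>2 = 0" "(?g11 * B - 2 * ?g12 * A)\<^sup>2 = 0"
    using zero_le_power2[of "?g11 * B - 2 * ?g12 * A"] by linarith+
  then have "A = 0" "B = 0" using pos by auto
  then have z: "?g11 * ?h12 = ?g12 * ?h11" "?g11 * ?h22 = ?g22 * ?h11" by (auto simp: A_def B_def)
  have "?g11 * (trace_sff x * det_metric x) = 2 * ?h11 * det_metric x"
    unfolding trace_sff_explicit[OF x] using z unfolding det_metric_def by algebra
  then have "?g11 * trace_sff x * det_metric x = 2 * ?h11 * det_metric x" by simp
  then have "?g11 * trace_sff x = 2 * ?h11" using pos by simp
  then have h: "?h11 = trace_sff x / 2 * ?g11" by (simp add: mult.commute)
  then have "?g11 * ?h12 = ?g11 * (trace_sff x / 2 * ?g12)" "?g11 * ?h22 = ?g11 * (trace_sff x / 2 * ?g22)"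
    using z by simp_all
  then have "?h12 = trace_sff x / 2 * ?g12" "?h22 = trace_sff x / 2 * ?g22" using pos by auto
  then show ?thesis
    using h s exhaust_2[of i] exhaust_2[of j] by (elim disjE) simp_all
qed

lemma umbilic_pderiv_\<eta>:
  assumes x: "x \<in> V" and eq: "(trace_sff x)\<^sup>2 = 4 * det_sff x"
  shows "pderiv_at i \<eta> x = - (trace_sff x / 2) *\<^sub>R tan i x"
proof (rule frame_eqI[OF x])
  show "pderiv_at i \<eta> x \<bullet> tan j x = (- (trace_sff x / 2) *\<^sub>R tan i x) \<bullet> tan j x" for j
    using x by (simp add: pderiv_\<eta>_inner_tan umbilic_sff[OF x eq] metric_eq)
qed (simp_all add: x frame_inner pderiv_\<eta>_inner_\<eta> pderiv_\<eta>_inner_pos)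

end

section \<open>A quadratic form attached to the moving frame, and flatness at points that are not
  umbilic\<close>

context surface
begin

text \<open>If \<open>u = 0\<close>, this is the quadratic form of the operator that swaps \<open>F\<close> with \<open>\<eta>\<close> and maps
  \<open>tan k\<close> to the \<open>k\<close>-th derivative of \<open>\<eta>\<close>; along the Clifford torus it is a fixed reflection.\<close>

definition frame_form :: "real^4 \<Rightarrow> real^2 \<Rightarrow> real" where
  "frame_form z y = 2 * ((z \<bullet> F y) * (z \<bullet> \<eta> y)) - trace_sff y * ((z \<bullet> \<eta> y) * (z \<bullet> \<eta> y))
     + (\<Sum>k\<in>UNIV. (z \<bullet> dual k y) * (z \<bullet> pderiv_at k \<eta> y))"

lemma smooth_frame_form: "smooth_on V (frame_form z)"
  unfolding frame_form_def
  by (intro smooth_on_add smooth_on_diff smooth_on_mult smooth_on_sum smooth_on_inner smooth_on_const open_V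
      smooth smooth_\<eta> smooth_trace_sff smooth_dual smooth_on_pderiv)

lemma pderiv_dual:
  assumes x: "x \<in> V"
  shows "pderiv_at l (dual k) x = - (\<Sum>m\<in>UNIV. christoffel g k l m x *\<^sub>R dual m x)
    + (\<Sum>p\<in>UNIV. matrix_inv (g x) $ k $ p * sff l p x) *\<^sub>R \<eta> x - (if k = l then 1 else 0) *\<^sub>R F x"
    (is "_ = ?r")
proof (rule frame_eqI[OF x])
  have sff: "\<eta> x \<bullet> pderiv_at l (tan p) x = sff l p x" for p
    unfolding sff_def by (rule inner_commute)
  have "pderiv_at l (dual k) x \<bullet> \<eta> x = (\<Sum>p\<in>UNIV. matrix_inv (g x) $ k $ p * (\<eta> x \<bullet> pderiv_at l (tan p) x))"
    by (subst inner_commute) (rule pderiv_dual_inner_normal[OF x \<eta>_tan[OF x]])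
  then show "pderiv_at l (dual k) x \<bullet> \<eta> x = ?r \<bullet> \<eta> x"
    by (simp add: x inner_add_left inner_diff_left inner_sum_left frame_inner sff)
  have "(\<Sum>p\<in>UNIV. matrix_inv (g x) $ k $ p * g x $ p $ l) = (matrix_inv (g x) ** g x) $ k $ l"
    by (simp add: matrix_matrix_mult_def)
  then have "(\<Sum>p\<in>UNIV. matrix_inv (g x) $ k $ p * g x $ l $ p) = (if k = l then 1 else 0)"
    by (simp add: matrix_inv_left[OF invertible_metric[OF x]] mat_def metric_sym[OF x, of l])
  moreover have "pderiv_at l (dual k) x \<bullet> F x = (\<Sum>p\<in>UNIV. matrix_inv (g x) $ k $ p * (F x \<bullet> pderiv_at l (tan p) x))"
    by (subst inner_commute) (rule pderiv_dual_inner_normal[OF x pos_inner_tan[OF x]])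
  ultimately have "pderiv_at l (dual k) x \<bullet> F x = - (if k = l then 1 else 0)"
    by (simp add: pos_inner_pderiv_tan[OF x] sum_negf)
  then show "pderiv_at l (dual k) x \<bullet> F x = ?r \<bullet> F x"
    by (simp add: x inner_add_left inner_diff_left inner_sum_left frame_inner)
  show "pderiv_at l (dual k) x \<bullet> tan p x = ?r \<bullet> tan p x" for p
    by (simp add: x inner_add_left inner_diff_left inner_sum_left frame_inner pderiv_dual_inner_tan)
qed

lemma differentiable_pderiv_\<eta>: "x \<in> V \<Longrightarrow> pderiv_at k \<eta> differentiable (at x)"
  by (rule smooth_on_differentiable_at[OF smooth_on_pderiv[OF smooth_\<eta>] open_V])

text \<open>For parallel h the covariant Hessian of \<open>\<eta>\<close> has no tangential part;
  its other components come from differentiating the orthogonality relations.\<close>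

lemma pderiv_pderiv_\<eta>:
  assumes x: "x \<in> V" and parallel: "\<And>i j k. cov_sff i j k x = 0"
  shows "pderiv_at l (pderiv_at k \<eta>) x = (\<Sum>m\<in>UNIV. christoffel g m l k x *\<^sub>R pderiv_at m \<eta> x)
    - (trace_sff x * sff l k x - det_sff x * g x $ l $ k) *\<^sub>R \<eta> x + sff l k x *\<^sub>R F x" (is "_ = ?r")
proof (rule frame_eqI[OF x])
  have "pderiv_at l (\<lambda>y. pderiv_at k \<eta> y \<bullet> \<eta> y) x = pderiv_at l (\<lambda>y. 0) x"
    by (rule pderiv_at_cong[OF open_V x pderiv_\<eta>_inner_\<eta>])
  then have "pderiv_at l (pderiv_at k \<eta>) x \<bullet> \<eta> x = - (pderiv_at k \<eta> x \<bullet> pderiv_at l \<eta> x)"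
    using x by (simp add: pderiv_at_inner differentiable_\<eta> differentiable_pderiv_\<eta>)
  then show "pderiv_at l (pderiv_at k \<eta>) x \<bullet> \<eta> x = ?r \<bullet> \<eta> x"
    using sff_sym[OF x, of k l] metric_sym[OF x, of k l]
    by (simp add: x inner_add_left inner_diff_left inner_sum_left frame_inner pderiv_\<eta>_inner_\<eta> pderiv_\<eta>_inner_pderiv_\<eta>)
  have "pderiv_at l (\<lambda>y. pderiv_at k \<eta> y \<bullet> F y) x = pderiv_at l (\<lambda>y. 0) x"
    by (rule pderiv_at_cong[OF open_V x pderiv_\<eta>_inner_pos])
  then have "pderiv_at l (pderiv_at k \<eta>) x \<bullet> F x = sff k l x"
    using x by (simp add: pderiv_at_inner differentiable_\<Psi> differentiable_pderiv_\<eta> pderiv_\<eta>_inner_tan)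
  then show "pderiv_at l (pderiv_at k \<eta>) x \<bullet> F x = ?r \<bullet> F x"
    using sff_sym[OF x, of k l]
    by (simp add: x inner_add_left inner_diff_left inner_sum_left frame_inner pderiv_\<eta>_inner_pos)
  show "pderiv_at l (pderiv_at k \<eta>) x \<bullet> tan p x = ?r \<bullet> tan p x" for p
  proof -
    have "pderiv_at l (\<lambda>y. pderiv_at k \<eta> y \<bullet> tan p y) x = pderiv_at l (\<lambda>y. - sff k p y) x"
      by (rule pderiv_at_cong[OF open_V x pderiv_\<eta>_inner_tan])
    then have "pderiv_at l (pderiv_at k \<eta>) x \<bullet> tan p x = - pderiv_at l (sff k p) x - pderiv_at k \<eta> x \<bullet> pderiv_at l (tan p) x"
      using x by (simp add: pderiv_at_inner pderiv_at_minus differentiable_sff differentiable_tan differentiable_pderiv_\<eta>)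
    moreover have "pderiv_at k \<eta> x \<bullet> pderiv_at l (tan p) x = - (\<Sum>j\<in>UNIV. christoffel g j l p x * sff k j x)"
      by (simp add: x pderiv_tan_eq inner_add_right inner_diff_right inner_sum_right pderiv_\<eta>_inner_tan
          pderiv_\<eta>_inner_\<eta> pderiv_\<eta>_inner_pos sum_negf)
    ultimately have "pderiv_at l (pderiv_at k \<eta>) x \<bullet> tan p x = - (\<Sum>m\<in>UNIV. christoffel g m l k x * sff m p x)"
      using parallel[of l k p] by (simp add: cov_sff_def)
    then show ?thesis
      by (simp add: x inner_add_left inner_diff_left inner_sum_left frame_inner pderiv_\<eta>_inner_tan sum_negf)
  qed
qed

text \<open>The trace term in \<open>frame_form\<close> is chosen to cancel all contributions of u.
  What remains carries the factor \<open>det_sff x + 1\<close>, the Gauss curvature, so the form is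
  constant in the flat case and an obstruction otherwise.\<close>

lemma pderiv_frame_form:
  assumes x: "x \<in> V" and parallel: "\<And>i j k. cov_sff i j k x = 0" and u: "pderiv_at l trace_sff x = 0"
  shows "pderiv_at l (frame_form z) x = 2 * (det_sff x + 1) * ((z \<bullet> \<eta> x) * (z \<bullet> tan l x))"
proof -
  let ?u = "trace_sff x" and ?G = "matrix_inv (g x)"
  define a e where "a = z \<bullet> F x" and "e = z \<bullet> \<eta> x"
  define s n where "s k = z \<bullet> dual k x" and "n k = z \<bullet> pderiv_at k \<eta> x" for k
  define t where "t = z \<bullet> tan l x"
  have L: "pderiv_at l (\<lambda>y. z \<bullet> f y) x = z \<bullet> pderiv_at l f x" "(\<lambda>y. z \<bullet> f y) differentiable (at x)"
    if "f differentiable (at x)" for f :: "real^2 \<Rightarrow> real^4"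
    using that pderiv_at_bounded_linear[OF bounded_linear_inner_right that]
      differentiable_bounded_linear[OF bounded_linear_inner_right that] by auto
  note d = differentiable_\<eta>[OF x] differentiable_\<Psi>[OF x] differentiable_dual[OF x] differentiable_pderiv_\<eta>[OF x]
  note M = differentiable_bilinear[OF bounded_bilinear_mult]
  have E: "pderiv_at l (frame_form z) x =
      2 * (a * n l + t * e) - ?u * (2 * (e * n l))
      + (\<Sum>k\<in>UNIV. s k * (z \<bullet> pderiv_at l (pderiv_at k \<eta>) x) + (z \<bullet> pderiv_at l (dual k) x) * n k)"
    unfolding frame_form_def[abs_def]
    by (simp add: pderiv_at_add pderiv_at_diff pderiv_at_mult pderiv_at_sum L d M differentiable_sum
        differentiable_diff differentiable_trace_sff[OF x] u a_def e_def s_def n_def t_def algebra_simps)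
  have E1: "z \<bullet> pderiv_at l (pderiv_at k \<eta>) x = (\<Sum>m\<in>UNIV. christoffel g m l k x * n m)
    - (?u * sff l k x - det_sff x * g x $ l $ k) * e + sff l k x * a" for k
    by (simp add: pderiv_pderiv_\<eta>[OF x parallel] inner_add_right inner_diff_right inner_sum_right n_def e_def a_def)
  have E2: "z \<bullet> pderiv_at l (dual k) x = - (\<Sum>m\<in>UNIV. christoffel g k l m x * s m)
    + (\<Sum>p\<in>UNIV. ?G $ k $ p * sff l p x) * e - (if k = l then 1 else 0) * a" for k
    by (simp add: pderiv_dual[OF x] inner_add_right inner_diff_right inner_sum_right s_def e_def a_def)
  have E3: "(\<Sum>k\<in>UNIV. s k * ((\<Sum>m\<in>UNIV. christoffel g m l k x * n m)
        - (?u * sff l k x - det_sff x * g x $ l $ k) * e + sff l k x * a)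
      + (- (\<Sum>m\<in>UNIV. christoffel g k l m x * s m)
        + (\<Sum>p\<in>UNIV. ?G $ k $ p * sff l p x) * e - (if k = l then 1 else 0) * a) * n k)
    = - e * (\<Sum>k\<in>UNIV. (?u * sff l k x - det_sff x * g x $ l $ k) * s k) + a * (\<Sum>k\<in>UNIV. sff l k x * s k)
      + e * (\<Sum>k\<in>UNIV. (\<Sum>p\<in>UNIV. ?G $ k $ p * sff l p x) * n k) - a * n l"
    using exhaust_2[of l] by (elim disjE) (simp_all add: sum_2 algebra_simps)
  have n_eq: "(\<Sum>j\<in>UNIV. sff k j x * s j) = - n k" for k
    by (simp add: n_def s_def weingarten[OF x] inner_sum_right)
  then have n_eq': "n k = - (sff k 1 x * s 1 + sff k 2 x * s 2)" for k
    by (simp add: sum_2)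
  have "(\<Sum>k\<in>UNIV. g x $ l $ k * s k) = t"
    unfolding t_def s_def by (subst tan_eq_sum_dual[OF x]) (simp add: inner_sum_right)
  then have E4: "(\<Sum>k\<in>UNIV. (?u * sff l k x - det_sff x * g x $ l $ k) * s k) = - ?u * n l - det_sff x * t"
    using n_eq[of l] by (simp add: left_diff_distrib sum_subtractf mult.assoc sum_distrib_left[symmetric])
  have "(\<Sum>k\<in>UNIV. (\<Sum>p\<in>UNIV. ?G $ k $ p * sff l p x) * n k)
      = - (\<Sum>j\<in>UNIV. (\<Sum>i\<in>UNIV. \<Sum>k\<in>UNIV. sff l i x * ?G $ i $ k * sff k j x) * s j)"
    using metric_inv_sym[OF x, of 2 1] by (simp add: n_eq' sum_2 algebra_simps)
  then have E5: "(\<Sum>k\<in>UNIV. (\<Sum>p\<in>UNIV. ?G $ k $ p * sff l p x) * n k) = ?u * n l + det_sff x * t"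
    by (simp only: cayley_hamilton[OF x] E4)
  show ?thesis
    unfolding E E1 E2 E3 E4 E5 n_eq by (simp add: a_def e_def t_def algebra_simps)
qed

text \<open>Equality of the mixed second derivatives of \<open>frame_form\<close> replaces the Ricci identity for the
  parallel second fundamental form.\<close>

lemma parallel_imp_flat:
  assumes u: "\<And>y j. y \<in> V \<Longrightarrow> pderiv_at j trace_sff y = 0"
    and D: "\<And>y. y \<in> V \<Longrightarrow> det_sff y = \<delta>" and x: "x \<in> V" and ne: "(trace_sff x)\<^sup>2 \<noteq> 4 * \<delta>"
  shows "\<delta> = - 1"
proof (rule ccontr)
  assume "\<delta> \<noteq> - 1"
  \<comment> \<open>The derivative formula holds where the covariant derivative of h vanishes; a
    second differentiation needs it on a neighbourhood.\<close>
  define U where "U = {y \<in> V. (trace_sff y)\<^sup>2 \<noteq> 4 * \<delta>}"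
  have "continuous_on V trace_sff"
    using differentiable_trace_sff differentiable_imp_continuous_within
    by (intro continuous_at_imp_continuous_on) blast
  then have "continuous_on V (\<lambda>y. (trace_sff y)\<^sup>2)" by (intro continuous_intros)
  from continuous_open_preimage[OF this open_V, of "- {4 * \<delta>}"]
  have U: "open U" "x \<in> U" "U \<subseteq> V"
    using x ne by (auto simp: U_def vimage_def Int_def)
  have d: "pderiv_at l (frame_form z) y = 2 * (\<delta> + 1) * ((z \<bullet> \<eta> y) * (z \<bullet> tan l y))" if "y \<in> U" for y l z
    using pderiv_frame_form[of y l z] cov_sff_eq_0[OF u D] that D u by (simp add: U_def)
  have dd: "pderiv_at m (pderiv_at l (frame_form z)) x
    = 2 * (\<delta> + 1) * ((z \<bullet> \<eta> x) * (z \<bullet> pderiv_at m (tan l) x) + (z \<bullet> pderiv_at m \<eta> x) * (z \<bullet> tan l x))" for m l z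
  proof -
    have L: "pderiv_at m (\<lambda>y. z \<bullet> f y) x = z \<bullet> pderiv_at m f x" "(\<lambda>y. z \<bullet> f y) differentiable (at x)"
      if "f differentiable (at x)" for f :: "real^2 \<Rightarrow> real^4"
      using that pderiv_at_bounded_linear[OF bounded_linear_inner_right that]
        differentiable_bounded_linear[OF bounded_linear_inner_right that] by auto
    have "pderiv_at m (pderiv_at l (frame_form z)) x =
      pderiv_at m (\<lambda>y. 2 * (\<delta> + 1) * ((z \<bullet> \<eta> y) * (z \<bullet> tan l y))) x"
      by (rule pderiv_at_cong[OF U(1,2) d])
    then show ?thesis
      using x by (simp add: pderiv_at_bounded_linear[OF bounded_linear_mult_right] pderiv_at_mult L
          differentiable_bilinear[OF bounded_bilinear_mult] differentiable_\<eta> differentiable_tan)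
  qed
  \<comment> \<open>The products with \<open>pderiv_at m (tan l) x\<close> are symmetric in
    \<open>m\<close> and \<open>l\<close> and cancel; the factor \<open>2 * (\<delta> + 1)\<close>
    is divided out.\<close>
  have key: "(z \<bullet> pderiv_at 1 \<eta> x) * (z \<bullet> tan 2 x) = (z \<bullet> pderiv_at 2 \<eta> x) * (z \<bullet> tan 1 x)" for z
    using pderiv_at_commute[OF smooth_frame_form open_V x, of 1 2 z] \<open>\<delta> \<noteq> - 1\<close>
      pderiv_tan_commute[OF x, of 1 2]
    by (simp add: dd)
  have \<eta>t: "tan j x \<bullet> pderiv_at i \<eta> x = - sff i j x" for i j
    by (subst inner_commute) (rule pderiv_\<eta>_inner_tan[OF x])
  have tt: "tan i x \<bullet> tan j x = g x $ i $ j" for i j by (simp add: metric_eq[OF x])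
  have s: "g x $ 2 $ 1 = g x $ 1 $ 2" "sff 2 1 x = sff 1 2 x"
    using metric_sym sff_sym x by auto
  \<comment> \<open>\<open>key\<close> is quadratic in \<open>z\<close>, so two basis vectors and
    their sum exhaust it on the tangent plane. Together they make h proportional to g, contrary to
    \<open>ne\<close>.\<close>
  have k1: "sff 1 1 x * g x $ 1 $ 2 = sff 1 2 x * g x $ 1 $ 1"
    using key[of "tan 1 x"] by (simp add: \<eta>t tt s)
  have k2: "sff 1 2 x * g x $ 2 $ 2 = sff 2 2 x * g x $ 1 $ 2"
    using key[of "tan 2 x"] by (simp add: \<eta>t tt s)
  have k3: "(sff 1 1 x + sff 1 2 x) * (g x $ 1 $ 2 + g x $ 2 $ 2) = (sff 1 2 x + sff 2 2 x) * (g x $ 1 $ 1 + g x $ 1 $ 2)"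
    using key[of "tan 1 x + tan 2 x"] by (simp add: \<eta>t tt s inner_add_left algebra_simps)
  have k4: "sff 1 1 x * g x $ 2 $ 2 = sff 2 2 x * g x $ 1 $ 1"
    using k1 k2 k3 by (simp add: algebra_simps)
  have "(trace_sff x * det_metric x)\<^sup>2 - 4 * (det_sff x * det_metric x) * det_metric x = 0"
  proof -
    have "(g x $ 1 $ 1)\<^sup>2 * ((trace_sff x * det_metric x)\<^sup>2 - 4 * (det_sff x * det_metric x) * det_metric x) = 0"
      unfolding trace_sff_explicit[OF x] det_sff_explicit[OF x] unfolding det_metric_def using k1 k4 by algebra
    then show ?thesis using metric_pos(1)[OF x] by simp
  qed
  then have "(det_metric x)\<^sup>2 * ((trace_sff x)\<^sup>2 - 4 * det_sff x) = 0"
    by (simp add: power2_eq_square algebra_simps)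
  then show False using ne D[OF x] metric_pos(2)[OF x] by simp
qed

end

text \<open>\<open>K\<close> is the Gauss curvature. The coefficient is
  \<open>2 + 2 * K - (2 / 3) * (2 * K)\<close>, since the scalar curvature is
  \<open>2 * K\<close>.\<close>

locale c_biharmonic_surface = surface V F g \<eta> for V F g \<eta> +
  fixes K :: real
  assumes bitension_0: "x \<in> V \<Longrightarrow> bitension_expr (2 + 2 * K / 3) x = 0"
    and gauss_curvature: "x \<in> V \<Longrightarrow> det_sff x = K - 1"
begin

lemma pderiv_trace_sff_0: "x \<in> V \<Longrightarrow> pderiv_at i trace_sff x = 0"
  by (rule trace_sff_constant[OF bitension_0 gauss_curvature])

lemma local_cases:
  assumes x: "x \<in> V"
  shows "K = 0 \<and> trace_sff x = 0 \<or> (K = 1 \<or> K = 3) \<and> (trace_sff x)\<^sup>2 = 4 * (K - 1)"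
proof -
  \<comment> \<open>From \<open>2 + 2 * K / 3 + 2 * (K - 1) = 8 * K / 3\<close>. In the umbilic case
    the two alternatives give \<open>K = 1\<close> and, from \<open>8 * K / 3 = 4 * (K - 1)\<close>,
    \<open>K = 3\<close>.\<close>
  have n: "trace_sff x = 0 \<or> (trace_sff x)\<^sup>2 = 8 * K / 3"
    using bitension_normal[OF x bitension_0[OF x] pderiv_trace_sff_0] gauss_curvature[OF x]
    by (auto simp: algebra_simps)
  show ?thesis
  proof (cases "(trace_sff x)\<^sup>2 = 4 * (K - 1)")
    case True
    then show ?thesis using n by auto
  next
    case False
    then have "K = 0" using parallel_imp_flat[OF pderiv_trace_sff_0 gauss_curvature x] by simp
    then show ?thesis using n by auto
  qed
qed

text \<open>The resulting constant vector is normal to the hyperplane that contains the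
  surface.\<close>

lemma umbilic_centre:
  assumes "K = 1 \<or> K = 3" and x: "x \<in> V"
  shows "pderiv_at i (\<lambda>y. \<eta> y + (trace_sff y / 2) *\<^sub>R F y) x = 0"
proof -
  have "(trace_sff x)\<^sup>2 = 4 * det_sff x"
    using local_cases[OF x] assms gauss_curvature[OF x] by auto
  from umbilic_pderiv_\<eta>[OF x this, of i] show ?thesis
    using x pderiv_trace_sff_0[OF x, of i] differentiable_bounded_linear[OF bounded_linear_divide[of 2] differentiable_trace_sff[OF x]]
      pderiv_at_bounded_linear[OF bounded_linear_divide[of 2] differentiable_trace_sff[OF x], of i]
    by (simp add: pderiv_at_add pderiv_at_scaleR differentiable_\<eta> differentiable_\<Psi> differentiable_scaleR')
qed

lemma flat_frame_form:
  assumes "K = 0" and x: "x \<in> V"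
  shows "trace_sff x = 0" "pderiv_at i (frame_form z) x = 0"
proof -
  show u: "trace_sff x = 0" using local_cases[OF x] assms by auto
  have "cov_sff i j k x = 0" for i j k
    using cov_sff_eq_0[OF pderiv_trace_sff_0 gauss_curvature x] u assms by simp
  from pderiv_frame_form[OF x this pderiv_trace_sff_0[OF x]]
  show "pderiv_at i (frame_form z) x = 0" using gauss_curvature[OF x] assms by simp
qed

end

section \<open>Open parts of the model surfaces\<close>

lemma open_image_in_level_set:
  fixes F :: "real^'m::finite \<Rightarrow> real^'n::finite" and G :: "real^'n \<Rightarrow> real^'m"
  assumes V: "open V" "x \<in> V" and cont: "continuous_on V F" and F': "(F has_derivative F') (at x)"
    and G: "linear G" and inj: "\<And>v. G (F' v) = 0 \<Longrightarrow> v = 0"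
    and W: "open W" "F x \<in> W" and injW: "inj_on G (W \<inter> S)" and S: "F ` V \<subseteq> S"
  shows "\<exists>U. open U \<and> F x \<in> U \<and> U \<inter> S \<subseteq> F ` V"
proof -
  have bG: "bounded_linear G" using G by (simp add: linear_conv_bounded_linear)
  have der: "((\<lambda>y. G (F y)) has_derivative (\<lambda>v. G (F' v))) (at x)"
    by (rule bounded_linear.has_derivative[OF bG F'])
  have lin: "linear (\<lambda>v. G (F' v))" using has_derivative_linear[OF der] .
  then have "inj (\<lambda>v. G (F' v))" using inj by (simp add: linear_injective_0)
  then obtain g' where g': "linear g'" "\<And>v. G (F' (g' v)) = v"
    using linear_injective_isomorphism[OF lin] by metis
  define T where "T = V \<inter> F -` W"
  have T: "open T" "x \<in> T" "T \<subseteq> V"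
    using continuous_open_preimage[OF cont V(1) W(1)] V W by (auto simp: T_def)
  have "continuous_on V (\<lambda>y. G (F y))"
    using continuous_on_compose2[OF linear_continuous_on[OF bG, of UNIV] cont] by simp
  \<comment> \<open>This open mapping theorem asks for a right inverse of the derivative at the
    single point \<open>x\<close>.\<close>
  from sussmann_open_mapping[OF V(1) this V(2) der, of g' T]
  have int: "G (F x) \<in> interior ((\<lambda>y. G (F y)) ` T)"
    using g' T by (simp add: linear_conv_bounded_linear o_def id_def interior_open)
  define U where "U = W \<inter> G -` interior ((\<lambda>y. G (F y)) ` T)"
  have "open (G -` interior ((\<lambda>y. G (F y)) ` T))"
    using linear_continuous_on[OF bG, of UNIV] by (simp add: open_vimage)
  then have "open U" "F x \<in> U" using int W by (auto simp: U_def)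
  moreover have "U \<inter> S \<subseteq> F ` V"
  proof
    fix z assume z: "z \<in> U \<inter> S"
    then obtain y where y: "y \<in> T" "G z = G (F y)"
      using interior_subset by (fastforce simp: U_def)
    then have "z = F y"
      using z S T by (intro inj_onD[OF injW]) (auto simp: U_def T_def)
    then show "z \<in> F ` V" using y T by auto
  qed
  ultimately show ?thesis by blast
qed

context surface
begin

lemma continuous_on_F: "continuous_on V F"
  using differentiable_\<Psi> differentiable_imp_continuous_within
  by (intro continuous_at_imp_continuous_on) blast

text \<open>\<open>G\<close> is projection to the tangent plane, with kernel spanned by
  \<open>F x\<close> and \<open>\<eta> x\<close>; it remains to see that the level set is locally a
  graph over that plane.\<close>

lemma open_image_if_graph:
  assumes x: "x \<in> V" and W: "open W" "F x \<in> W" and S: "F ` V \<subseteq> S"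
    and inj: "\<And>z z'. z \<in> W \<inter> S \<Longrightarrow> z' \<in> W \<inter> S \<Longrightarrow> (\<And>k. z \<bullet> tan k x = z' \<bullet> tan k x) \<Longrightarrow>
      z \<bullet> F x = z' \<bullet> F x \<and> z \<bullet> \<eta> x = z' \<bullet> \<eta> x"
  shows "\<exists>U. open U \<and> F x \<in> U \<and> U \<inter> S \<subseteq> F ` V"
proof (rule open_image_in_level_set[OF open_V x continuous_on_F
      has_derivative_pderiv[OF differentiable_\<Psi>[OF x]] _ _ W _ S])
  let ?G = "\<lambda>z. \<chi> k. z \<bullet> tan k x"
  show "linear ?G" by (rule linearI) (simp_all add: vec_eq_iff inner_add_left)
  show "v = 0" if "?G (\<Sum>i\<in>UNIV. v $ i *\<^sub>R tan i x) = 0" for v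
  proof -
    let ?w = "\<Sum>i\<in>UNIV. v $ i *\<^sub>R tan i x"
    have "?w \<bullet> tan k x = 0" for k using that by (simp add: vec_eq_iff)
    then have "?w \<bullet> ?w = 0" by (subst inner_sum_right) simp
    then show ?thesis using independent_tangents[OF x] by simp
  qed
  show "inj_on ?G (W \<inter> S)"
  proof (rule inj_onI)
    fix z z' assume z: "z \<in> W \<inter> S" "z' \<in> W \<inter> S" "?G z = ?G z'"
    then have "z \<bullet> tan k x = z' \<bullet> tan k x" for k by (simp add: vec_eq_iff)
    then show "z = z'" using inj[OF z(1,2)] by (intro frame_eqI[OF x]) auto
  qed
qed

lemma inner_self_frame:
  assumes "x \<in> V"
  shows "z \<bullet> z = (z \<bullet> F x)\<^sup>2 + (z \<bullet> \<eta> x)\<^sup>2 + (\<Sum>k\<in>UNIV. (z \<bullet> dual k x) * (z \<bullet> tan k x))"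
proof -
  have "z \<bullet> z = z \<bullet> ((z \<bullet> F x) *\<^sub>R F x + (z \<bullet> \<eta> x) *\<^sub>R \<eta> x + (\<Sum>k\<in>UNIV. (z \<bullet> dual k x) *\<^sub>R tan k x))"
    by (subst frame_expansion[OF assms, symmetric]) simp
  then show ?thesis by (simp add: inner_add_right inner_sum_right power2_eq_square)
qed

lemma open_image_umbilic:
  assumes x: "x \<in> V" and C: "C = \<eta> x + a *\<^sub>R F x" and S: "F ` V \<subseteq> {z. z \<bullet> z = 1 \<and> z \<bullet> C = a}"
  shows "\<exists>U. open U \<and> F x \<in> U \<and> U \<inter> {z. z \<bullet> z = 1 \<and> z \<bullet> C = a} \<subseteq> F ` V"
proof (rule open_image_if_graph[OF x _ _ S])
  \<comment> \<open>Fixed tangential components put \<open>(\<alpha>, \<beta>)\<close> on a circle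
    and on a line \<open>\<beta> + a * \<alpha> = const\<close>; the sign of
    \<open>\<alpha> - a * \<beta>\<close> selects one of the two intersection points.\<close>
  let ?W = "{z. z \<bullet> (F x - a *\<^sub>R \<eta> x) > 0}"
  show "open ?W" by (intro open_Collect_less continuous_intros)
  show "F x \<in> ?W" using x by (simp add: inner_diff_right frame_inner)
  fix z z' assume z: "z \<in> ?W \<inter> {z. z \<bullet> z = 1 \<and> z \<bullet> C = a}" and z': "z' \<in> ?W \<inter> {z. z \<bullet> z = 1 \<and> z \<bullet> C = a}"
    and eq: "\<And>k. z \<bullet> tan k x = z' \<bullet> tan k x"
  define \<alpha> \<beta> \<alpha>' \<beta>' where "\<alpha> = z \<bullet> F x" and "\<beta> = z \<bullet> \<eta> x" and "\<alpha>' = z' \<bullet> F x" and "\<beta>' = z' \<bullet> \<eta> x"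
  have "z \<bullet> dual k x = z' \<bullet> dual k x" for k by (simp add: dual_def inner_sum_right eq)
  then have n: "\<alpha>\<^sup>2 + \<beta>\<^sup>2 = \<alpha>'\<^sup>2 + \<beta>'\<^sup>2"
    using inner_self_frame[OF x, of z] inner_self_frame[OF x, of z'] z z' eq
    by (simp add: \<alpha>_def \<beta>_def \<alpha>'_def \<beta>'_def)
  have l: "\<beta> + a * \<alpha> = \<beta>' + a * \<alpha>'"
    using z z' by (simp add: C inner_add_right \<alpha>_def \<beta>_def \<alpha>'_def \<beta>'_def)
  have "(\<alpha> - a * \<beta>)\<^sup>2 = (1 + a\<^sup>2) * (\<alpha>\<^sup>2 + \<beta>\<^sup>2) - (\<beta> + a * \<alpha>)\<^sup>2"
    "(\<alpha>' - a * \<beta>')\<^sup>2 = (1 + a\<^sup>2) * (\<alpha>'\<^sup>2 + \<beta>'\<^sup>2) - (\<beta>' + a * \<alpha>')\<^sup>2" by algebra+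
  then have "(\<alpha> - a * \<beta>)\<^sup>2 = (\<alpha>' - a * \<beta>')\<^sup>2" using n l by simp
  moreover have "\<alpha> - a * \<beta> > 0" "\<alpha>' - a * \<beta>' > 0"
    using z z' by (simp_all add: inner_diff_right \<alpha>_def \<beta>_def \<alpha>'_def \<beta>'_def)
  ultimately have m: "\<alpha> - a * \<beta> = \<alpha>' - a * \<beta>'" by (simp add: power2_eq_iff_nonneg)
  have "(1 + a\<^sup>2) * (\<alpha> - \<alpha>') = 0" using l m by algebra
  moreover have "1 + a\<^sup>2 > 0" by (simp add: add_pos_nonneg)
  ultimately have "\<alpha> = \<alpha>'" by simp
  then show "z \<bullet> F x = z' \<bullet> F x \<and> z \<bullet> \<eta> x = z' \<bullet> \<eta> x"
    using l by (simp add: \<alpha>_def \<beta>_def \<alpha>'_def \<beta>'_def)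
qed

lemma open_image_clifford:
  assumes x: "x \<in> V" and u: "trace_sff x = 0" and S: "F ` V \<subseteq> {z. z \<bullet> z = 1 \<and> frame_form z x = 0}"
  shows "\<exists>U. open U \<and> F x \<in> U \<and> U \<inter> {z. z \<bullet> z = 1 \<and> frame_form z x = 0} \<subseteq> F ` V"
proof (rule open_image_if_graph[OF x _ _ S])
  \<comment> \<open>Here \<open>\<alpha>\<^sup>2 + \<beta>\<^sup>2\<close> and
    \<open>\<alpha> * \<beta>\<close> are fixed, hence the squares of
    \<open>\<alpha> + \<beta>\<close> and \<open>\<alpha> - \<beta>\<close>; \<open>?W\<close> fixes
    their signs.\<close>
  let ?W = "{z. z \<bullet> (F x + \<eta> x) > 0} \<inter> {z. z \<bullet> (F x - \<eta> x) > 0}"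
  show "open ?W" by (intro open_Int open_Collect_less continuous_intros)
  show "F x \<in> ?W" using x by (simp add: inner_diff_right inner_add_right frame_inner)
  fix z z' assume z: "z \<in> ?W \<inter> {z. z \<bullet> z = 1 \<and> frame_form z x = 0}"
    and z': "z' \<in> ?W \<inter> {z. z \<bullet> z = 1 \<and> frame_form z x = 0}"
    and eq: "\<And>k. z \<bullet> tan k x = z' \<bullet> tan k x"
  define \<alpha> \<beta> \<alpha>' \<beta>' where "\<alpha> = z \<bullet> F x" and "\<beta> = z \<bullet> \<eta> x" and "\<alpha>' = z' \<bullet> F x" and "\<beta>' = z' \<bullet> \<eta> x"
  have d: "z \<bullet> dual k x = z' \<bullet> dual k x" for k by (simp add: dual_def inner_sum_right eq)
  then have n: "\<alpha>\<^sup>2 + \<beta>\<^sup>2 = \<alpha>'\<^sup>2 + \<beta>'\<^sup>2"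
    using inner_self_frame[OF x, of z] inner_self_frame[OF x, of z'] z z' eq
    by (simp add: \<alpha>_def \<beta>_def \<alpha>'_def \<beta>'_def)
  have "z \<bullet> pderiv_at k \<eta> x = z' \<bullet> pderiv_at k \<eta> x" for k
    by (simp add: weingarten[OF x] inner_sum_right d)
  then have "frame_form z x - frame_form z' x = 2 * (\<alpha> * \<beta>) - 2 * (\<alpha>' * \<beta>')"
    by (simp add: frame_form_def u d \<alpha>_def \<beta>_def \<alpha>'_def \<beta>'_def)
  then have m: "\<alpha> * \<beta> = \<alpha>' * \<beta>'" using z z' by simp
  have "(\<alpha> + \<beta>)\<^sup>2 = (\<alpha>' + \<beta>')\<^sup>2" "(\<alpha> - \<beta>)\<^sup>2 = (\<alpha>' - \<beta>')\<^sup>2"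
    using n m by (simp_all add: power2_sum power2_diff)
  moreover have "\<alpha> + \<beta> > 0" "\<alpha>' + \<beta>' > 0" "\<alpha> - \<beta> > 0" "\<alpha>' - \<beta>' > 0"
    using z z' by (simp_all add: inner_diff_right inner_add_right \<alpha>_def \<beta>_def \<alpha>'_def \<beta>'_def)
  ultimately have "\<alpha> + \<beta> = \<alpha>' + \<beta>'" "\<alpha> - \<beta> = \<alpha>' - \<beta>'" by (simp_all add: power2_eq_iff_nonneg)
  then show "z \<bullet> F x = z' \<bullet> F x \<and> z \<bullet> \<eta> x = z' \<bullet> \<eta> x"
    unfolding \<alpha>_def \<beta>_def \<alpha>'_def \<beta>'_def by linarith
qed

text \<open>The axes are the lines spanned by \<open>(F \<plusminus> \<eta>) / sqrt 2\<close> and the principal directions, which are obtained from an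
  orthonormal tangent frame by a rotation through half the angle of the traceless second
  fundamental form.\<close>

lemma clifford_axes:
  assumes x: "x \<in> V" and u: "trace_sff x = 0" and D: "det_sff x = - 1"
  shows "\<exists>A :: real^4 \<Rightarrow> real^4. orthogonal_transformation A \<and>
    (\<forall>z. frame_form z x = (A z $ 1)\<^sup>2 + (A z $ 2)\<^sup>2 - (A z $ 3)\<^sup>2 - (A z $ 4)\<^sup>2)"
proof -
  define g11 g12 g22 where "g11 = g x $ 1 $ 1" and "g12 = g x $ 1 $ 2" and "g22 = g x $ 2 $ 2"
  define h11 h12 h22 where "h11 = sff 1 1 x" and "h12 = sff 1 2 x" and "h22 = sff 2 2 x"
  define d where "d = g11 * g22 - g12\<^sup>2"
  note defs = g11_def g12_def g22_def h11_def h12_def h22_def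
  have d_eq: "d = det_metric x" by (simp add: d_def defs det_metric_def)
  have pos: "g11 > 0" "d > 0" using metric_pos[OF x] by (simp_all add: d_eq defs)
  have tr: "g22 * h11 - 2 * g12 * h12 + g11 * h22 = 0"
    using trace_sff_explicit[OF x] by (simp add: u defs)
  have det: "h11 * h22 - h12\<^sup>2 = - d"
    using det_sff_explicit[OF x] by (simp add: D d_eq defs)
  define r w where "r = sqrt g11" and "w = sqrt d"
  have rw: "r > 0" "w > 0" "r\<^sup>2 = g11" "w\<^sup>2 = d" using pos by (simp_all add: r_def w_def)
  \<comment> \<open>Minus the entries of h at \<open>(t1, t1)\<close> and \<open>(t1, t2)\<close> in
    the orthonormal frame \<open>t1\<close>, \<open>t2\<close> defined below. Trace 0 and
    determinant -1 give \<open>a\<^sup>2 + b\<^sup>2 = 1\<close>.\<close>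
  define a b where "a = - h11 / g11" and "b = (h11 * g12 - h12 * g11) / (g11 * w)"
  have "a\<^sup>2 + b\<^sup>2 = (h11\<^sup>2 * d + (h11 * g12 - h12 * g11)\<^sup>2) / (g11\<^sup>2 * d)"
    using pos rw by (simp add: a_def b_def power_divide power_mult_distrib add_divide_distrib)
  also have "h11\<^sup>2 * d + (h11 * g12 - h12 * g11)\<^sup>2 = g11\<^sup>2 * d"
    using tr det unfolding d_def by algebra
  finally have "a\<^sup>2 + b\<^sup>2 = 1" using pos by simp
  \<comment> \<open>Rotation through \<open>\<theta> / 2\<close> diagonalizes the symmetric matrix
    with rows \<open>(a, b)\<close> and \<open>(b, - a)\<close>.\<close>
  then obtain \<theta> where \<theta>: "a = cos \<theta>" "b = sin \<theta>" by (rule sincos_total_2pi)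
  define c s where "c = cos (\<theta> / 2)" and "s = sin (\<theta> / 2)"
  have cs: "c\<^sup>2 + s\<^sup>2 = 1" "a = c\<^sup>2 - s\<^sup>2" "b = 2 * s * c"
    using cos_double[of "\<theta> / 2"] sin_double[of "\<theta> / 2"] by (simp_all add: \<theta> c_def s_def)
  define t1 t2 where "t1 = (1 / r) *\<^sub>R tan 1 x" and "t2 = (w / r) *\<^sub>R dual 2 x"
  define A :: "real^4 \<Rightarrow> real^4" where "A z = vector [z \<bullet> ((1 / sqrt 2) *\<^sub>R (F x + \<eta> x)), z \<bullet> (c *\<^sub>R t1 + s *\<^sub>R t2),
    z \<bullet> ((1 / sqrt 2) *\<^sub>R (F x - \<eta> x)), z \<bullet> (c *\<^sub>R t2 - s *\<^sub>R t1)]" for z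
  have A: "A z $ 1 = (z \<bullet> F x + z \<bullet> \<eta> x) / sqrt 2" "A z $ 2 = c * (z \<bullet> t1) + s * (z \<bullet> t2)"
    "A z $ 3 = (z \<bullet> F x - z \<bullet> \<eta> x) / sqrt 2" "A z $ 4 = c * (z \<bullet> t2) - s * (z \<bullet> t1)" for z
    by (simp_all add: A_def vector_def inner_add_right inner_diff_right)
  have lin: "linear A"
    by (rule linearI) (simp_all add: vec_eq_iff forall_4 A inner_add_left algebra_simps add_divide_distrib diff_divide_distrib)
  have tang: "(\<Sum>k\<in>UNIV. (z \<bullet> dual k x) * (z \<bullet> tan k x)) = (z \<bullet> t1)\<^sup>2 + (z \<bullet> t2)\<^sup>2"
    "(\<Sum>k\<in>UNIV. (z \<bullet> dual k x) * (z \<bullet> pderiv_at k \<eta> x)) = a * ((z \<bullet> t1)\<^sup>2 - (z \<bullet> t2)\<^sup>2) + 2 * b * (z \<bullet> t1) * (z \<bullet> t2)" for z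
  proof -
    define d1 d2 where "d1 = z \<bullet> dual 1 x" and "d2 = z \<bullet> dual 2 x"
    have y: "z \<bullet> tan 1 x = g11 * d1 + g12 * d2" "z \<bullet> tan 2 x = g12 * d1 + g22 * d2"
      using metric_sym[OF x, of 2 1]
      by (simp_all add: tan_eq_sum_dual[OF x] inner_sum_right inner_add_right sum_2 defs d1_def d2_def)
    have st: "r * (z \<bullet> t1) = g11 * d1 + g12 * d2" "r * (z \<bullet> t2) = w * d2"
      using rw by (simp_all add: t1_def t2_def y d2_def)
    have n: "z \<bullet> pderiv_at 1 \<eta> x = - (h11 * d1 + h12 * d2)" "z \<bullet> pderiv_at 2 \<eta> x = - (h12 * d1 + h22 * d2)"
      using sff_sym[OF x, of 2 1]
      by (simp_all add: weingarten[OF x] inner_sum_right inner_add_right inner_diff_right sum_2 defs d1_def d2_def)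
    have "r\<^sup>2 * ((z \<bullet> t1)\<^sup>2 + (z \<bullet> t2)\<^sup>2) = g11 * (d1 * (g11 * d1 + g12 * d2) + d2 * (g12 * d1 + g22 * d2))"
      using st rw(4) unfolding d_def by algebra
    then show "(\<Sum>k\<in>UNIV. (z \<bullet> dual k x) * (z \<bullet> tan k x)) = (z \<bullet> t1)\<^sup>2 + (z \<bullet> t2)\<^sup>2"
      using pos by (simp add: rw sum_2 y d1_def d2_def)
    have ab: "g11 * a = - h11" "g11 * w * b = h11 * g12 - h12 * g11"
      using pos rw by (simp_all add: a_def b_def)
    have "r\<^sup>2 * g11 * (a * ((z \<bullet> t1)\<^sup>2 - (z \<bullet> t2)\<^sup>2) + 2 * b * (z \<bullet> t1) * (z \<bullet> t2))
      = (g11 * a) * ((r * (z \<bullet> t1))\<^sup>2 - (r * (z \<bullet> t2))\<^sup>2) + 2 * g11 * b * (r * (z \<bullet> t1)) * (r * (z \<bullet> t2))"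
      by algebra
    also have "\<dots> = - h11 * ((g11 * d1 + g12 * d2)\<^sup>2 - d * d2\<^sup>2) + 2 * (g11 * w * b) * (g11 * d1 + g12 * d2) * d2"
      unfolding st ab(1) by (simp add: power_mult_distrib rw(4) algebra_simps)
    also have "\<dots> = g11\<^sup>2 * (d1 * - (h11 * d1 + h12 * d2) + d2 * - (h12 * d1 + h22 * d2))"
      unfolding ab(2) using tr unfolding d_def by algebra
    finally show "(\<Sum>k\<in>UNIV. (z \<bullet> dual k x) * (z \<bullet> pderiv_at k \<eta> x)) =
        a * ((z \<bullet> t1)\<^sup>2 - (z \<bullet> t2)\<^sup>2) + 2 * b * (z \<bullet> t1) * (z \<bullet> t2)"
      using pos by (simp add: rw(3) sum_2 n d1_def d2_def power2_eq_square[of g11])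
  qed
  have sqrt2: "(v / sqrt 2)\<^sup>2 = v\<^sup>2 / 2" for v :: real by (simp add: power_divide)
  have "A z \<bullet> A z = z \<bullet> z" for z
  proof -
    have "A z \<bullet> A z = (A z $ 1)\<^sup>2 + (A z $ 2)\<^sup>2 + (A z $ 3)\<^sup>2 + (A z $ 4)\<^sup>2"
      by (simp add: inner_vec_def sum_4 power2_eq_square)
    also have "\<dots> = (z \<bullet> F x)\<^sup>2 + (z \<bullet> \<eta> x)\<^sup>2 + (c\<^sup>2 + s\<^sup>2) * ((z \<bullet> t1)\<^sup>2 + (z \<bullet> t2)\<^sup>2)"
      unfolding A sqrt2 by (simp add: power2_eq_square field_simps)
    finally show ?thesis by (simp add: cs(1) inner_self_frame[OF x, of z] tang)
  qed
  then have "orthogonal_transformation A"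
    using lin by (simp add: orthogonal_transformation norm_eq_sqrt_inner)
  moreover have "frame_form z x = (A z $ 1)\<^sup>2 + (A z $ 2)\<^sup>2 - (A z $ 3)\<^sup>2 - (A z $ 4)\<^sup>2" for z
    unfolding A sqrt2 frame_form_def tang u cs(2,3)
    by (simp add: power2_eq_square algebra_simps add_divide_distrib diff_divide_distrib)
  ultimately show ?thesis by blast
qed

end

section \<open>Moving the level sets onto the model surfaces by orthogonal maps\<close>

lemma openin_orthogonal_image:
  fixes A :: "real^'n::finite \<Rightarrow> real^'n"
  assumes A: "orthogonal_transformation A" and X: "openin (top_of_set S) X"
  shows "openin (top_of_set (A ` S)) (A ` X)"
proof -
  obtain T where T: "open T" "X = S \<inter> T" using X by (auto simp: openin_open)
  have "open (A ` T)"
    using open_surjective_linear_image[OF T(1) orthogonal_transformation_linear[OF A] orthogonal_transformation_surj[OF A]] .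
  moreover have "A ` X = A ` S \<inter> A ` T"
    using T(2) image_Int[OF orthogonal_transformation_inj[OF A]] by simp
  ultimately show ?thesis by (auto simp: openin_open)
qed

lemma open_part_umbilic:
  fixes C :: "real^4" and X :: "(real^4) set"
  assumes X: "openin (top_of_set {z. z \<bullet> z = 1 \<and> z \<bullet> C = a}) X" and C: "C \<bullet> C = 1 + a\<^sup>2"
  shows "a = 0 \<Longrightarrow> open_part_up_to_isometry X totally_geodesic_S2"
    "a\<^sup>2 = 2 \<Longrightarrow> open_part_up_to_isometry X (small_S2 (1 / sqrt 3))"
proof -
  \<comment> \<open>\<open>\<sigma>\<close> normalizes \<open>C\<close> to a unit vector, which is
    rotated to the fourth axis; \<open>\<rho>\<close> is then the height of the hyperplane.\<close>
  have rot: "\<exists>A :: real^4 \<Rightarrow> real^4. orthogonal_transformation A \<and> A ` {z. z \<bullet> z = 1 \<and> z \<bullet> C = a} = {z \<in> sphere 0 1. z $ 4 = \<rho>}"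
    if \<sigma>: "\<sigma> \<noteq> 0" "\<sigma>\<^sup>2 * (1 + a\<^sup>2) = 1" "\<sigma> * a = \<rho>" for \<sigma> \<rho>
  proof -
    have "norm (\<sigma> *\<^sub>R C) = norm (axis 4 1 :: real^4)"
      using \<sigma>(2) C by (simp add: norm_eq_sqrt_inner power2_eq_square mult.assoc inner_axis_axis)
    then obtain A where A: "orthogonal_transformation A" "A (\<sigma> *\<^sub>R C) = (axis 4 1 :: real^4)"
      using orthogonal_transformation_exists[of "\<sigma> *\<^sub>R C" "axis 4 1 :: real^4"] by auto
    have 4: "A z $ 4 = \<sigma> * (z \<bullet> C)" for z
    proof -
      have "A z \<bullet> A (\<sigma> *\<^sub>R C) = z \<bullet> (\<sigma> *\<^sub>R C)"
        using A(1) by (simp add: orthogonal_transformation_def del: inner_scaleR_right)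
      then show ?thesis by (simp add: A(2) inner_axis)
    qed
    have n: "A z \<bullet> A z = z \<bullet> z" for z using A(1) by (simp add: orthogonal_transformation_def)
    have "A ` {z. z \<bullet> z = 1 \<and> z \<bullet> C = a} = {z \<in> sphere 0 1. z $ 4 = \<rho>}"
    proof (intro equalityI subsetI)
      fix y :: "real^4" assume "y \<in> {z \<in> sphere 0 1. z $ 4 = \<rho>}"
      then have y: "y \<bullet> y = 1" "y $ 4 = \<rho>" by (auto simp: norm_eq_1)
      obtain z where z: "y = A z" using orthogonal_transformation_surj[OF A(1)] by (metis surjD)
      then have "z \<bullet> z = 1" "\<sigma> * (z \<bullet> C) = \<sigma> * a" using y n 4 \<sigma> by auto
      then show "y \<in> A ` {z. z \<bullet> z = 1 \<and> z \<bullet> C = a}" using z \<sigma>(1) by auto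
    qed (use n 4 \<sigma> in \<open>auto simp: norm_eq_1\<close>)
    then show ?thesis using A(1) by blast
  qed
  show "open_part_up_to_isometry X totally_geodesic_S2" if "a = 0"
    using rot[of 1 0] that openin_orthogonal_image[OF _ X]
    by (fastforce simp: open_part_up_to_isometry_def totally_geodesic_S2_def)
  show "open_part_up_to_isometry X (small_S2 (1 / sqrt 3))" if a: "a\<^sup>2 = 2"
  proof -
    \<comment> \<open>\<open>small_S2\<close> lies at positive height, so the sign of
      \<open>a\<close> is absorbed into \<open>\<sigma>\<close>. Since
      \<open>C \<bullet> C = 3\<close>, the distance of the hyperplane is
      \<open>sqrt 2 / sqrt 3\<close>, which belongs to radius \<open>1 / sqrt 3\<close>.\<close>
    have "sgn a * a = sqrt 2" using a by (metis abs_sgn mult.commute real_sqrt_abs)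
    then have "sgn a / sqrt 3 * a = sqrt (2 / 3)" by (simp add: real_sqrt_divide)
    moreover have "sqrt (1 - (1 / sqrt 3)\<^sup>2) = sqrt (2 / 3)" by (simp add: power_divide)
    moreover have "a \<noteq> 0" using a by auto
    moreover have "(sgn a / sqrt 3)\<^sup>2 * (1 + a\<^sup>2) = 1"
      using a \<open>a \<noteq> 0\<close> by (simp add: power_divide sgn_if)
    ultimately obtain A :: "real^4 \<Rightarrow> real^4" where A: "orthogonal_transformation A"
      "A ` {z. z \<bullet> z = 1 \<and> z \<bullet> C = a} = small_S2 (1 / sqrt 3)"
      using rot[of "sgn a / sqrt 3" "sqrt (2 / 3)"] by (auto simp: small_S2_def sgn_0_0)
    then show ?thesis
      using openin_orthogonal_image[OF A(1) X] by (auto simp: open_part_up_to_isometry_def)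
  qed
qed

text \<open>The sum and the difference of \<open>z \<bullet> z = 1\<close> and
  \<open>q z = 0\<close> say that both pairs of squares add up to 1/2.\<close>

lemma open_part_clifford:
  fixes q :: "real^4 \<Rightarrow> real" and A :: "real^4 \<Rightarrow> real^4"
  assumes X: "openin (top_of_set {z. z \<bullet> z = 1 \<and> q z = 0}) X" and A: "orthogonal_transformation A"
    and q: "\<And>z. q z = (A z $ 1)\<^sup>2 + (A z $ 2)\<^sup>2 - (A z $ 3)\<^sup>2 - (A z $ 4)\<^sup>2"
  shows "open_part_up_to_isometry X (product_torus (1 / sqrt 2) (1 / sqrt 2))"
proof -
  have n: "z \<bullet> z = (A z $ 1)\<^sup>2 + (A z $ 2)\<^sup>2 + (A z $ 3)\<^sup>2 + (A z $ 4)\<^sup>2" for z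
  proof -
    have "z \<bullet> z = A z \<bullet> A z" using A by (simp add: orthogonal_transformation_def)
    then show ?thesis by (simp add: inner_vec_def sum_4 power2_eq_square)
  qed
  have T: "product_torus (1 / sqrt 2) (1 / sqrt 2) = {y. (y $ 1)\<^sup>2 + (y $ 2)\<^sup>2 = 1 / 2 \<and> (y $ 3)\<^sup>2 + (y $ 4)\<^sup>2 = 1 / 2}"
    by (simp add: product_torus_def power_divide)
  have "A ` {z. z \<bullet> z = 1 \<and> q z = 0} = product_torus (1 / sqrt 2) (1 / sqrt 2)"
  proof (intro equalityI subsetI)
    fix y assume y: "y \<in> product_torus (1 / sqrt 2) (1 / sqrt 2)"
    obtain z where z: "y = A z" using orthogonal_transformation_surj[OF A] by (metis surjD)
    then have "z \<bullet> z = 1" "q z = 0" using y n[of z] q[of z] by (auto simp: T)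
    then show "y \<in> A ` {z. z \<bullet> z = 1 \<and> q z = 0}" using z by auto
  next
    fix y assume "y \<in> A ` {z. z \<bullet> z = 1 \<and> q z = 0}"
    then obtain z where z: "y = A z" "z \<bullet> z = 1" "q z = 0" by auto
    then show "y \<in> product_torus (1 / sqrt 2) (1 / sqrt 2)" using n[of z] q[of z] by (simp add: T)
  qed
  then show ?thesis
    using A openin_orthogonal_image[OF A X] by (auto simp: open_part_up_to_isometry_def)
qed

section \<open>The unit normal\<close>

text \<open>The ternary cross product of R^4, given by 3 by 3 minors with alternating signs.\<close>

definition cross4 :: "real^4 \<Rightarrow> real^4 \<Rightarrow> real^4 \<Rightarrow> real^4" where
  "cross4 a b c = (let D = \<lambda>i j k. a $ i * (b $ j * c $ k - b $ k * c $ j)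
      - a $ j * (b $ i * c $ k - b $ k * c $ i) + a $ k * (b $ i * c $ j - b $ j * c $ i)
    in vector [D 2 3 4, - D 1 3 4, D 1 2 4, - D 1 2 3])"

lemma vector_4_nth [simp]:
  "(vector [a, b, c, d] :: 'a::zero^4) $ 1 = a" "(vector [a, b, c, d] :: 'a::zero^4) $ 2 = b"
  "(vector [a, b, c, d] :: 'a::zero^4) $ 3 = c" "(vector [a, b, c, d] :: 'a::zero^4) $ 4 = d"
  unfolding vector_def by simp_all

lemma cross4_orthogonal: "cross4 a b c \<bullet> a = 0" "cross4 a b c \<bullet> b = 0" "cross4 a b c \<bullet> c = 0"
  by (simp_all add: cross4_def Let_def inner_vec_def sum_4 algebra_simps)

lemma cross4_inner_self:
  assumes "a \<bullet> a = 1" "a \<bullet> b = 0" "a \<bullet> c = 0"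
  shows "cross4 a b c \<bullet> cross4 a b c = (b \<bullet> b) * (c \<bullet> c) - (b \<bullet> c)\<^sup>2"
proof -
  have "cross4 a b c \<bullet> cross4 a b c = (a \<bullet> a) * ((b \<bullet> b) * (c \<bullet> c) - (b \<bullet> c)\<^sup>2)
     - (a \<bullet> b) * ((a \<bullet> b) * (c \<bullet> c) - (b \<bullet> c) * (a \<bullet> c)) + (a \<bullet> c) * ((a \<bullet> b) * (b \<bullet> c) - (b \<bullet> b) * (a \<bullet> c))"
    unfolding cross4_def Let_def inner_vec_def sum_4 vector_4_nth inner_real_def by algebra
  then show ?thesis using assms by simp
qed

text \<open>A change of tangent basis rescales the product by its determinant; positivity of that
  determinant will make the unit normal independent of the chart.\<close>

lemma cross4_change_basis:
  "cross4 a (\<alpha> *\<^sub>R b + \<beta> *\<^sub>R c) (\<gamma> *\<^sub>R b + \<delta> *\<^sub>R c) = (\<alpha> * \<delta> - \<beta> * \<gamma>) *\<^sub>R cross4 a b c"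
  by (simp add: cross4_def Let_def vec_eq_iff forall_4 algebra_simps)

lemma smooth_on_cross4:
  assumes "open V" "smooth_on V a" "smooth_on V b" "smooth_on V c"
  shows "smooth_on V (\<lambda>x. cross4 (a x) (b x) (c x))"
proof (rule smooth_on_vecI[OF assms(1)])
  have "\<forall>k. smooth_on V (\<lambda>x. cross4 (a x) (b x) (c x) $ k)"
    unfolding forall_4 cross4_def Let_def vector_4_nth
    by (intro conjI smooth_on_add smooth_on_diff smooth_on_minus smooth_on_mult smooth_on_nth assms)
  then show "smooth_on V (\<lambda>x. cross4 (a x) (b x) (c x) $ k)" for k by blast
qed

context spherical_surface
begin

text \<open>An explicit formula, so that smoothness and the choice of sign are settled at
  once.\<close>

definition normal :: "real^2 \<Rightarrow> real^4" where
  "normal x = (let n = cross4 (F x) (tan 1 x) (tan 2 x) in (1 / sqrt (n \<bullet> n)) *\<^sub>R n)"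

lemma cross4_tan_pos:
  assumes "x \<in> V"
  shows "cross4 (F x) (tan 1 x) (tan 2 x) \<bullet> cross4 (F x) (tan 1 x) (tan 2 x) > 0"
  using metric_pos(2)[OF assms] assms
  by (simp add: cross4_inner_self on_sphere pos_inner_tan det_metric_def metric_eq)

lemma surface_normal: "surface V F g normal"
proof
  have sm: "smooth_on V (\<lambda>x. cross4 (F x) (tan 1 x) (tan 2 x))"
    by (intro smooth_on_cross4 open_V smooth smooth_tan)
  show "smooth_on V normal"
    unfolding normal_def Let_def
    by (intro smooth_on_scaleR smooth_on_divide smooth_on_const smooth_on_sqrt smooth_on_inner open_V sm cross4_tan_pos)
      (use cross4_tan_pos in fastforce)
  fix x assume x: "x \<in> V"
  let ?n = "cross4 (F x) (tan 1 x) (tan 2 x)"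
  show "normal x \<bullet> normal x = 1"
    using cross4_tan_pos[OF x] by (simp add: normal_def Let_def divide_simps real_sqrt_mult[symmetric])
  show "normal x \<bullet> F x = 0" by (simp add: normal_def Let_def cross4_orthogonal)
  show "normal x \<bullet> tan i x = 0" for i
    using exhaust_2[of i] by (elim disjE) (simp_all add: normal_def Let_def cross4_orthogonal)
qed

end

section \<open>Charts and gluing\<close>

context
  fixes T :: "'a topology" and c :: "('a, 'm::finite) chart"
  assumes chart: "is_chart T c"
begin

lemma cdom_subset: "cdom c \<subseteq> topspace T"
  using chart openin_subset by (auto simp: is_chart_def)

lemma open_cimage: "open (cimage c)"
  using chart by (simp add: is_chart_def)

lemma chart_homeomorphic: "homeomorphic_map (subtopology T (cdom c)) (top_of_set (cimage c)) (coord c)"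
  using chart by (simp add: is_chart_def)

lemma inj_on_coord: "inj_on (coord c) (cdom c)"
  using chart_homeomorphic cdom_subset by (simp add: homeomorphic_map_def Int_absorb1)

lemma param_coord: "p \<in> cdom c \<Longrightarrow> param c (coord c p) = p"
  by (simp add: param_def the_inv_into_f_f[OF inj_on_coord])

lemma coord_in_cimage: "p \<in> cdom c \<Longrightarrow> coord c p \<in> cimage c"
  by (simp add: cimage_def)

lemma coord_param: "x \<in> cimage c \<Longrightarrow> coord c (param c x) = x"
  by (auto simp: cimage_def param_coord)

lemma param_in_cdom: "x \<in> cimage c \<Longrightarrow> param c x \<in> cdom c"
  by (auto simp: cimage_def param_coord)

lemma open_coord_image:
  assumes "openin T S" shows "open (coord c ` (cdom c \<inter> S))"
proof -
  have "openin (subtopology T (cdom c)) (cdom c \<inter> S)"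
    using assms by (auto simp: openin_subtopology)
  then have "openin (top_of_set (cimage c)) (coord c ` (cdom c \<inter> S))"
    using homeomorphic_imp_open_map[OF chart_homeomorphic] by (simp add: open_map_def)
  then show ?thesis using openin_open_trans open_cimage by blast
qed

lemma openin_coord_vimage:
  assumes "open W" shows "openin T {p \<in> cdom c. coord c p \<in> W}"
proof -
  have "continuous_map (subtopology T (cdom c)) (top_of_set (cimage c)) (coord c)"
    using chart_homeomorphic by (rule homeomorphic_imp_continuous_map)
  then have "openin (subtopology T (cdom c)) {p \<in> topspace (subtopology T (cdom c)). coord c p \<in> cimage c \<inter> W}"
    using assms by (intro openin_continuous_map_preimage) auto
  moreover have "{p \<in> topspace (subtopology T (cdom c)). coord c p \<in> cimage c \<inter> W} = {p \<in> cdom c. coord c p \<in> W}"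
    using cdom_subset by (auto simp: cimage_def)
  ultimately show ?thesis
    using chart by (simp add: is_chart_def openin_open_subtopology)
qed

end

text \<open>The level sets \<open>E k\<close> are open, disjoint and cover the connected space, so
  only one of them is nonempty. \<open>R\<close> may take values in any normed space, which covers
  the trace, the vector \<open>C\<close> and the quadratic form.\<close>

lemma locally_constant_glue:
  fixes R :: "('a, 'm::finite) chart \<Rightarrow> real^'m \<Rightarrow> 'b::real_normed_vector"
  assumes M: "smooth_manifold M" "connected_space (mtop M)"
    and diff: "\<And>c x. c \<in> atlas M \<Longrightarrow> x \<in> cimage c \<Longrightarrow> R c differentiable (at x)"
    and deriv: "\<And>c x i. c \<in> atlas M \<Longrightarrow> x \<in> cimage c \<Longrightarrow> pderiv_at i (R c) x = 0"
    and agree: "\<And>c d p. c \<in> atlas M \<Longrightarrow> d \<in> atlas M \<Longrightarrow> p \<in> cdom c \<Longrightarrow> p \<in> cdom d \<Longrightarrow>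
      R c (coord c p) = R d (coord d p)"
  shows "\<exists>k. \<forall>c\<in>atlas M. \<forall>x\<in>cimage c. R c x = k"
proof -
  have chart: "is_chart (mtop M) c" if "c \<in> atlas M" for c
    using M(1) that by (simp add: smooth_manifold_def)
  have cover: "(\<Union>c\<in>atlas M. cdom c) = topspace (mtop M)" using M(1) by (simp add: smooth_manifold_def)
  define E where "E k = {p. \<exists>c\<in>atlas M. p \<in> cdom c \<and> R c (coord c p) = k}" for k
  have op: "openin (mtop M) (E k)" for k
  proof (subst openin_subopen, intro ballI)
    fix p assume "p \<in> E k"
    then obtain c where c: "c \<in> atlas M" "p \<in> cdom c" "R c (coord c p) = k" by (auto simp: E_def)
    note ch = chart[OF c(1)]
    obtain e where e: "e > 0" "ball (coord c p) e \<subseteq> cimage c"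
      using open_cimage[OF ch] coord_in_cimage[OF ch c(2)] open_contains_ball by blast
    have const: "R c y = k" if "y \<in> ball (coord c p) e" for y
    proof -
      have "(R c has_derivative (\<lambda>v. 0)) (at z within ball (coord c p) e)" if "z \<in> ball (coord c p) e" for z
      proof -
        have z: "z \<in> cimage c" using e that by auto
        have "(R c has_derivative (\<lambda>v. 0)) (at z)"
          using has_derivative_pderiv[OF diff[OF c(1) z]] by (simp add: deriv[OF c(1) z])
        then show ?thesis by (rule has_derivative_at_withinI)
      qed
      from has_derivative_zero_unique[OF convex_ball this that, of "coord c p"]
      show ?thesis using c(3) e(1) by simp
    qed
    show "\<exists>U. openin (mtop M) U \<and> p \<in> U \<and> U \<subseteq> E k"
      using openin_coord_vimage[OF ch, of "ball (coord c p) e"] c e const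
      by (intro exI[of _ "{q \<in> cdom c. coord c q \<in> ball (coord c p) e}"]) (auto simp: E_def)
  qed
  have un: "(\<Union>k. E k) = topspace (mtop M)" by (auto simp: E_def cover[symmetric])
  have disj: "E k \<inter> E k' = {}" if "k \<noteq> k'" for k k'
  proof (intro equals0I)
    fix p assume "p \<in> E k \<inter> E k'"
    then obtain c d where "c \<in> atlas M" "p \<in> cdom c" "R c (coord c p) = k"
      "d \<in> atlas M" "p \<in> cdom d" "R d (coord d p) = k'" unfolding E_def by blast
    then show False using agree[of c d p] that by simp
  qed
  show ?thesis
  proof (cases "topspace (mtop M) = {}")
    case True
    then have "cimage c = {}" if "c \<in> atlas M" for c using cover that by (auto simp: cimage_def)
    then show ?thesis by auto
  next
    case False
    then obtain k where k: "E k \<noteq> {}" using un by blast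
    have "E k \<union> (\<Union>k'\<in>- {k}. E k') = topspace (mtop M)" using un by (auto simp del: UN_simps)
    \<comment> \<open>A separation into one level set and the union of all others.\<close>
    moreover have "E k \<inter> (\<Union>k'\<in>- {k}. E k') = {}" using disj by auto
    moreover have "openin (mtop M) (\<Union>k'\<in>- {k}. E k')" using op by blast
    ultimately have empty: "(\<Union>k'\<in>- {k}. E k') = {}"
      using M(2) op[of k] k unfolding connected_space_eq by metis
    have "R c x = k" if "c \<in> atlas M" "x \<in> cimage c" for c x
    proof (rule ccontr)
      assume "R c x \<noteq> k"
      moreover have "param c x \<in> E (R c x)"
        unfolding E_def
        by (intro CollectI bexI[of _ c] conjI param_in_cdom[OF chart[OF that(1)] that(2)] that(1))
          (simp add: coord_param[OF chart[OF that(1)] that(2)])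
      ultimately have "param c x \<in> (\<Union>k'\<in>- {k}. E k')" by (intro UN_I[of "R c x"]) simp_all
      then show False unfolding empty by simp
    qed
    then show ?thesis by (intro exI[of _ k] ballI)
  qed
qed

section \<open>Stereographic charts of the 3-sphere\<close>

text \<open>For \<open>s = 1\<close> or \<open>s = - 1\<close>, stereographic projection from the
  point with fourth coordinate \<open>- s\<close>, the only one that the chart misses.\<close>

definition stereo :: "real \<Rightarrow> real^4 \<Rightarrow> real^3" where
  "stereo s z = (1 / (1 + s * z $ 4)) *\<^sub>R vector [z $ 1, z $ 2, z $ 3]"

definition stereo_inv :: "real \<Rightarrow> real^3 \<Rightarrow> real^4" where
  "stereo_inv s y = (1 / (1 + y \<bullet> y)) *\<^sub>R vector [2 * y $ 1, 2 * y $ 2, 2 * y $ 3, s * (1 - y \<bullet> y)]"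

definition stereo_chart :: "real \<Rightarrow> (real^4, 3) chart" where
  "stereo_chart s = ({z \<in> sphere 0 1. 1 + s * z $ 4 > 0}, stereo s)"

lemma stereo_nth:
  "stereo s z $ 1 = z $ 1 / (1 + s * z $ 4)" "stereo s z $ 2 = z $ 2 / (1 + s * z $ 4)"
  "stereo s z $ 3 = z $ 3 / (1 + s * z $ 4)"
  by (simp_all add: stereo_def)

lemma stereo_inv_nth:
  "stereo_inv s y $ 1 = 2 * y $ 1 / (1 + y \<bullet> y)" "stereo_inv s y $ 2 = 2 * y $ 2 / (1 + y \<bullet> y)"
  "stereo_inv s y $ 3 = 2 * y $ 3 / (1 + y \<bullet> y)" "stereo_inv s y $ 4 = s * (1 - y \<bullet> y) / (1 + y \<bullet> y)"
  by (simp_all add: stereo_inv_def)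

lemma stereo_denom_pos: "1 + y \<bullet> y > (0::real)" for y :: "real^3"
  by (simp add: add_pos_nonneg)

lemma stereo_inverse:
  assumes "s\<^sup>2 = 1"
  shows "stereo_inv s y \<in> cdom (stereo_chart s)" "stereo s (stereo_inv s y) = y"
    "z \<in> cdom (stereo_chart s) \<Longrightarrow> stereo_inv s (stereo s z) = z"
proof -
  let ?d = "1 + y \<bullet> y"
  have d: "?d > 0" by (rule stereo_denom_pos)
  have yy: "y \<bullet> y = (y $ 1)\<^sup>2 + (y $ 2)\<^sup>2 + (y $ 3)\<^sup>2"
    by (simp add: inner_vec_def sum_3 power2_eq_square)
  have s4: "1 + s * stereo_inv s y $ 4 = 2 / ?d"
    using d assms by (simp add: stereo_inv_nth field_simps power2_eq_square)
  have "stereo_inv s y \<bullet> stereo_inv s y = ((2 * y $ 1)\<^sup>2 + (2 * y $ 2)\<^sup>2 + (2 * y $ 3)\<^sup>2 + s\<^sup>2 * (1 - y \<bullet> y)\<^sup>2) / ?d\<^sup>2"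
    using d by (simp add: inner_vec_def sum_4 stereo_inv_nth power2_eq_square add_divide_distrib)
  also have "(2 * y $ 1)\<^sup>2 + (2 * y $ 2)\<^sup>2 + (2 * y $ 3)\<^sup>2 + s\<^sup>2 * (1 - y \<bullet> y)\<^sup>2 = ?d\<^sup>2"
    unfolding assms yy by algebra
  finally have "stereo_inv s y \<bullet> stereo_inv s y = 1" using d by simp
  then show "stereo_inv s y \<in> cdom (stereo_chart s)"
    using d s4 by (simp add: stereo_chart_def norm_eq_1)
  show "stereo s (stereo_inv s y) = y"
    using d by (simp add: vec_eq_iff forall_3 stereo_nth s4) (simp add: stereo_inv_nth)
  show "stereo_inv s (stereo s z) = z" if "z \<in> cdom (stereo_chart s)"
  proof -
    define e where "e = 1 + s * z $ 4"
    have e: "e > 0" "z \<bullet> z = 1" using that by (auto simp: stereo_chart_def norm_eq_1 e_def)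
    have zz: "(z $ 1)\<^sup>2 + (z $ 2)\<^sup>2 + (z $ 3)\<^sup>2 = e * (2 - e)"
      using e(2) assms unfolding e_def inner_vec_def sum_4 inner_real_def by algebra
    have "stereo s z \<bullet> stereo s z = ((z $ 1)\<^sup>2 + (z $ 2)\<^sup>2 + (z $ 3)\<^sup>2) / e\<^sup>2"
      by (simp add: inner_vec_def sum_3 stereo_nth e_def[symmetric] power2_eq_square add_divide_distrib)
    from this[unfolded zz] have ss: "stereo s z \<bullet> stereo s z = (2 - e) / e"
      using e by (simp add: power2_eq_square)
    have D: "1 + stereo s z \<bullet> stereo s z = 2 / e" "1 - stereo s z \<bullet> stereo s z = 2 * (e - 1) / e"
      using e by (simp_all add: ss field_simps)
    have "s * (2 * e - 2) = z $ 4 * 2" using assms by (simp add: e_def power2_eq_square)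
    then show ?thesis
      using e by (simp add: vec_eq_iff forall_4 stereo_inv_nth D) (simp add: stereo_nth e_def[symmetric])
  qed
qed

lemma stereo_chart_simps:
  assumes "s\<^sup>2 = 1"
  shows "cimage (stereo_chart s) = UNIV" "param (stereo_chart s) = stereo_inv s"
proof -
  note inv = stereo_inverse[OF assms]
  have c: "coord (stereo_chart s) = stereo s" by (simp add: stereo_chart_def)
  show "cimage (stereo_chart s) = UNIV"
    unfolding cimage_def c using inv by (metis UNIV_eq_I image_eqI)
  show "param (stereo_chart s) = stereo_inv s"
  proof
    fix y
    have "inj_on (stereo s) (cdom (stereo_chart s))" using inv(3) by (metis inj_onI)
    from the_inv_into_f_f[OF this inv(1)[of y]] show "param (stereo_chart s) y = stereo_inv s y"
      by (simp add: param_def c inv(2))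
  qed
qed

lemma smooth_stereo_inv: "smooth_on UNIV (stereo_inv s)"
proof (rule smooth_on_vecI[OF open_UNIV])
  have "\<forall>k. smooth_on UNIV (\<lambda>y. stereo_inv s y $ k)"
    unfolding forall_4 stereo_inv_nth
    by (intro conjI smooth_on_divide smooth_on_mult smooth_on_diff smooth_on_add smooth_on_const smooth_on_nth
        smooth_on_inner smooth_on_ident open_UNIV) (use stereo_denom_pos less_imp_neq in \<open>fastforce+\<close>)
  then show "smooth_on UNIV (\<lambda>y. stereo_inv s y $ k)" for k by blast
qed

lemma stereo_chart_in_atlas:
  assumes "s\<^sup>2 = 1" shows "stereo_chart s \<in> atlas S3"
proof -
  let ?c = "stereo_chart s"
  note inv = stereo_inverse[OF assms] and sc = stereo_chart_simps[OF assms]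
  have c: "coord ?c = stereo s" by (simp add: stereo_chart_def)
  have "open {z :: real^4. 1 + s * z $ 4 > 0}" by (intro open_Collect_less continuous_intros)
  moreover have "cdom ?c = sphere 0 1 \<inter> {z. 1 + s * z $ 4 > 0}" by (auto simp: stereo_chart_def)
  ultimately have op: "openin (top_of_set (sphere 0 1)) (cdom ?c)" by (metis openin_open_Int)
  have diff_inv: "stereo_inv s differentiable (at y)" for y
    by (rule smooth_on_differentiable_at[OF smooth_stereo_inv open_UNIV]) simp
  have diff: "(\<lambda>z. stereo s z $ k) differentiable (at z)" if "1 + s * z $ 4 > 0" for z k
  proof -
    have "(\<lambda>z. z $ j) differentiable (at z)" for j :: 4
      using bounded_linear_vec_nth[of j] bounded_linear_imp_differentiable by blast
    then have "\<forall>k. (\<lambda>z. stereo s z $ k) differentiable (at z)"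
      unfolding forall_3 stereo_nth using that
      by (intro conjI differentiable_divide differentiable_add differentiable_mult differentiable_const) auto
    then show ?thesis by blast
  qed
  have "continuous_on (cdom ?c) (stereo s)"
  proof (rule continuous_on_vec_lambda[of _ "\<lambda>k z. stereo s z $ k", simplified])
    show "continuous_on (cdom ?c) (\<lambda>z. stereo s z $ k)" for k
    proof (intro continuous_at_imp_continuous_on ballI)
      fix z assume "z \<in> cdom ?c"
      then have "1 + s * z $ 4 > 0" by (simp add: stereo_chart_def)
      from differentiable_imp_continuous_within[OF diff[OF this]] show "isCont (\<lambda>z. stereo s z $ k) z" .
    qed
  qed
  moreover have "continuous_on UNIV (stereo_inv s)"
    using diff_inv differentiable_imp_continuous_within by (intro continuous_at_imp_continuous_on) blast
  ultimately have "homeomorphic_maps (top_of_set (cdom ?c)) (top_of_set UNIV) (stereo s) (stereo_inv s)"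
    using inv by (auto simp: homeomorphic_maps_def continuous_map_in_subtopology)
  then have "homeomorphic_map (top_of_set (cdom ?c)) (top_of_set UNIV) (stereo s)"
    using homeomorphic_map_maps by blast
  moreover have "subtopology (top_of_set (sphere 0 1)) (cdom ?c) = top_of_set (cdom ?c)"
    using op openin_subset[OF op] by (simp add: subtopology_subtopology Int_absorb1)
  ultimately have "is_chart (top_of_set (sphere 0 1)) ?c"
    using op by (simp add: is_chart_def sc c)
  \<comment> \<open>Each component of \<open>stereo s\<close> is differentiable and
    \<open>stereo s\<close> is a left inverse, so the chain rule recovers \<open>v\<close> from its
    image.\<close>
  moreover have "inj (frechet_derivative (stereo_inv s) (at y))" for y
  proof -
    let ?D = "frechet_derivative (stereo_inv s) (at y)"
    have lin: "linear ?D" by (rule linear_frechet_derivative[OF diff_inv])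
    have "v = 0" if v: "?D v = 0" for v
    proof -
      have "v $ k = 0" for k
      proof -
        have "1 + s * stereo_inv s y $ 4 > 0" using inv(1)[of y] by (simp add: stereo_chart_def)
        from diff[OF this, of k] obtain L where L: "((\<lambda>z. stereo s z $ k) has_derivative L) (at (stereo_inv s y))"
          by (auto simp: differentiable_def)
        have "((\<lambda>y. stereo s (stereo_inv s y) $ k) has_derivative (\<lambda>v. L (?D v))) (at y)"
          using diff_chain_at[OF diff_inv[unfolded frechet_derivative_works] L] by (simp add: o_def)
        then have "((\<lambda>y. y $ k) has_derivative (\<lambda>v. L (?D v))) (at y)" by (simp add: inv(2))
        moreover have "((\<lambda>y. y $ k) has_derivative (\<lambda>v. v $ k)) (at y)"
          by (rule bounded_linear_imp_has_derivative[OF bounded_linear_vec_nth])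
        ultimately have "L (?D v) = v $ k" using has_derivative_unique by metis
        then show ?thesis using v linear_0[OF has_derivative_linear[OF L]] by simp
      qed
      then show ?thesis by (simp add: vec_eq_iff)
    qed
    then show ?thesis by (simp add: linear_injective_0[OF lin])
  qed
  ultimately show ?thesis
    by (simp add: S3_def induced_riem_def sc smooth_stereo_inv)
qed

text \<open>The conditions on \<open>\<phi>\<close> speak of charts of \<open>S3\<close> around
  \<open>\<phi> p\<close>; without such a chart they would be vacuous at \<open>p\<close>.\<close>

lemma S3_chart_exists:
  assumes "z \<in> sphere 0 1" shows "\<exists>d\<in>atlas S3. z \<in> cdom d"
proof (cases "z $ 4 > -1")
  case True
  then show ?thesis
    using assms stereo_chart_in_atlas[of 1] by (intro bexI[of _ "stereo_chart 1"]) (auto simp: stereo_chart_def)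
next
  case False
  then show ?thesis
    using assms stereo_chart_in_atlas[of "-1"] by (intro bexI[of _ "stereo_chart (-1)"]) (auto simp: stereo_chart_def)
qed

lemma sphere_chart_S3:
  assumes "d \<in> atlas S3" shows "sphere_chart (cimage d) (param d) (metric S3 d)"
proof
  have d: "is_chart (top_of_set (sphere 0 1)) d" "smooth_on (cimage d) (param d)"
    "\<And>x. x \<in> cimage d \<Longrightarrow> inj (frechet_derivative (param d) (at x))"
    using assms by (auto simp: S3_def induced_riem_def)
  show op: "open (cimage d)" by (rule open_cimage[OF d(1)])
  show "smooth_on (cimage d) (param d)" by (rule d(2))
  fix x assume x: "x \<in> cimage d"
  show "metric S3 d x $ i $ j = pderiv_at i (param d) x \<bullet> pderiv_at j (param d) x" for i j
    by (simp add: S3_def induced_riem_def)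
  show "param d x \<bullet> param d x = 1"
    using param_in_cdom[OF d(1) x] cdom_subset[OF d(1)] by (auto simp: norm_eq_1)
  have df: "param d differentiable (at x)" by (rule smooth_on_differentiable_at[OF d(2) op x])
  show "v = 0" if "(\<Sum>i\<in>UNIV. v $ i *\<^sub>R pderiv_at i (param d) x) = 0" for v
    using that d(3)[OF x] linear_injective_0[OF linear_frechet_derivative[OF df]]
    by (simp add: frechet_derivative_eq_sum[OF df])
qed simp

section \<open>The classification\<close>

lemma spherical_immersion_subset:
  assumes "spherical_immersion V \<Psi> g" "open U" "U \<subseteq> V"
  shows "spherical_immersion U \<Psi> g"
proof -
  interpret spherical_immersion V \<Psi> g by fact
  show ?thesis
    using assms(2,3) smooth_on_subset[OF smooth]
    by unfold_locales (auto intro: metric_eq independent_tangents on_sphere)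
qed

lemma jacobian_nth:
  fixes f :: "real^'m::finite \<Rightarrow> real^'n::finite"
  shows "jacobian f (at x) $ a $ i = pderiv_at i f x $ a"
  by (simp add: jacobian_def matrix_def pderiv_at_def)

text \<open>\<open>\<kappa>\<close> is the Gauss curvature, half of the scalar curvature.\<close>

locale c_biharmonic_immersion =
  fixes M :: "('a, 2) riem" and \<phi> :: "'a \<Rightarrow> real^4" and \<kappa> :: real
  assumes hypersurface: "c_biharmonic_hypersurface M S3 \<phi>"
    and scal_const: "c \<in> atlas M \<Longrightarrow> p \<in> cdom c \<Longrightarrow> scal (metric M c) (coord c p) = 2 * \<kappa>"
begin

abbreviation F :: "('a, 2) chart \<Rightarrow> real^2 \<Rightarrow> real^4" where
  "F c \<equiv> \<lambda>x. \<phi> (param c x)"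

definition overlap :: "('a, 2) chart \<Rightarrow> (real^4, 3) chart \<Rightarrow> (real^2) set" where
  "overlap c d = coord c ` {p \<in> cdom c. \<phi> p \<in> cdom d}"

lemma manifold: "smooth_manifold M"
  using hypersurface by (simp add: c_biharmonic_hypersurface_def riemannian_manifold_def)

lemma chart: "c \<in> atlas M \<Longrightarrow> is_chart (mtop M) c"
  using manifold by (simp add: smooth_manifold_def)

lemma chart_at: "p \<in> topspace (mtop M) \<Longrightarrow> \<exists>c\<in>atlas M. p \<in> cdom c"
  using manifold unfolding smooth_manifold_def by blast

lemma chart_S3: "d \<in> atlas S3 \<Longrightarrow> is_chart (mtop S3) d"
  by (simp add: S3_def induced_riem_def)

lemma metric_M:
  assumes "c \<in> atlas M" "x \<in> cimage c"
  shows "v \<noteq> 0 \<Longrightarrow> v \<bullet> (metric M c x *v v) > 0"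
  using hypersurface assms by (simp add: c_biharmonic_hypersurface_def riemannian_manifold_def)

lemma smooth_map_\<phi>: "smooth_map M S3 \<phi>"
  using hypersurface by (simp add: c_biharmonic_hypersurface_def c_biharmonic_def)

lemma continuous_\<phi>: "continuous_map (mtop M) (mtop S3) \<phi>"
  using smooth_map_\<phi> by (simp add: smooth_map_def)

lemma \<phi>_in_sphere: "p \<in> topspace (mtop M) \<Longrightarrow> \<phi> p \<in> sphere 0 1"
  using continuous_\<phi> by (auto simp: continuous_map_def S3_def induced_riem_def)

lemma S3_chart_at:
  assumes "c \<in> atlas M" "p \<in> cdom c" shows "\<exists>d\<in>atlas S3. \<phi> p \<in> cdom d"
  using S3_chart_exists \<phi>_in_sphere cdom_subset[OF chart[OF assms(1)]] assms(2) by blast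

lemma overlap_iff:
  assumes "c \<in> atlas M" shows "x \<in> overlap c d \<longleftrightarrow> x \<in> cimage c \<and> \<phi> (param c x) \<in> cdom d"
proof
  show "x \<in> cimage c \<and> \<phi> (param c x) \<in> cdom d" if "x \<in> overlap c d"
    using that by (auto simp: overlap_def param_coord[OF chart[OF assms]] coord_in_cimage[OF chart[OF assms]])
  show "x \<in> overlap c d" if "x \<in> cimage c \<and> \<phi> (param c x) \<in> cdom d"
    using that coord_param[OF chart[OF assms], of x] param_in_cdom[OF chart[OF assms], of x]
    by (force simp: overlap_def)
qed

lemma overlap_at:
  assumes "c \<in> atlas M" "x \<in> cimage c" obtains d where "d \<in> atlas S3" "x \<in> overlap c d"
  using S3_chart_at[OF assms(1) param_in_cdom[OF chart[OF assms(1)] assms(2)]] assms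
  by (auto simp: overlap_iff)

lemma open_overlap:
  assumes "c \<in> atlas M" "d \<in> atlas S3" shows "open (overlap c d)"
proof -
  have "openin (mtop S3) (cdom d)" using chart_S3[OF assms(2)] by (simp add: is_chart_def)
  then have "openin (mtop M) {p \<in> topspace (mtop M). \<phi> p \<in> cdom d}"
    by (rule openin_continuous_map_preimage[OF continuous_\<phi>])
  from open_coord_image[OF chart[OF assms(1)] this]
  have "open (coord c ` (cdom c \<inter> {p \<in> topspace (mtop M). \<phi> p \<in> cdom d}))" .
  moreover have "cdom c \<inter> {p \<in> topspace (mtop M). \<phi> p \<in> cdom d} = {p \<in> cdom c. \<phi> p \<in> cdom d}"
    using cdom_subset[OF chart[OF assms(1)]] by auto
  ultimately show ?thesis by (simp add: overlap_def)
qed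

lemma local_rep_overlap:
  assumes "c \<in> atlas M" "d \<in> atlas S3"
  shows "smooth_on (overlap c d) (local_rep c d \<phi>)"
    "x \<in> overlap c d \<Longrightarrow> local_rep c d \<phi> x \<in> cimage d"
    "x \<in> overlap c d \<Longrightarrow> F c x = param d (local_rep c d \<phi> x)"
  using smooth_map_\<phi> assms param_coord[OF chart_S3[OF assms(2)]] coord_in_cimage[OF chart_S3[OF assms(2)]]
  by (auto simp: smooth_map_def overlap_def[symmetric] local_rep_def overlap_iff)

lemma smooth_F_overlap:
  assumes "c \<in> atlas M" "d \<in> atlas S3" shows "smooth_on (overlap c d) (F c)"
proof -
  interpret T: sphere_chart "cimage d" "param d" "metric S3 d" by (rule sphere_chart_S3[OF assms(2)])
  note lr = local_rep_overlap[OF assms] and op = open_overlap[OF assms]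
  have "smooth_on (overlap c d) (\<lambda>x. param d (local_rep c d \<phi> x))"
    by (rule smooth_on_compose[OF op T.open_V _ T.smooth lr(1)]) (use lr(2) in auto)
  then show ?thesis by (rule smooth_on_cong[OF op lr(3)[symmetric], rotated])
qed

lemma pderiv_F:
  assumes "c \<in> atlas M" "d \<in> atlas S3" "x \<in> overlap c d"
  shows "pderiv_at i (F c) x =
    (\<Sum>a\<in>UNIV. pderiv_at i (local_rep c d \<phi>) x $ a *\<^sub>R pderiv_at a (param d) (local_rep c d \<phi> x))"
proof -
  interpret T: sphere_chart "cimage d" "param d" "metric S3 d" by (rule sphere_chart_S3[OF assms(2)])
  note lr = local_rep_overlap[OF assms(1,2)] and op = open_overlap[OF assms(1,2)]
  have "pderiv_at i (F c) x = pderiv_at i (\<lambda>x. param d (local_rep c d \<phi> x)) x"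
    by (rule pderiv_at_cong[OF op assms(3) lr(3)])
  then show ?thesis
    using T.differentiable_\<Psi>[OF lr(2)[OF assms(3)]] smooth_on_differentiable_at[OF lr(1) op assms(3)]
    by (simp add: pderiv_at_compose)
qed

lemma metric_M_eq:
  assumes c: "c \<in> atlas M" and x: "x \<in> cimage c"
  shows "metric M c x $ i $ j = pderiv_at i (F c) x \<bullet> pderiv_at j (F c) x"
proof -
  obtain d where d: "d \<in> atlas S3" "x \<in> overlap c d" using overlap_at[OF c x] by blast
  interpret T: sphere_chart "cimage d" "param d" "metric S3 d" by (rule sphere_chart_S3[OF d(1)])
  let ?f = "local_rep c d \<phi>" and ?p = "param c x"
  have p: "?p \<in> cdom c" "coord c ?p = x" "\<phi> ?p \<in> cdom d"
    using param_in_cdom[OF chart[OF c] x] coord_param[OF chart[OF c] x] d(2) overlap_iff[OF c] by auto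
  have "metric M c (coord c ?p) = transpose (jacobian ?f (at (coord c ?p))) ** metric S3 d (coord d (\<phi> ?p))
      ** jacobian ?f (at (coord c ?p))"
    using hypersurface c d(1) p unfolding c_biharmonic_hypersurface_def isometric_immersion_def Let_def by blast
  then have "metric M c x = transpose (jacobian ?f (at x)) ** metric S3 d (?f x) ** jacobian ?f (at x)"
    by (simp add: p(2) local_rep_def)
  then have "metric M c x $ i $ j =
      (\<Sum>b\<in>UNIV. (\<Sum>a\<in>UNIV. pderiv_at i ?f x $ a * metric S3 d (?f x) $ a $ b) * pderiv_at j ?f x $ b)"
    by (simp add: matrix_matrix_mult_def transpose_def jacobian_nth)
  also have "\<dots> = pderiv_at i (F c) x \<bullet> pderiv_at j (F c) x"
    using local_rep_overlap(2)[OF c d(1,2)]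
    by (simp add: pderiv_F[OF c d] inner_sum_left inner_sum_right T.metric_eq sum_distrib_left sum_distrib_right mult_ac)
  finally show ?thesis .
qed

lemma spherical_surface_F:
  assumes c: "c \<in> atlas M" shows "spherical_surface (cimage c) (F c) (metric M c)"
proof
  show "open (cimage c)" by (rule open_cimage[OF chart[OF c]])
  show "smooth_on (cimage c) (F c)"
  proof (rule smooth_on_local)
    fix x assume "x \<in> cimage c"
    then obtain d where "d \<in> atlas S3" "x \<in> overlap c d" using overlap_at[OF c] by blast
    then show "\<exists>W. open W \<and> x \<in> W \<and> smooth_on W (F c)"
      using open_overlap[OF c] smooth_F_overlap[OF c] by blast
  qed
  fix x assume x: "x \<in> cimage c"
  show "metric M c x $ i $ j = pderiv_at i (F c) x \<bullet> pderiv_at j (F c) x" for i j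
    by (rule metric_M_eq[OF c x])
  show "v = 0" if "(\<Sum>i\<in>UNIV. v $ i *\<^sub>R pderiv_at i (F c) x) = 0" for v
  proof -
    \<comment> \<open>The metric evaluates the squared length of the image vector, so positive
      definiteness gives independence.\<close>
    have "v \<bullet> (metric M c x *v v) = (\<Sum>i\<in>UNIV. v $ i *\<^sub>R pderiv_at i (F c) x) \<bullet> (\<Sum>i\<in>UNIV. v $ i *\<^sub>R pderiv_at i (F c) x)"
      by (simp add: matrix_inner_sum metric_M_eq[OF c x] sum_2 inner_add_left inner_add_right algebra_simps)
    then show ?thesis using that metric_M[OF c x, of v] by fastforce
  qed
  show "F c x \<bullet> F c x = 1"
    using \<phi>_in_sphere cdom_subset[OF chart[OF c]] param_in_cdom[OF chart[OF c] x] by (auto simp: norm_eq_1)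
qed

abbreviation \<eta> :: "('a, 2) chart \<Rightarrow> real^2 \<Rightarrow> real^4" where
  "\<eta> c \<equiv> spherical_surface.normal (F c)"

lemma surface_F:
  assumes "c \<in> atlas M" shows "surface (cimage c) (F c) (metric M c) (\<eta> c)"
  by (rule spherical_surface.surface_normal[OF spherical_surface_F[OF assms]])

lemma scal_M:
  assumes "c \<in> atlas M" "x \<in> cimage c" shows "scal (metric M c) x = 2 * \<kappa>"
  using scal_const[OF assms(1) param_in_cdom[OF chart[OF assms(1)] assms(2)]]
  by (simp add: coord_param[OF chart[OF assms(1)] assms(2)])

lemma c_biharmonic_surface_F:
  assumes c: "c \<in> atlas M" shows "c_biharmonic_surface (cimage c) (F c) (metric M c) (\<eta> c) \<kappa>"
proof -
  interpret S: surface "cimage c" "F c" "metric M c" "\<eta> c" by (rule surface_F[OF c])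
  \<comment> \<open>The scalar curvature determines the determinant of h by the Gauss equation; the
    Ricci operator is then \<open>\<kappa>\<close> times the identity.\<close>
  have D: "S.det_sff x = \<kappa> - 1" if "x \<in> cimage c" for x
    using S.curvature_surface(2)[OF that] scal_M[OF c that] by simp
  show ?thesis
  proof
    fix x assume x: "x \<in> cimage c"
    show "S.det_sff x = \<kappa> - 1" by (rule D[OF x])
    obtain d where d: "d \<in> atlas S3" "x \<in> overlap c d" using overlap_at[OF c x] by blast
    interpret T: sphere_chart "cimage d" "param d" "metric S3 d" by (rule sphere_chart_S3[OF d(1)])
    interpret U: spherical_immersion "overlap c d" "F c" "metric M c"
      by (rule spherical_immersion_subset[OF S.spherical_immersion_axioms open_overlap[OF c d(1)]])
        (auto simp: overlap_iff[OF c])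
    interpret m: map_into_sphere "cimage d" "param d" "metric S3 d" "overlap c d" "F c" "metric M c" "local_rep c d \<phi>"
      by unfold_locales (use local_rep_overlap[OF c d(1)] in auto)
    let ?p = "param c x"
    have p: "?p \<in> cdom c" "coord c ?p = x" "\<phi> ?p \<in> cdom d"
      using param_in_cdom[OF chart[OF c] x] coord_param[OF chart[OF c] x] d(2) overlap_iff[OF c] by auto
    have 0: "c_bitension (metric M c) (metric S3 d) (local_rep c d \<phi>) x = 0"
      using hypersurface c d(1) p unfolding c_biharmonic_hypersurface_def c_biharmonic_def by metis
    have "pderiv_at l (scal (metric M c)) x = pderiv_at l (\<lambda>_. 2 * \<kappa>) x" for l
      by (rule pderiv_at_cong[OF S.open_V x scal_M[OF c]])
    then have "grad (metric M c) (scal (metric M c)) x = 0"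
      by (simp add: grad_def vec_eq_iff matrix_vector_mult_def)
    \<comment> \<open>\<open>push\<close> maps the vanishing c-bitension field to zero; the leading
      2 is the dimension of the surface.\<close>
    from m.push_c_bitension[OF d(2) _ this, of \<kappa>]
    have "S.bitension_expr (2 + 2 * \<kappa> - 2 / 3 * scal (metric M c) x) x = 0"
      using S.curvature_surface(1)[OF x] D[OF x] linear_0[OF m.linear_push, of x]
      by (simp add: 0 S.bitension_expr_def)
    then show "S.bitension_expr (2 + 2 * \<kappa> / 3) x = 0" by (simp add: scal_M[OF c x] add.commute)
  qed
qed

section \<open>Change of charts on the surface\<close>

lemma pderiv_change_of_chart:
  fixes R :: "('a, 2) chart \<Rightarrow> real^2 \<Rightarrow> 'b::real_normed_vector"
  assumes c: "c \<in> atlas M" and d: "d \<in> atlas M" and p: "p \<in> cdom c" "p \<in> cdom d"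
    and diff: "R d differentiable (at (coord d p))"
    and agree: "\<And>q. q \<in> cdom c \<Longrightarrow> q \<in> cdom d \<Longrightarrow> R c (coord c q) = R d (coord d q)"
  shows "pderiv_at i (R c) (coord c p) =
    (\<Sum>k\<in>UNIV. jacobian (transition c d) (at (coord c p)) $ k $ i *\<^sub>R pderiv_at k (R d) (coord d p))"
proof -
  let ?U = "coord c ` (cdom c \<inter> cdom d)"
  have "openin (mtop M) (cdom d)" using chart[OF d] by (simp add: is_chart_def)
  then have U: "open ?U" "coord c p \<in> ?U" using open_coord_image[OF chart[OF c]] p by blast+
  have tr: "transition c d (coord c q) = coord d q" if "q \<in> cdom c" for q
    by (simp add: transition_def param_coord[OF chart[OF c] that])
  have "smooth_on ?U (transition c d)" using manifold c d by (simp add: smooth_manifold_def)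
  then have "transition c d differentiable (at (coord c p))" by (rule smooth_on_differentiable_at[OF _ U])
  moreover have "pderiv_at i (R c) (coord c p) = pderiv_at i (\<lambda>x. R d (transition c d x)) (coord c p)"
    by (rule pderiv_at_cong[OF U]) (auto simp: tr agree)
  ultimately show ?thesis
    using diff by (simp add: pderiv_at_compose tr p jacobian_nth)
qed

context
  fixes c d p
  assumes c: "c \<in> atlas M" and d: "d \<in> atlas M" and p: "p \<in> cdom c" "p \<in> cdom d"
begin

abbreviation J :: "real^2^2" where "J \<equiv> jacobian (transition c d) (at (coord c p))"

lemma tan_change:
  "pderiv_at i (F c) (coord c p) = (\<Sum>k\<in>UNIV. J $ k $ i *\<^sub>R pderiv_at k (F d) (coord d p))"
proof (rule pderiv_change_of_chart[OF c d p, of F])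
  interpret spherical_surface "cimage d" "F d" "metric M d" by (rule spherical_surface_F[OF d])
  show "F d differentiable (at (coord d p))" by (rule differentiable_\<Psi>[OF coord_in_cimage[OF chart[OF d] p(2)]])
qed (simp add: param_coord[OF chart[OF c]] param_coord[OF chart[OF d]])

text \<open>This is where the orientation enters: a positive Jacobian determinant cancels when the
  cross product is normalized.\<close>

lemma normal_change: "\<eta> c (coord c p) = \<eta> d (coord d p)"
proof -
  interpret C: spherical_surface "cimage c" "F c" "metric M c" by (rule spherical_surface_F[OF c])
  interpret D: spherical_surface "cimage d" "F d" "metric M d" by (rule spherical_surface_F[OF d])
  have det: "det J > 0"
    using hypersurface c d p by (simp add: c_biharmonic_hypersurface_def oriented_def)
  let ?n = "cross4 (F d (coord d p)) (D.tan 1 (coord d p)) (D.tan 2 (coord d p))"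
  have "cross4 (F c (coord c p)) (C.tan 1 (coord c p)) (C.tan 2 (coord c p)) = det J *\<^sub>R ?n"
    by (simp add: tan_change sum_2 cross4_change_basis det_2 param_coord[OF chart[OF c] p(1)]
        param_coord[OF chart[OF d] p(2)] mult.commute)
  then show ?thesis
    using det by (simp add: C.normal_def D.normal_def Let_def norm_eq_sqrt_inner[symmetric])
qed

end

lemma pderiv_normal_change:
  assumes c: "c \<in> atlas M" and d: "d \<in> atlas M" and p: "p \<in> cdom c" "p \<in> cdom d"
  shows "pderiv_at i (\<eta> c) (coord c p) =
    (\<Sum>k\<in>UNIV. jacobian (transition c d) (at (coord c p)) $ k $ i *\<^sub>R pderiv_at k (\<eta> d) (coord d p))"
proof (rule pderiv_change_of_chart[OF c d p, of \<eta>])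
  interpret surface "cimage d" "F d" "metric M d" "\<eta> d" by (rule surface_F[OF d])
  show "\<eta> d differentiable (at (coord d p))" by (rule differentiable_\<eta>[OF coord_in_cimage[OF chart[OF d] p(2)]])
qed (rule normal_change[OF c d])

abbreviation chart_trace :: "('a, 2) chart \<Rightarrow> real^2 \<Rightarrow> real" where
  "chart_trace c \<equiv> surface.trace_sff (F c) (metric M c) (\<eta> c)"

lemma in_image:
  assumes "c \<in> atlas M" "x \<in> cimage c" shows "F c x \<in> \<phi> ` topspace (mtop M)"
  using param_in_cdom[OF chart[OF assms(1)] assms(2)] cdom_subset[OF chart[OF assms(1)]] by blast

lemma openin_image:
  assumes S: "\<And>c x. c \<in> atlas M \<Longrightarrow> x \<in> cimage c \<Longrightarrow> F c x \<in> S"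
    and U: "\<And>c x. c \<in> atlas M \<Longrightarrow> x \<in> cimage c \<Longrightarrow> \<exists>U. open U \<and> F c x \<in> U \<and> U \<inter> S \<subseteq> F c ` cimage c"
  shows "openin (top_of_set S) (\<phi> ` topspace (mtop M))"
proof (subst openin_subopen, intro ballI)
  fix z assume "z \<in> \<phi> ` topspace (mtop M)"
  then obtain c p where c: "c \<in> atlas M" and p: "p \<in> cdom c" "z = \<phi> p"
    using chart_at by blast
  have x: "coord c p \<in> cimage c" "F c (coord c p) = z"
    using coord_in_cimage[OF chart[OF c] p(1)] param_coord[OF chart[OF c] p(1)] p(2) by auto
  obtain U where "open U" "z \<in> U" "U \<inter> S \<subseteq> F c ` cimage c" using U[OF c x(1)] x(2) by auto
  then show "\<exists>T. openin (top_of_set S) T \<and> z \<in> T \<and> T \<subseteq> \<phi> ` topspace (mtop M)"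
    using in_image[OF c] S[OF c x(1)] x(2) by (intro exI[of _ "S \<inter> U"]) (auto simp: Int_commute)
qed

lemma umbilic_case:
  assumes \<kappa>: "\<kappa> = 1 \<or> \<kappa> = 3"
  shows "\<exists>a C. C \<bullet> C = 1 + a\<^sup>2 \<and> a\<^sup>2 = \<kappa> - 1 \<and>
    openin (top_of_set {z. z \<bullet> z = 1 \<and> z \<bullet> C = a}) (\<phi> ` topspace (mtop M))"
proof (cases "topspace (mtop M) = {}")
  case True
  \<comment> \<open>With no points there are no constants to glue, and any vector \<open>C\<close>
    of the required length is a witness.\<close>
  have "1 + (sqrt (\<kappa> - 1))\<^sup>2 = \<kappa>" "(sqrt (\<kappa> - 1))\<^sup>2 = \<kappa> - 1" using \<kappa> by auto
  moreover have "(sqrt \<kappa> *\<^sub>R axis 1 1 :: real^4) \<bullet> (sqrt \<kappa> *\<^sub>R axis 1 1) = \<kappa>"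
    using \<kappa> by (auto simp: inner_axis_axis)
  ultimately show ?thesis using True by (intro exI[of _ "sqrt (\<kappa> - 1)"] exI[of _ "sqrt \<kappa> *\<^sub>R axis 1 1"]) simp
next
  case False
  have eq: "(chart_trace c x)\<^sup>2 = 4 * (\<kappa> - 1)" and
    pd: "pderiv_at i (\<eta> c) x = - (chart_trace c x / 2) *\<^sub>R pderiv_at i (F c) x" if "c \<in> atlas M" "x \<in> cimage c" for c x i
  proof -
    interpret c_biharmonic_surface "cimage c" "F c" "metric M c" "\<eta> c" \<kappa> by (rule c_biharmonic_surface_F[OF that(1)])
    show e: "(chart_trace c x)\<^sup>2 = 4 * (\<kappa> - 1)" using local_cases[OF that(2)] \<kappa> by auto
    then show "pderiv_at i (\<eta> c) x = - (chart_trace c x / 2) *\<^sub>R pderiv_at i (F c) x"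
      using umbilic_pderiv_\<eta>[OF that(2)] gauss_curvature[OF that(2)] by simp
  qed
  \<comment> \<open>No transformation law for h is needed: in each chart the derivative of the
    common normal is \<open>- u / 2\<close> times that of \<open>F\<close>, and comparison along one
    nonzero tangent vector identifies u.\<close>
  have trace_agree: "chart_trace c (coord c p) = chart_trace d (coord d p)"
    if c: "c \<in> atlas M" and d: "d \<in> atlas M" and p: "p \<in> cdom c" "p \<in> cdom d" for c d p
  proof -
    interpret spherical_surface "cimage c" "F c" "metric M c" by (rule spherical_surface_F[OF c])
    have x: "coord c p \<in> cimage c" "coord d p \<in> cimage d"
      using coord_in_cimage[OF chart[OF c] p(1)] coord_in_cimage[OF chart[OF d] p(2)] .
    have "- (chart_trace c (coord c p) / 2) *\<^sub>R tan 1 (coord c p) = - (chart_trace d (coord d p) / 2) *\<^sub>R tan 1 (coord c p)"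
      using pderiv_normal_change[OF c d p, of 1]
      by (simp add: pd[OF c x(1)] pd[OF d x(2)] tan_change[OF c d p, of 1] sum_2 algebra_simps)
    moreover have "tan 1 (coord c p) \<noteq> 0"
      using metric_pos(1)[OF x(1)] metric_eq[OF x(1), of 1 1] by auto
    ultimately show ?thesis by simp
  qed
  have deriv: "chart_trace c differentiable (at x)" "pderiv_at i (chart_trace c) x = 0"
    "(\<lambda>y. \<eta> c y + (chart_trace c y / 2) *\<^sub>R F c y) differentiable (at x)"
    "pderiv_at i (\<lambda>y. \<eta> c y + (chart_trace c y / 2) *\<^sub>R F c y) x = 0"
    if "c \<in> atlas M" "x \<in> cimage c" for c x i
  proof -
    interpret c_biharmonic_surface "cimage c" "F c" "metric M c" "\<eta> c" \<kappa> by (rule c_biharmonic_surface_F[OF that(1)])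
    show "chart_trace c differentiable (at x)" "pderiv_at i (chart_trace c) x = 0"
      "pderiv_at i (\<lambda>y. \<eta> c y + (chart_trace c y / 2) *\<^sub>R F c y) x = 0"
      using differentiable_trace_sff pderiv_trace_sff_0 umbilic_centre[OF \<kappa>] that(2) by blast+
    show "(\<lambda>y. \<eta> c y + (chart_trace c y / 2) *\<^sub>R F c y) differentiable (at x)"
      using that(2) differentiable_bounded_linear[OF bounded_linear_divide[of 2] differentiable_trace_sff[OF that(2)]]
      by (simp add: differentiable_\<eta> differentiable_\<Psi> differentiable_scaleR')
  qed
  have conn: "connected_space (mtop M)" using hypersurface by (simp add: c_biharmonic_hypersurface_def)
  obtain u where u: "\<And>c x. c \<in> atlas M \<Longrightarrow> x \<in> cimage c \<Longrightarrow> chart_trace c x = u"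
    using locally_constant_glue[OF manifold conn, of chart_trace] deriv(1,2) trace_agree by metis
  obtain C where C: "\<And>c x. c \<in> atlas M \<Longrightarrow> x \<in> cimage c \<Longrightarrow> \<eta> c x + (chart_trace c x / 2) *\<^sub>R F c x = C"
    using locally_constant_glue[OF manifold conn, of "\<lambda>c x. \<eta> c x + (chart_trace c x / 2) *\<^sub>R F c x"] deriv(3,4)
      trace_agree normal_change param_coord[OF chart] by (smt (verit))
  define a where "a = u / 2"
  have Ca: "\<eta> c x + a *\<^sub>R F c x = C" if "c \<in> atlas M" "x \<in> cimage c" for c x
    using C[OF that] u[OF that] by (simp add: a_def)
  have S: "F c x \<in> {z. z \<bullet> z = 1 \<and> z \<bullet> C = a}" and CC: "C \<bullet> C = 1 + a\<^sup>2" and aa: "a\<^sup>2 = \<kappa> - 1"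
    if "c \<in> atlas M" "x \<in> cimage c" for c x
  proof -
    interpret surface "cimage c" "F c" "metric M c" "\<eta> c" by (rule surface_F[OF that(1)])
    show "F c x \<in> {z. z \<bullet> z = 1 \<and> z \<bullet> C = a}" "C \<bullet> C = 1 + a\<^sup>2"
      using that(2) by (simp_all add: Ca[OF that, symmetric] frame_inner inner_add_left inner_add_right power2_eq_square)
    show "a\<^sup>2 = \<kappa> - 1" using eq[OF that] u[OF that] by (simp add: a_def power_divide)
  qed
  have "openin (top_of_set {z. z \<bullet> z = 1 \<and> z \<bullet> C = a}) (\<phi> ` topspace (mtop M))"
  proof (rule openin_image[OF S])
    fix c x assume cx: "c \<in> atlas M" "x \<in> cimage c"
    interpret surface "cimage c" "F c" "metric M c" "\<eta> c" by (rule surface_F[OF cx(1)])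
    show "\<exists>U. open U \<and> F c x \<in> U \<and> U \<inter> {z. z \<bullet> z = 1 \<and> z \<bullet> C = a} \<subseteq> F c ` cimage c"
      by (rule open_image_umbilic[OF cx(2) Ca[OF cx, symmetric]]) (use S[OF cx(1)] in auto)
  qed
  moreover obtain c p where c: "c \<in> atlas M" and p: "p \<in> cdom c" using False chart_at by blast
  note x = coord_in_cimage[OF chart[OF c] p]
  ultimately show ?thesis using CC[OF c x] aa[OF c x] by blast
qed

abbreviation chart_form :: "real^4 \<Rightarrow> ('a, 2) chart \<Rightarrow> real^2 \<Rightarrow> real" where
  "chart_form z c \<equiv> surface.frame_form (F c) (metric M c) (\<eta> c) z"

lemma flat_case:
  assumes \<kappa>: "\<kappa> = 0" and ne: "topspace (mtop M) \<noteq> {}"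
  shows "open_part_up_to_isometry (\<phi> ` topspace (mtop M)) (product_torus (1 / sqrt 2) (1 / sqrt 2))"
proof -
  have agree: "chart_form z c (coord c p) = chart_form z d (coord d p)"
    if c: "c \<in> atlas M" and d: "d \<in> atlas M" and p: "p \<in> cdom c" "p \<in> cdom d" for z c d p
  proof -
    interpret C: c_biharmonic_surface "cimage c" "F c" "metric M c" "\<eta> c" \<kappa> by (rule c_biharmonic_surface_F[OF c])
    interpret D: c_biharmonic_surface "cimage d" "F d" "metric M d" "\<eta> d" \<kappa> by (rule c_biharmonic_surface_F[OF d])
    let ?x = "coord c p" and ?y = "coord d p"
    have x: "?x \<in> cimage c" and y: "?y \<in> cimage d"
      using coord_in_cimage[OF chart[OF c] p(1)] coord_in_cimage[OF chart[OF d] p(2)] .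
    \<comment> \<open>The differential of the normal, extended by zero to the normal directions. The
      last summand of \<open>frame_form\<close> is \<open>z \<bullet> ?L z\<close>, and expanding
      \<open>z\<close> in the frame of chart \<open>c\<close> shows that \<open>?L\<close> does not
      depend on the chart.\<close>
    let ?L = "\<lambda>w. \<Sum>k\<in>UNIV. (w \<bullet> D.dual k ?y) *\<^sub>R pderiv_at k (\<eta> d) ?y"
    have pos: "F c ?x = F d ?y" by (simp add: param_coord[OF chart[OF c] p(1)] param_coord[OF chart[OF d] p(2)])
    note \<eta> = normal_change[OF c d p]
    have lin: "linear ?L"
      by (rule linearI) (simp_all add: inner_add_left scaleR_add_left sum.distrib scaleR_sum_right)
    have Ltan: "?L (C.tan k ?x) = pderiv_at k (\<eta> c) ?x" for k
      unfolding tan_change[OF c d p] pderiv_normal_change[OF c d p]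
      using y by (simp add: linear_sum[OF lin] linear_cmul[OF lin] D.tan_inner_dual inner_sum_left)
    have "?L z = ?L ((z \<bullet> F c ?x) *\<^sub>R F c ?x + (z \<bullet> \<eta> c ?x) *\<^sub>R \<eta> c ?x + (\<Sum>k\<in>UNIV. (z \<bullet> C.dual k ?x) *\<^sub>R C.tan k ?x))"
      by (simp only: C.frame_expansion[OF x, symmetric])
    also have "\<dots> = (z \<bullet> F c ?x) *\<^sub>R ?L (F c ?x) + (z \<bullet> \<eta> c ?x) *\<^sub>R ?L (\<eta> c ?x)
        + (\<Sum>k\<in>UNIV. (z \<bullet> C.dual k ?x) *\<^sub>R ?L (C.tan k ?x))"
      by (simp only: linear_add[OF lin] linear_cmul[OF lin] linear_sum[OF lin])
    also have "?L (F c ?x) = 0" unfolding pos using D.dual_pos[OF y] by (simp add: inner_commute)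
    also have "?L (\<eta> c ?x) = 0" unfolding \<eta> using D.dual_\<eta>[OF y] by (simp add: inner_commute)
    finally have "?L z = (\<Sum>k\<in>UNIV. (z \<bullet> C.dual k ?x) *\<^sub>R pderiv_at k (\<eta> c) ?x)" by (simp only: Ltan scaleR_zero_right add_0)
    then have "z \<bullet> ?L z = z \<bullet> (\<Sum>k\<in>UNIV. (z \<bullet> C.dual k ?x) *\<^sub>R pderiv_at k (\<eta> c) ?x)" by simp
    then show ?thesis
      \<comment> \<open>In the flat case u vanishes in both charts, which disposes of the trace
        term.\<close>
      using C.flat_frame_form(1)[OF \<kappa> x] D.flat_frame_form(1)[OF \<kappa> y]
      by (simp add: C.frame_form_def D.frame_form_def pos \<eta> inner_sum_right)
  qed
  have conn: "connected_space (mtop M)" using hypersurface by (simp add: c_biharmonic_hypersurface_def)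
  have "\<exists>k. \<forall>c\<in>atlas M. \<forall>x\<in>cimage c. chart_form z c x = k" for z
  proof (rule locally_constant_glue[OF manifold conn])
    fix c x assume cx: "c \<in> atlas M" "x \<in> cimage c"
    interpret c_biharmonic_surface "cimage c" "F c" "metric M c" "\<eta> c" \<kappa> by (rule c_biharmonic_surface_F[OF cx(1)])
    show "chart_form z c differentiable (at x)"
      by (rule smooth_on_differentiable_at[OF smooth_frame_form open_V cx(2)])
    show "pderiv_at i (chart_form z c) x = 0" for i by (rule flat_frame_form(2)[OF \<kappa> cx(2)])
  qed (rule agree)
  then obtain q where q: "\<And>z c x. c \<in> atlas M \<Longrightarrow> x \<in> cimage c \<Longrightarrow> chart_form z c x = q z" by metis
  have S: "F c x \<in> {z. z \<bullet> z = 1 \<and> q z = 0}" if "c \<in> atlas M" "x \<in> cimage c" for c x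
  proof -
    interpret c_biharmonic_surface "cimage c" "F c" "metric M c" "\<eta> c" \<kappa> by (rule c_biharmonic_surface_F[OF that(1)])
    have "F c x \<bullet> dual k x = 0" for k by (subst inner_commute) (rule dual_pos[OF that(2)])
    then have "chart_form (F c x) c x = 0" using that(2) by (simp add: frame_form_def frame_inner)
    then show ?thesis using q[OF that] on_sphere[OF that(2)] by simp
  qed
  have op: "openin (top_of_set {z. z \<bullet> z = 1 \<and> q z = 0}) (\<phi> ` topspace (mtop M))"
  proof (rule openin_image[OF S])
    fix c x assume cx: "c \<in> atlas M" "x \<in> cimage c"
    interpret c_biharmonic_surface "cimage c" "F c" "metric M c" "\<eta> c" \<kappa> by (rule c_biharmonic_surface_F[OF cx(1)])
    show "\<exists>U. open U \<and> F c x \<in> U \<and> U \<inter> {z. z \<bullet> z = 1 \<and> q z = 0} \<subseteq> F c ` cimage c"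
      using open_image_clifford[OF cx(2) flat_frame_form(1)[OF \<kappa> cx(2)]] S[OF cx(1)]
      unfolding q[OF cx] by blast
  qed
  obtain c p where cp: "c \<in> atlas M" "p \<in> cdom c" using ne chart_at by blast
  then have x: "coord c p \<in> cimage c" using coord_in_cimage[OF chart] by blast
  interpret c_biharmonic_surface "cimage c" "F c" "metric M c" "\<eta> c" \<kappa> by (rule c_biharmonic_surface_F[OF cp(1)])
  obtain A :: "real^4 \<Rightarrow> real^4" where "orthogonal_transformation A"
    "\<And>z. q z = (A z $ 1)\<^sup>2 + (A z $ 2)\<^sup>2 - (A z $ 3)\<^sup>2 - (A z $ 4)\<^sup>2"
    using clifford_axes[OF x flat_frame_form(1)[OF \<kappa> x]] gauss_curvature[OF x] \<kappa> q[OF cp(1) x] by auto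
  then show ?thesis by (rule open_part_clifford[OF op])
qed

lemma classification:
  "open_part_up_to_isometry (\<phi> ` topspace (mtop M)) totally_geodesic_S2
    \<or> open_part_up_to_isometry (\<phi> ` topspace (mtop M)) (small_S2 (1 / sqrt 3))
    \<or> open_part_up_to_isometry (\<phi> ` topspace (mtop M)) (product_torus (1 / sqrt 2) (1 / sqrt 2))"
proof (cases "topspace (mtop M) = {}")
  case True
  then show ?thesis
    \<comment> \<open>An empty surface satisfies the definitions; its empty image is open in any
      model.\<close>
    unfolding open_part_up_to_isometry_def by (intro disjI1 exI[of _ "\<lambda>x. x"]) simp
next
  case False
  then obtain c p where cp: "c \<in> atlas M" "p \<in> cdom c" using chart_at by blast
  interpret c_biharmonic_surface "cimage c" "F c" "metric M c" "\<eta> c" \<kappa> by (rule c_biharmonic_surface_F[OF cp(1)])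
  have "\<kappa> = 0 \<or> \<kappa> = 1 \<or> \<kappa> = 3" using local_cases[OF coord_in_cimage[OF chart[OF cp(1)] cp(2)]] by auto
  then show ?thesis
  proof (elim disjE)
    assume "\<kappa> = 0" then show ?thesis using flat_case False by blast
  next
    assume "\<kappa> = 1"
    then obtain a C where "C \<bullet> C = 1 + a\<^sup>2" "a = 0"
      "openin (top_of_set {z. z \<bullet> z = 1 \<and> z \<bullet> C = a}) (\<phi> ` topspace (mtop M))"
      using umbilic_case by auto
    then show ?thesis using open_part_umbilic(1) by blast
  next
    assume "\<kappa> = 3"
    then obtain a C where "C \<bullet> C = 1 + a\<^sup>2" "a\<^sup>2 = 2"
      "openin (top_of_set {z. z \<bullet> z = 1 \<and> z \<bullet> C = a}) (\<phi> ` topspace (mtop M))"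
      using umbilic_case by auto
    then show ?thesis using open_part_umbilic(2) by blast
  qed
qed

end

theorem theorem1p2:
  fixes M :: "('a, 2) riem" and \<phi> :: "'a \<Rightarrow> real^4"
  assumes "c_biharmonic_hypersurface M S3 \<phi>"
    and "constant_scalar_curvature M"
  shows "open_part_up_to_isometry (\<phi> ` topspace (mtop M)) totally_geodesic_S2
       \<or> open_part_up_to_isometry (\<phi> ` topspace (mtop M)) (small_S2 (1 / sqrt 3))
       \<or> open_part_up_to_isometry (\<phi> ` topspace (mtop M)) (product_torus (1 / sqrt 2) (1 / sqrt 2))"
proof -
  obtain K where "\<forall>c\<in>atlas M. \<forall>p\<in>cdom c. scal (metric M c) (coord c p) = K"
    using assms(2) by (auto simp: constant_scalar_curvature_def)
  \<comment> \<open>\<open>K\<close> is here the scalar curvature, twice the Gauss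
    curvature.\<close>
  then interpret c_biharmonic_immersion M \<phi> "K / 2"
    using assms(1) by unfold_locales auto
  show ?thesis by (rule classification)
qed

end
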